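(* Let $G$ be a locally profinite group, $G^\natural$ a $G$-twisted space, $\omega$ a character of $G$, and $\delta_1\in G^\natural$ an element such that there is a fundamental system $\mathcal K_1$ of neighborhoods of $1$ in $G$ consisting of open compact subgroups $K$ with $\omega|_K=1$ and ${\rm Int}_{G^\natural}(\delta_1)(K)=K$. Let $K\in\mathcal K_1$ and let $W$ be a simple non-degenerate $(\mathcal H_K^\natural,\omega)$-module such that the socle of the $\mathcal H_K$-module $W$ is nonzero. Then the $\mathcal H_K$-module $W$ is semisimple, and there exists an irreducible smooth $\omega$-representation $(\Pi,V)$ of $G^\natural$ such that the $(\mathcal H_K^\natural,\omega)$-module $V^K$ is isomorphic to $W$. Moreover, the representation $\Pi^\circ$ of $G$ is semisimple, and it is of finite length (resp. irreducible) if and only if the $\mathcal H_K$-module $W$ is of finite length (resp. simple).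
   Context: A $G$-twisted space is a topological space $G^\natural$ with a continuous left action of $G$ such that $g\mapsto g\cdot\delta$ is a homeomorphism $G\to G^\natural$ for each $\delta$, together with a map ${\rm Int}_{G^\natural}:G^\natural\to{\rm Aut}(G)$ with ${\rm Int}_{G^\natural}(g\cdot\delta)={\rm Int}_G(g)\circ{\rm Int}_{G^\natural}(\delta)$; the right action is $\delta\cdot g={\rm Int}_{G^\natural}(\delta)(g)\cdot\delta$. Characters are continuous morphisms to $\mathbb C^\times$. A smooth $\omega$-representation of $G^\natural$ is a smooth complex representation $(\pi,V)$ of $G$ with a map $\Pi:G^\natural\to{\rm Aut}_{\mathbb C}(V)$ with $\Pi(x\cdot\gamma\cdot y)=\omega(y)\pi(x)\Pi(\gamma)\pi(y)$; $\pi=\Pi^\circ$. It is irreducible if $V\neq 0$ and the only nonzero subspace $V'$ with $\Pi(\delta)(V')=V'$ for all $\delta\in G^\natural$ is $V$. Fix a left Haar measure $d_lg$ on $G$ and let $d_l\delta$ be its image on $G^\natural$ under $g\mapsto\delta_0\cdot g$ (independent of $\delta_0\in G^\natural$). For an open compact subgroup $K$ of $G$ with $\omega|_K=1$: $\mathcal H_K=C_{\rm c}(K\backslash G/K)$ is the Hecke algebra with convolution $f*f'(x)=\int_Gf(g)f'(g^{-1}x)d_lg$; $\mathcal H_K^\natural=C_{\rm c}(K\backslash G^\natural/K)$ is the $\mathcal H_K$-bimodule with $f*\phi(\delta)=\int_Gf(g)\phi(g^{-1}\cdot\delta)d_lg$ and $\phi*f(\delta)=\int_G\phi(\delta\cdot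 g)f(g^{-1})d_lg$. An $(\mathcal H_K^\natural,\omega)$-module is a left $\mathcal H_K$-module $W$ with a linear map $\mathcal H_K^\natural\to{\rm End}_{\mathbb C}(W)$, $\phi\mapsto(w\mapsto\phi\cdot w)$, with $(f*\phi*f')\cdot w=f\cdot(\phi\cdot(\omega f'\cdot w))$ for $f,f'\in\mathcal H_K$, $\phi\in\mathcal H_K^\natural$, where $\omega f'$ is the pointwise product. Morphisms are $\mathcal H_K$-linear maps commuting with the action of $\mathcal H_K^\natural$. $W$ is non-degenerate if $\mathcal H_K^\natural\cdot W=W$. A nonzero non-degenerate $W$ is simple if the only nonzero $\mathcal H_K$-submodule $W'$ of $W$ with $\mathcal H_K^\natural\cdot W'=W'$ is $W$ itself. For $(\Pi,V)$ smooth, $V^K$ (the $K$-fixed vectors) is an $(\mathcal H_K^\natural,\omega)$-module via $f\cdot v=\int_Gf(g)\pi(g)v\,d_lg$ and $\phi\cdot v=\int_{G^\natural}\phi(\delta)\Pi(\delta)v\,d_l\delta$.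
   Formalization: The formal theorem additionally assumes that no nonzero vector of W is killed by all of H_K^♮; without this the claim fails (G trivial, W with a surjective non-injective shift), and every V^K satisfies it. *)

theory Defs
  imports
    "HOL-Analysis.Analysis"
    "HOL-Algebra.Coset"
    "HOL-Library.Function_Algebras"
begin

record 'g topgroup = "'g monoid" +
  gtop :: "'g topology"

definition topological_group :: "'g topgroup \<Rightarrow> bool" where
  "topological_group G \<longleftrightarrow>
     group G \<and> topspace (gtop G) = carrier G \<and>
     continuous_map (prod_topology (gtop G) (gtop G)) (gtop G) (\<lambda>(x, y). x \<otimes>\<^bsub>G\<^esub> y) \<and>
     continuous_map (gtop G) (gtop G) (\<lambda>x. inv\<^bsub>G\<^esub> x)"

definition open_compact_subgroup :: "'g topgroup \<Rightarrow> 'g set \<Rightarrow> bool" where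
  "open_compact_subgroup G K \<longleftrightarrow>
     subgroup K G \<and> openin (gtop G) K \<and> compactin (gtop G) K"

definition locally_profinite :: "'g topgroup \<Rightarrow> bool" where
  "locally_profinite G \<longleftrightarrow>
     topological_group G \<and> Hausdorff_space (gtop G) \<and>
     (\<forall>U. openin (gtop G) U \<and> \<one>\<^bsub>G\<^esub> \<in> U \<longrightarrow> (\<exists>K\<subseteq>U. open_compact_subgroup G K))"

definition "character" :: "'g topgroup \<Rightarrow> ('g \<Rightarrow> complex) \<Rightarrow> bool" where
  "character G \<omega> \<longleftrightarrow>
     continuous_map (gtop G) euclidean \<omega> \<and>
     (\<forall>x\<in>carrier G. \<omega> x \<noteq> 0) \<and>
     (\<forall>x\<in>carrier G. \<forall>y\<in>carrier G. \<omega> (x \<otimes>\<^bsub>G\<^esub> y) = \<omega> x * \<omega> y)"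

record ('g, 'x) twisted =
  stop :: "'x topology"
  lact :: "'g \<Rightarrow> 'x \<Rightarrow> 'x"
  twist :: "'x \<Rightarrow> 'g \<Rightarrow> 'g"

text \<open>The elements of the twisted space are the points of \<^term>\<open>stop S\<close>, and
  \<^term>\<open>twist S \<delta>\<close> is the automorphism attached to \<open>\<delta>\<close>; automorphisms are those of the
  topological group.\<close>

definition twisted_space :: "'g topgroup \<Rightarrow> ('g, 'x) twisted \<Rightarrow> bool" where
  "twisted_space G S \<longleftrightarrow>
     continuous_map (prod_topology (gtop G) (stop S)) (stop S) (\<lambda>(g, \<delta>). lact S g \<delta>) \<and>
     (\<forall>\<delta>\<in>topspace (stop S). lact S \<one>\<^bsub>G\<^esub> \<delta> = \<delta>) \<and>
     (\<forall>g\<in>carrier G. \<forall>h\<in>carrier G. \<forall>\<delta>\<in>topspace (stop S).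
        lact S (g \<otimes>\<^bsub>G\<^esub> h) \<delta> = lact S g (lact S h \<delta>)) \<and>
     (\<forall>\<delta>\<in>topspace (stop S). homeomorphic_map (gtop G) (stop S) (\<lambda>g. lact S g \<delta>)) \<and>
     (\<forall>\<delta>\<in>topspace (stop S).
        twist S \<delta> \<in> iso G G \<and> homeomorphic_map (gtop G) (gtop G) (twist S \<delta>)) \<and>
     (\<forall>g\<in>carrier G. \<forall>\<delta>\<in>topspace (stop S). \<forall>x\<in>carrier G.
        twist S (lact S g \<delta>) x = g \<otimes>\<^bsub>G\<^esub> twist S \<delta> x \<otimes>\<^bsub>G\<^esub> inv\<^bsub>G\<^esub> g)"

definition ract :: "('g, 'x) twisted \<Rightarrow> 'x \<Rightarrow> 'g \<Rightarrow> 'x" where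
  "ract S \<delta> g = lact S (twist S \<delta> g) \<delta>"

definition adapted_system ::
  "'g topgroup \<Rightarrow> ('g, 'x) twisted \<Rightarrow> ('g \<Rightarrow> complex) \<Rightarrow> 'x \<Rightarrow> 'g set set \<Rightarrow> bool" where
  "adapted_system G S \<omega> \<delta>\<^sub>1 \<K> \<longleftrightarrow>
     (\<forall>K\<in>\<K>. open_compact_subgroup G K \<and> (\<forall>k\<in>K. \<omega> k = 1) \<and> twist S \<delta>\<^sub>1 ` K = K) \<and>
     (\<forall>U. openin (gtop G) U \<and> \<one>\<^bsub>G\<^esub> \<in> U \<longrightarrow> (\<exists>K\<in>\<K>. K \<subseteq> U))"

definition borel_sets :: "'a topology \<Rightarrow> 'a measure" where
  "borel_sets X = sigma (topspace X) {U. openin X U}"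

definition left_haar_measure :: "'g topgroup \<Rightarrow> 'g measure \<Rightarrow> bool" where
  "left_haar_measure G \<mu> \<longleftrightarrow>
     sets \<mu> = sets (borel_sets (gtop G)) \<and>
     emeasure \<mu> (space \<mu>) \<noteq> 0 \<and>
     (\<forall>C. compactin (gtop G) C \<longrightarrow> emeasure \<mu> C < \<infinity>) \<and>
     (\<forall>A\<in>sets \<mu>. emeasure \<mu> A = (INF U\<in>{U. openin (gtop G) U \<and> A \<subseteq> U}. emeasure \<mu> U)) \<and>
     (\<forall>U. openin (gtop G) U \<longrightarrow>
        emeasure \<mu> U = (SUP C\<in>{C. compactin (gtop G) C \<and> C \<subseteq> U}. emeasure \<mu> C)) \<and>
     (\<forall>g\<in>carrier G. \<forall>A\<in>sets \<mu>. emeasure \<mu> (g <#\<^bsub>G\<^esub> A) = emeasure \<mu> A)"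

text \<open>The image on the twisted space; it does not depend on the base point \<open>\<delta>\<^sub>0\<close>.\<close>

definition twisted_haar :: "('g, 'x) twisted \<Rightarrow> 'x \<Rightarrow> 'g measure \<Rightarrow> 'x measure" where
  "twisted_haar S \<delta>\<^sub>0 \<mu> = distr \<mu> (borel_sets (stop S)) (\<lambda>g. ract S \<delta>\<^sub>0 g)"

text \<open>Integral of a vector-valued function taking finitely many values. The vector space (with
  scalar multiplication \<open>s\<close>) carries no topology; all integrands below are locally constant with
  compact support.\<close>

definition simple_integral ::
  "(complex \<Rightarrow> 'v \<Rightarrow> 'v) \<Rightarrow> 'a measure \<Rightarrow> ('a \<Rightarrow> 'v::ab_group_add) \<Rightarrow> 'v" where
  "simple_integral s M F =
     (\<Sum>v\<in>F ` space M - {0}. s (of_real (measure M {x \<in> space M. F x = v})) v)"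

text \<open>\<open>s\<close> is the scalar multiplication of a complex vector space on the type \<open>'v\<close>, and \<open>V\<close> a
  subspace preserved by the operators in \<open>A\<close>. The operators will be those of a group
  representation or those of a module over a Hecke algebra.\<close>

definition invariant_subspace ::
  "(complex \<Rightarrow> 'v \<Rightarrow> 'v) \<Rightarrow> ('v \<Rightarrow> 'v) set \<Rightarrow> 'v::ab_group_add set \<Rightarrow> 'v set \<Rightarrow> bool" where
  "invariant_subspace s A V U \<longleftrightarrow>
     U \<subseteq> V \<and> module.subspace s U \<and> (\<forall>T\<in>A. T ` U \<subseteq> U)"

definition simple_under ::
  "(complex \<Rightarrow> 'v \<Rightarrow> 'v) \<Rightarrow> ('v \<Rightarrow> 'v) set \<Rightarrow> 'v::ab_group_add set \<Rightarrow> bool" where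
  "simple_under s A V \<longleftrightarrow>
     V \<noteq> {0} \<and> (\<forall>U. invariant_subspace s A V U \<longrightarrow> U = {0} \<or> U = V)"

definition socle ::
  "(complex \<Rightarrow> 'v \<Rightarrow> 'v) \<Rightarrow> ('v \<Rightarrow> 'v) set \<Rightarrow> 'v::ab_group_add set \<Rightarrow> 'v set" where
  "socle s A V = module.span s (\<Union>{U. invariant_subspace s A V U \<and> simple_under s A U})"

definition semisimple_under ::
  "(complex \<Rightarrow> 'v \<Rightarrow> 'v) \<Rightarrow> ('v \<Rightarrow> 'v) set \<Rightarrow> 'v::ab_group_add set \<Rightarrow> bool" where
  "semisimple_under s A V \<longleftrightarrow> socle s A V = V"

definition finite_length_under ::
  "(complex \<Rightarrow> 'v \<Rightarrow> 'v) \<Rightarrow> ('v \<Rightarrow> 'v) set \<Rightarrow> 'v::ab_group_add set \<Rightarrow> bool" where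
  "finite_length_under s A V \<longleftrightarrow>
     (\<exists>(n::nat) F. F 0 = {0} \<and> F n = V \<and>
        (\<forall>i\<le>n. invariant_subspace s A V (F i)) \<and>
        (\<forall>i<n. F i \<subset> F (Suc i) \<and>
           (\<forall>U. invariant_subspace s A V U \<and> F i \<subseteq> U \<and> U \<subseteq> F (Suc i) \<longrightarrow>
              U = F i \<or> U = F (Suc i))))"

definition linear_between ::
  "(complex \<Rightarrow> 'v \<Rightarrow> 'v) \<Rightarrow> 'v::ab_group_add set \<Rightarrow>
   (complex \<Rightarrow> 'w \<Rightarrow> 'w) \<Rightarrow> 'w::ab_group_add set \<Rightarrow> ('v \<Rightarrow> 'w) \<Rightarrow> bool" where
  "linear_between s V s' W f \<longleftrightarrow>
     f ` V \<subseteq> W \<and> (\<forall>u\<in>V. \<forall>v\<in>V. f (u + v) = f u + f v) \<and> (\<forall>c. \<forall>v\<in>V. f (s c v) = s' c (f v))"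

definition smooth_rep ::
  "'g topgroup \<Rightarrow> (complex \<Rightarrow> 'v \<Rightarrow> 'v) \<Rightarrow> 'v::ab_group_add set \<Rightarrow> ('g \<Rightarrow> 'v \<Rightarrow> 'v) \<Rightarrow> bool" where
  "smooth_rep G s V \<pi> \<longleftrightarrow>
     vector_space s \<and> module.subspace s V \<and>
     (\<forall>g\<in>carrier G. linear_between s V s V (\<pi> g)) \<and>
     (\<forall>v\<in>V. \<pi> \<one>\<^bsub>G\<^esub> v = v) \<and>
     (\<forall>g\<in>carrier G. \<forall>h\<in>carrier G. \<forall>v\<in>V. \<pi> (g \<otimes>\<^bsub>G\<^esub> h) v = \<pi> g (\<pi> h v)) \<and>
     (\<forall>v\<in>V. openin (gtop G) {g \<in> carrier G. \<pi> g v = v})"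

definition smooth_twisted_rep ::
  "'g topgroup \<Rightarrow> ('g, 'x) twisted \<Rightarrow> ('g \<Rightarrow> complex) \<Rightarrow>
   (complex \<Rightarrow> 'v \<Rightarrow> 'v) \<Rightarrow> 'v::ab_group_add set \<Rightarrow> ('g \<Rightarrow> 'v \<Rightarrow> 'v) \<Rightarrow> ('x \<Rightarrow> 'v \<Rightarrow> 'v) \<Rightarrow> bool" where
  "smooth_twisted_rep G S \<omega> s V \<pi> P \<longleftrightarrow>
     smooth_rep G s V \<pi> \<and>
     (\<forall>\<delta>\<in>topspace (stop S). linear_between s V s V (P \<delta>) \<and> bij_betw (P \<delta>) V V) \<and>
     (\<forall>x\<in>carrier G. \<forall>\<gamma>\<in>topspace (stop S). \<forall>y\<in>carrier G. \<forall>v\<in>V.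
        P (lact S x (ract S \<gamma> y)) v = s (\<omega> y) (\<pi> x (P \<gamma> (\<pi> y v))))"

definition irreducible_twisted ::
  "('g, 'x) twisted \<Rightarrow> (complex \<Rightarrow> 'v \<Rightarrow> 'v) \<Rightarrow> 'v::ab_group_add set \<Rightarrow> ('x \<Rightarrow> 'v \<Rightarrow> 'v) \<Rightarrow> bool" where
  "irreducible_twisted S s V P \<longleftrightarrow>
     V \<noteq> {0} \<and>
     (\<forall>U. module.subspace s U \<and> U \<subseteq> V \<and> U \<noteq> {0} \<and>
        (\<forall>\<delta>\<in>topspace (stop S). P \<delta> ` U = U) \<longrightarrow> U = V)"

definition fixed_vectors :: "'v set \<Rightarrow> ('g \<Rightarrow> 'v \<Rightarrow> 'v) \<Rightarrow> 'g set \<Rightarrow> 'v set" where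
  "fixed_vectors V \<pi> K = {v \<in> V. \<forall>k\<in>K. \<pi> k v = v}"

text \<open>Functions on the group (on the twisted space) are extended by zero to the whole type.\<close>

definition hecke :: "'g topgroup \<Rightarrow> 'g set \<Rightarrow> ('g \<Rightarrow> complex) set" where
  "hecke G K = {f.
     (\<forall>x. x \<notin> carrier G \<longrightarrow> f x = 0) \<and>
     continuous_map (gtop G) euclidean f \<and>
     compactin (gtop G) (gtop G closure_of {x \<in> carrier G. f x \<noteq> 0}) \<and>
     (\<forall>k\<in>K. \<forall>k'\<in>K. \<forall>x\<in>carrier G. f (k \<otimes>\<^bsub>G\<^esub> x \<otimes>\<^bsub>G\<^esub> k') = f x)}"

definition hecke_tw :: "('g, 'x) twisted \<Rightarrow> 'g set \<Rightarrow> ('x \<Rightarrow> complex) set" where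
  "hecke_tw S K = {\<phi>.
     (\<forall>\<delta>. \<delta> \<notin> topspace (stop S) \<longrightarrow> \<phi> \<delta> = 0) \<and>
     continuous_map (stop S) euclidean \<phi> \<and>
     compactin (stop S) (stop S closure_of {\<delta> \<in> topspace (stop S). \<phi> \<delta> \<noteq> 0}) \<and>
     (\<forall>k\<in>K. \<forall>k'\<in>K. \<forall>\<delta>\<in>topspace (stop S). \<phi> (lact S k (ract S \<delta> k')) = \<phi> \<delta>)}"

definition conv ::
  "'g topgroup \<Rightarrow> 'g measure \<Rightarrow> ('g \<Rightarrow> complex) \<Rightarrow> ('g \<Rightarrow> complex) \<Rightarrow> 'g \<Rightarrow> complex" where
  "conv G \<mu> f f' x =
     (if x \<in> carrier G then LINT g|\<mu>. f g * f' (inv\<^bsub>G\<^esub> g \<otimes>\<^bsub>G\<^esub> x) else 0)"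

definition lconv ::
  "'g topgroup \<Rightarrow> ('g, 'x) twisted \<Rightarrow> 'g measure \<Rightarrow>
   ('g \<Rightarrow> complex) \<Rightarrow> ('x \<Rightarrow> complex) \<Rightarrow> 'x \<Rightarrow> complex" where
  "lconv G S \<mu> f \<phi> \<delta> =
     (if \<delta> \<in> topspace (stop S) then LINT g|\<mu>. f g * \<phi> (lact S (inv\<^bsub>G\<^esub> g) \<delta>) else 0)"

definition rconv ::
  "'g topgroup \<Rightarrow> ('g, 'x) twisted \<Rightarrow> 'g measure \<Rightarrow>
   ('x \<Rightarrow> complex) \<Rightarrow> ('g \<Rightarrow> complex) \<Rightarrow> 'x \<Rightarrow> complex" where
  "rconv G S \<mu> \<phi> f \<delta> =
     (if \<delta> \<in> topspace (stop S) then LINT g|\<mu>. \<phi> (ract S \<delta> g) * f (inv\<^bsub>G\<^esub> g) else 0)"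

text \<open>Unitality of the action of the Hecke algebra is not required: for the non-degenerate modules
  considered here it is automatic.\<close>

definition hecke_module ::
  "'g topgroup \<Rightarrow> 'g measure \<Rightarrow> 'g set \<Rightarrow> (complex \<Rightarrow> 'w \<Rightarrow> 'w) \<Rightarrow> 'w::ab_group_add set \<Rightarrow>
   (('g \<Rightarrow> complex) \<Rightarrow> 'w \<Rightarrow> 'w) \<Rightarrow> bool" where
  "hecke_module G \<mu> K s W a \<longleftrightarrow>
     vector_space s \<and> module.subspace s W \<and>
     (\<forall>f\<in>hecke G K. linear_between s W s W (a f)) \<and>
     (\<forall>f\<in>hecke G K. \<forall>f'\<in>hecke G K. \<forall>w\<in>W. a (\<lambda>x. f x + f' x) w = a f w + a f' w) \<and>
     (\<forall>c. \<forall>f\<in>hecke G K. \<forall>w\<in>W. a (\<lambda>x. c * f x) w = s c (a f w)) \<and>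
     (\<forall>f\<in>hecke G K. \<forall>f'\<in>hecke G K. \<forall>w\<in>W. a (conv G \<mu> f f') w = a f (a f' w))"

definition twisted_hecke_module ::
  "'g topgroup \<Rightarrow> ('g, 'x) twisted \<Rightarrow> ('g \<Rightarrow> complex) \<Rightarrow> 'g measure \<Rightarrow> 'g set \<Rightarrow>
   (complex \<Rightarrow> 'w \<Rightarrow> 'w) \<Rightarrow> 'w::ab_group_add set \<Rightarrow>
   (('g \<Rightarrow> complex) \<Rightarrow> 'w \<Rightarrow> 'w) \<Rightarrow> (('x \<Rightarrow> complex) \<Rightarrow> 'w \<Rightarrow> 'w) \<Rightarrow> bool" where
  "twisted_hecke_module G S \<omega> \<mu> K s W a b \<longleftrightarrow>
     hecke_module G \<mu> K s W a \<and>
     (\<forall>\<phi>\<in>hecke_tw S K. linear_between s W s W (b \<phi>)) \<and>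
     (\<forall>\<phi>\<in>hecke_tw S K. \<forall>\<phi>'\<in>hecke_tw S K. \<forall>w\<in>W. b (\<lambda>\<delta>. \<phi> \<delta> + \<phi>' \<delta>) w = b \<phi> w + b \<phi>' w) \<and>
     (\<forall>c. \<forall>\<phi>\<in>hecke_tw S K. \<forall>w\<in>W. b (\<lambda>\<delta>. c * \<phi> \<delta>) w = s c (b \<phi> w)) \<and>
     (\<forall>f\<in>hecke G K. \<forall>\<phi>\<in>hecke_tw S K. \<forall>f'\<in>hecke G K. \<forall>w\<in>W.
        b (rconv G S \<mu> (lconv G S \<mu> f \<phi>) f') w = a f (b \<phi> (a (\<lambda>x. \<omega> x * f' x) w)))"

definition hecke_tw_span ::
  "('g, 'x) twisted \<Rightarrow> 'g set \<Rightarrow> (complex \<Rightarrow> 'w \<Rightarrow> 'w) \<Rightarrow>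
   (('x \<Rightarrow> complex) \<Rightarrow> 'w \<Rightarrow> 'w) \<Rightarrow> 'w::ab_group_add set \<Rightarrow> 'w set" where
  "hecke_tw_span S K s b U = module.span s {b \<phi> w |\<phi> w. \<phi> \<in> hecke_tw S K \<and> w \<in> U}"

definition nondegenerate ::
  "('g, 'x) twisted \<Rightarrow> 'g set \<Rightarrow> (complex \<Rightarrow> 'w \<Rightarrow> 'w) \<Rightarrow> 'w::ab_group_add set \<Rightarrow>
   (('x \<Rightarrow> complex) \<Rightarrow> 'w \<Rightarrow> 'w) \<Rightarrow> bool" where
  "nondegenerate S K s W b \<longleftrightarrow> hecke_tw_span S K s b W = W"

text \<open>Non-degeneracy does not exclude nonzero vectors killed by all \<^term>\<open>b \<phi>\<close>, not even for simple
  modules: for the trivial group acting on a point, a module is a vector space with one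
  endomorphism, and the surjective endomorphism \<open>e\<^sub>0 \<mapsto> 0, e\<^sub>n\<^sub>+\<^sub>1 \<mapsto> e\<^sub>n\<close> makes \<open>\<Oplus>\<^sub>n \<complex> e\<^sub>n\<close> simple in the
  sense below. Modules of fixed vectors of twisted representations have no such vectors.\<close>

definition no_killed_vectors ::
  "('g, 'x) twisted \<Rightarrow> 'g set \<Rightarrow> 'w::ab_group_add set \<Rightarrow> (('x \<Rightarrow> complex) \<Rightarrow> 'w \<Rightarrow> 'w) \<Rightarrow> bool" where
  "no_killed_vectors S K W b \<longleftrightarrow> (\<forall>w\<in>W. (\<forall>\<phi>\<in>hecke_tw S K. b \<phi> w = 0) \<longrightarrow> w = 0)"

definition simple_twisted ::
  "'g topgroup \<Rightarrow> ('g, 'x) twisted \<Rightarrow> 'g set \<Rightarrow> (complex \<Rightarrow> 'w \<Rightarrow> 'w) \<Rightarrow> 'w::ab_group_add set \<Rightarrow>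
   (('g \<Rightarrow> complex) \<Rightarrow> 'w \<Rightarrow> 'w) \<Rightarrow> (('x \<Rightarrow> complex) \<Rightarrow> 'w \<Rightarrow> 'w) \<Rightarrow> bool" where
  "simple_twisted G S K s W a b \<longleftrightarrow>
     W \<noteq> {0} \<and> nondegenerate S K s W b \<and>
     (\<forall>U. invariant_subspace s (a ` hecke G K) W U \<and> U \<noteq> {0} \<and> hecke_tw_span S K s b U = U \<longrightarrow>
        U = W)"

definition rep_hecke_action ::
  "'g measure \<Rightarrow> (complex \<Rightarrow> 'v \<Rightarrow> 'v) \<Rightarrow> ('g \<Rightarrow> 'v \<Rightarrow> 'v) \<Rightarrow>
   ('g \<Rightarrow> complex) \<Rightarrow> 'v::ab_group_add \<Rightarrow> 'v" where
  "rep_hecke_action \<mu> s \<pi> f v = simple_integral s \<mu> (\<lambda>g. s (f g) (\<pi> g v))"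

definition rep_hecke_tw_action ::
  "('g, 'x) twisted \<Rightarrow> 'x \<Rightarrow> 'g measure \<Rightarrow> (complex \<Rightarrow> 'v \<Rightarrow> 'v) \<Rightarrow> ('x \<Rightarrow> 'v \<Rightarrow> 'v) \<Rightarrow>
   ('x \<Rightarrow> complex) \<Rightarrow> 'v::ab_group_add \<Rightarrow> 'v" where
  "rep_hecke_tw_action S \<delta>\<^sub>0 \<mu> s P \<phi> v =
     simple_integral s (twisted_haar S \<delta>\<^sub>0 \<mu>) (\<lambda>\<delta>. s (\<phi> \<delta>) (P \<delta> v))"

definition twisted_modules_isomorphic ::
  "'g topgroup \<Rightarrow> ('g, 'x) twisted \<Rightarrow> 'g set \<Rightarrow>
   (complex \<Rightarrow> 'v \<Rightarrow> 'v) \<Rightarrow> 'v::ab_group_add set \<Rightarrow>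
   (('g \<Rightarrow> complex) \<Rightarrow> 'v \<Rightarrow> 'v) \<Rightarrow> (('x \<Rightarrow> complex) \<Rightarrow> 'v \<Rightarrow> 'v) \<Rightarrow>
   (complex \<Rightarrow> 'w \<Rightarrow> 'w) \<Rightarrow> 'w::ab_group_add set \<Rightarrow>
   (('g \<Rightarrow> complex) \<Rightarrow> 'w \<Rightarrow> 'w) \<Rightarrow> (('x \<Rightarrow> complex) \<Rightarrow> 'w \<Rightarrow> 'w) \<Rightarrow> bool" where
  "twisted_modules_isomorphic G S K s V a b s' W a' b' \<longleftrightarrow>
     (\<exists>h. linear_between s V s' W h \<and> bij_betw h V W \<and>
        (\<forall>f\<in>hecke G K. \<forall>v\<in>V. h (a f v) = a' f (h v)) \<and>
        (\<forall>\<phi>\<in>hecke_tw S K. \<forall>v\<in>V. h (b \<phi> v) = b' \<phi> (h v)))"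

text \<open>Pointwise scalar multiplication. An irreducible twisted representation with nonzero fixed
  vectors \<open>W\<close> under an adapted \<open>K\<close> embeds into the space of functions from the group
  to \<open>W\<close>, by sending \<open>v\<close> to \<open>g \<mapsto> e\<^sub>K \<pi>(g) v\<close> with \<open>e\<^sub>K\<close> the projection onto the fixed vectors.\<close>

definition fun_scale :: "(complex \<Rightarrow> 'w \<Rightarrow> 'w) \<Rightarrow> complex \<Rightarrow> ('a \<Rightarrow> 'w) \<Rightarrow> 'a \<Rightarrow> 'w" where
  "fun_scale s c F x = s c (F x)"

end

theory Submission
  imports Defs
begin

text \<open>Let \<open>\<theta>\<close> be the automorphism attached to \<open>\<delta>\<^sub>1\<close>, so that \<open>\<theta>(K) = K\<close>, and let \<open>e\<close> be the unit of the
  Hecke algebra. Since \<open>\<delta>\<^sub>1\<close> normalises \<open>K\<close>, the bimodule of functions on the twisted space is, as a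
  left module over the Hecke algebra, free of rank one on the normalised indicator function of
  \<open>K\<delta>\<^sub>1 = \<delta>\<^sub>1K\<close>. A twisted module is thus an ordinary module \<open>W\<close> with one additional operator \<open>T\<close>, the
  action of this generator, which satisfies \<open>\<omega>(g) T E(g) = E(\<theta> g) T\<close>, where \<open>E(g)\<close> is the action of
  the normalised indicator function of \<open>KgK\<close> (lemmas \<open>b_push\<close> and \<open>T_E_\<theta>\<close>). Non-degeneracy makes \<open>T\<close>
  surjective and the absence of killed vectors makes it injective (\<open>T_bijective\<close>). A simple twisted
  module is then one without proper nonzero submodule \<open>X\<close> such that \<open>T(X) = X\<close>. As \<open>T\<close> permutes the
  simple submodules, it preserves the socle, which is therefore zero or everything
  (\<open>W_semisimple\<close>).

  The representation \<open>V\<close> is the space of functions on the group spanned by the right translates of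
  \<open>x \<mapsto> E(x) w\<close> for \<open>w \<in> W\<close>. The value at \<open>1\<close> plays the role of the projection \<open>e\<close> to the \<open>K\<close>-fixed
  vectors (\<open>average_eq_emb\<close>). It follows that the \<open>K\<close>-fixed vectors of \<open>V\<close> are \<open>W\<close>
  (\<open>fixed_vectors_eq\<close>), and that every nonzero subrepresentation contains a nonzero \<open>K\<close>-fixed vector
  (\<open>subrep_trivial\<close>). When \<open>W\<close> is semisimple, complements in \<open>W\<close> show that passing to \<open>K\<close>-fixed
  vectors is an isomorphism between the ordered sets of subrepresentations of \<open>V\<close> and submodules of
  \<open>W\<close> (\<open>fixed_part_iso\<close>). Finite length and simplicity are properties of these ordered sets, so they
  pass between \<open>V\<close> and \<open>W\<close>. The simple submodules of \<open>W\<close> generate simple subrepresentations, so \<open>V\<close> is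
  semisimple.

  Finally, \<open>\<delta>\<^sub>1\<close> acts on \<open>V\<close> by the unique operator that extends \<open>T\<close> and is compatible with the action
  of the group (\<open>twisting\<close>), and \<open>x \<cdot> \<delta>\<^sub>1\<close> acts by its composition with \<open>\<pi>(x)\<close>. An invariant subspace
  of \<open>V\<close> for the twisted action has \<open>K\<close>-fixed vectors preserved by \<open>T\<close> and its inverse, so \<open>V\<close> is
  irreducible.

  All integrands are constant on left cosets of \<open>K\<close>, all of which have the same volume. Integrals
  are therefore finite sums over left cosets, and \<open>\<theta>\<close> preserves them because it permutes the left
  cosets of \<open>K\<close>.\<close>

section \<open>Subspaces invariant under a family of operators\<close>

locale complex_space = vector_space scale for scale :: "complex \<Rightarrow> 'b::ab_group_add \<Rightarrow> 'b"
begin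

text \<open>Simplicity of a subspace only depends on the invariant subspaces of the whole space. This lets
  different families of operators with the same invariant subspaces be exchanged.\<close>

lemma invariant_subspace_simple_iff:
  assumes "invariant_subspace scale A V N"
  shows "simple_under scale A N \<longleftrightarrow>
    N \<noteq> {0} \<and> (\<forall>U. invariant_subspace scale A V U \<and> U \<subseteq> N \<longrightarrow> U = {0} \<or> U = N)"
proof -
  have "invariant_subspace scale A N U \<longleftrightarrow> invariant_subspace scale A V U \<and> U \<subseteq> N" for U
    using assms by (auto simp: invariant_subspace_def)
  then show ?thesis by (simp add: simple_under_def)
qed

lemma invariant_subspace_Int:
  assumes "invariant_subspace scale A V U" "invariant_subspace scale A V U'"
  shows "invariant_subspace scale A V (U \<inter> U')"
  using assms subspace_inter unfolding invariant_subspace_def by blast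

lemma invariant_subspace_zero:
  assumes "subspace V" "\<forall>T\<in>A. linear_between scale V scale V T"
  shows "invariant_subspace scale A V {0}"
proof -
  have 0: "0 \<in> V" using assms(1) by (rule subspace_0)
  have "T 0 = 0" if "T \<in> A" for T
  proof -
    have "T (scale 0 0) = scale 0 (T 0)" using assms(2) that 0 unfolding linear_between_def by blast
    then show ?thesis by simp
  qed
  then show ?thesis using 0 by (auto simp: invariant_subspace_def)
qed

lemma invariant_subspace_self:
  assumes "subspace V" "\<forall>T\<in>A. linear_between scale V scale V T"
  shows "invariant_subspace scale A V V"
  using assms by (auto simp: invariant_subspace_def linear_between_def)

lemma invariant_subspace_plus:
  assumes lin: "\<forall>T\<in>A. linear_between scale V scale V T" and V: "subspace V"
    and U: "invariant_subspace scale A V U" and U': "invariant_subspace scale A V U'"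
  shows "invariant_subspace scale A V {x + y |x y. x \<in> U \<and> y \<in> U'}"
proof -
  have "subspace {x + y |x y. x \<in> U \<and> y \<in> U'}"
    using U U' subspace_sums unfolding invariant_subspace_def by blast
  moreover have "{x + y |x y. x \<in> U \<and> y \<in> U'} \<subseteq> V"
    using U U' V unfolding invariant_subspace_def by (auto intro!: subspace_add)
  moreover have "T (x + y) = T x + T y" if "T \<in> A" "x \<in> U" "y \<in> U'" for T x y
    using U U' lin that unfolding invariant_subspace_def linear_between_def by blast
  ultimately show ?thesis
    using U U' unfolding invariant_subspace_def by (fastforce simp: image_subset_iff)
qed

text \<open>Linearity only holds on \<open>V\<close>. The elements of \<open>V\<close> that are sent to the target form a subspace.\<close>

lemma linear_between_span:
  assumes "linear_between scale V scale V T" "subspace V" "S \<subseteq> V" "T ` S \<subseteq> span S'"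
  shows "T ` span S \<subseteq> span S'"
proof -
  have "subspace {x \<in> V. T x \<in> span S'}"
  proof (rule subspaceI)
    have "0 \<in> V" using assms(2) by (rule subspace_0)
    then have "T (scale 0 0) = scale 0 (T 0)" using assms(1) unfolding linear_between_def by blast
    then have "T 0 = 0" by simp
    then show "0 \<in> {x \<in> V. T x \<in> span S'}" using \<open>0 \<in> V\<close> by (simp add: span_zero)
  next
    fix x y assume "x \<in> {x \<in> V. T x \<in> span S'}" "y \<in> {x \<in> V. T x \<in> span S'}"
    then show "x + y \<in> {x \<in> V. T x \<in> span S'}"
      using assms(1,2) by (auto simp: linear_between_def span_add subspace_add)
  next
    fix c x assume "x \<in> {x \<in> V. T x \<in> span S'}"
    then show "scale c x \<in> {x \<in> V. T x \<in> span S'}"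
      using assms(1,2) by (auto simp: linear_between_def span_scale subspace_scale)
  qed
  then have "span S \<subseteq> {x \<in> V. T x \<in> span S'}"
    using assms(3,4) by (intro span_minimal) auto
  then show ?thesis by auto
qed

lemma socle_subset:
  assumes "subspace V" shows "socle scale A V \<subseteq> V"
  unfolding socle_def using assms by (intro span_minimal) (auto simp: invariant_subspace_def)

lemma simple_subset_socle:
  "invariant_subspace scale A V N \<Longrightarrow> simple_under scale A N \<Longrightarrow> N \<subseteq> socle scale A V"
  unfolding socle_def by (intro order_trans[OF _ span_superset]) blast

lemma socle_minimal:
  assumes "subspace U"
    and "\<And>N. invariant_subspace scale A V N \<Longrightarrow> simple_under scale A N \<Longrightarrow> N \<subseteq> U"
  shows "socle scale A V \<subseteq> U"
  unfolding socle_def using assms by (intro span_minimal Sup_least) auto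

lemma invariant_subspace_cong:
  assumes "invariant_subspace scale A V = invariant_subspace scale B V"
  shows "socle scale A V = socle scale B V"
    "simple_under scale A V \<longleftrightarrow> simple_under scale B V"
    "finite_length_under scale A V \<longleftrightarrow> finite_length_under scale B V"
proof -
  have "invariant_subspace scale A V N \<and> simple_under scale A N \<longleftrightarrow>
      invariant_subspace scale B V N \<and> simple_under scale B N" for N
    using invariant_subspace_simple_iff[of A V N] invariant_subspace_simple_iff[of B V N] assms by auto
  then show "socle scale A V = socle scale B V" by (simp add: socle_def)
qed (simp_all add: simple_under_def finite_length_under_def assms)

lemma socle_invariant:
  assumes "subspace V" "\<forall>T\<in>A. linear_between scale V scale V T"
  shows "invariant_subspace scale A V (socle scale A V)"
proof -
  have "T ` socle scale A V \<subseteq> socle scale A V" if "T \<in> A" for T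
    unfolding socle_def
  proof (rule linear_between_span)
    let ?S = "\<Union> {U. invariant_subspace scale A V U \<and> simple_under scale A U}"
    show "linear_between scale V scale V T" using assms(2) that by blast
    show "T ` ?S \<subseteq> span ?S"
      using that span_superset[of ?S] unfolding invariant_subspace_def by blast
  qed (use assms in \<open>auto simp: invariant_subspace_def\<close>)
  then show ?thesis
    using socle_subset[OF assms(1)] by (auto simp: invariant_subspace_def socle_def)
qed

text \<open>Zorn's lemma gives a largest invariant subspace meeting \<open>U\<close> trivially. A simple subspace
  outside of its sum with \<open>U\<close> would meet this sum trivially and could be added to it.\<close>

lemma semisimple_complement:
  assumes V: "subspace V" and lin: "\<forall>T\<in>A. linear_between scale V scale V T"
    and ss: "semisimple_under scale A V" and U: "invariant_subspace scale A V U"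
  obtains U' where "invariant_subspace scale A V U'" "U \<inter> U' = {0}"
    "\<And>v. v \<in> V \<Longrightarrow> \<exists>u\<in>U. \<exists>u'\<in>U'. v = u + u'"
proof -
  let ?inv = "invariant_subspace scale A V"
  let ?Z = "{X. ?inv X \<and> U \<inter> X = {0}}"
  have U0: "0 \<in> U" using U by (auto simp: invariant_subspace_def intro: subspace_0)
  have ne: "?Z \<noteq> {}" using invariant_subspace_zero[OF V lin] U0 by auto
 
  have chain: "\<Union>C \<in> ?Z" if "C \<noteq> {}" "subset.chain ?Z C" for C
  proof -
    have mem: "?inv X" "U \<inter> X = {0}" if "X \<in> C" for X
      using that \<open>subset.chain ?Z C\<close> by (auto simp: subset.chain_def)
    have "subspace (\<Union>C)"
    proof (rule subspaceI)
      show "0 \<in> \<Union>C" using \<open>C \<noteq> {}\<close> mem(2) by blast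
    next
      fix x y assume "x \<in> \<Union>C" "y \<in> \<Union>C"
      then obtain X Y where XY: "X \<in> C" "Y \<in> C" "x \<in> X" "y \<in> Y" by blast
      then have "X \<subseteq> Y \<or> Y \<subseteq> X" using \<open>subset.chain ?Z C\<close> by (meson subset_chain_def)
      then obtain Z where "Z \<in> C" "x \<in> Z" "y \<in> Z" using XY by blast
      then show "x + y \<in> \<Union>C" using mem(1) by (meson UnionI invariant_subspace_def subspace_add)
    next
      fix c x assume "x \<in> \<Union>C"
      then show "scale c x \<in> \<Union>C" using mem(1) by (meson UnionE UnionI invariant_subspace_def subspace_scale)
    qed
    moreover have "U \<inter> \<Union>C = {0}" using \<open>C \<noteq> {}\<close> mem(2) by blast
    moreover have "\<Union>C \<subseteq> V" "\<forall>T\<in>A. T ` \<Union>C \<subseteq> \<Union>C"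
      using mem(1) unfolding invariant_subspace_def by blast+
    ultimately show ?thesis by (auto simp: invariant_subspace_def)
  qed
  have "\<exists>M\<in>?Z. \<forall>X\<in>?Z. M \<subseteq> X \<longrightarrow> X = M"
    by (rule subset_Zorn_nonempty[OF ne chain])
  then obtain U' where U': "?inv U'" "U \<inter> U' = {0}"
    and max: "\<And>X. ?inv X \<Longrightarrow> U \<inter> X = {0} \<Longrightarrow> U' \<subseteq> X \<Longrightarrow> X = U'"
    by auto
  let ?S = "{x + y |x y. x \<in> U \<and> y \<in> U'}"
  have S: "?inv ?S" using invariant_subspace_plus[OF lin V U U'(1)] .
  have "N \<subseteq> ?S" if N: "?inv N" "simple_under scale A N" for N
  proof -
    have "N \<inter> ?S = {0} \<or> N \<inter> ?S = N"
      using N invariant_subspace_Int[OF N(1) S] invariant_subspace_simple_iff[OF N(1)] by blast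
    moreover have "N \<subseteq> ?S" if triv: "N \<inter> ?S = {0}"
    proof -
      \<comment> \<open>By maximality of \<open>U'\<close>, its sum with \<open>N\<close> cannot be larger.\<close>
      let ?X = "{x + y |x y. x \<in> U' \<and> y \<in> N}"
      have X: "?inv ?X" using invariant_subspace_plus[OF lin V U'(1) N(1)] .
      have N0: "0 \<in> N" and U'0: "0 \<in> U'"
        using N(1) U'(1) by (auto simp: invariant_subspace_def intro: subspace_0)
      have "u = 0" if "u \<in> U" "u = x + y" "x \<in> U'" "y \<in> N" for u x y
      proof -
        have "- x \<in> U'" using U'(1) that(3) by (auto simp: invariant_subspace_def intro: subspace_neg)
        moreover have "y = u + (- x)" using that(2) by simp
        ultimately have "y \<in> ?S" using that(1) by blast
        then have "y = 0" using triv that(4) by blast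
        then show ?thesis using that U'(2) by auto
      qed
      then have "U \<inter> ?X = {0}" using U0 U'0 N0 by force
      moreover have "U' \<subseteq> ?X" using N0 by force
      ultimately have "?X = U'" using max[OF X] by blast
      moreover have "N \<subseteq> ?X" using U'0 by force
      ultimately show ?thesis using U0 by force
    qed
    ultimately show ?thesis by blast
  qed
  then have "socle scale A V \<subseteq> ?S"
    unfolding socle_def using S by (intro span_minimal) (auto simp: invariant_subspace_def)
  then have "V \<subseteq> ?S" using ss by (simp add: semisimple_under_def)
  then show thesis using that[OF U'] by blast
qed

end

text \<open>Length and simplicity can be read off from the ordered set of invariant subspaces.\<close>

definition invariant_subspace_iso ::
  "(complex \<Rightarrow> 'v \<Rightarrow> 'v) \<Rightarrow> ('v \<Rightarrow> 'v) set \<Rightarrow> 'v::ab_group_add set \<Rightarrow>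
   (complex \<Rightarrow> 'w \<Rightarrow> 'w) \<Rightarrow> ('w \<Rightarrow> 'w) set \<Rightarrow> 'w::ab_group_add set \<Rightarrow> ('v set \<Rightarrow> 'w set) \<Rightarrow> bool" where
  "invariant_subspace_iso s A V s' B W \<Phi> \<longleftrightarrow>
     bij_betw \<Phi> {U. invariant_subspace s A V U} {X. invariant_subspace s' B W X} \<and>
     (\<forall>U U'. invariant_subspace s A V U \<longrightarrow> invariant_subspace s A V U' \<longrightarrow>
        (\<Phi> U \<subseteq> \<Phi> U' \<longleftrightarrow> U \<subseteq> U'))"

lemma invariant_subspace_iso_inv:
  assumes "invariant_subspace_iso s A V s' B W \<Phi>"
  shows "invariant_subspace_iso s' B W s A V (inv_into {U. invariant_subspace s A V U} \<Phi>)"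
    (is "invariant_subspace_iso _ _ _ _ _ _ ?\<Psi>")
proof -
  let ?I = "{U. invariant_subspace s A V U}"
  have bij: "bij_betw \<Phi> ?I {X. invariant_subspace s' B W X}"
    using assms by (simp add: invariant_subspace_iso_def)
  have "?\<Psi> X \<in> ?I" "\<Phi> (?\<Psi> X) = X" if "invariant_subspace s' B W X" for X
    using that bij_betw_apply[OF bij_betw_inv_into[OF bij], of X] bij_betw_inv_into_right[OF bij, of X]
    by auto
  then show ?thesis
    using assms bij_betw_inv_into[OF bij] unfolding invariant_subspace_iso_def
    by (metis mem_Collect_eq)
qed

lemma invariant_subspace_iso_bounds:
  assumes iso: "invariant_subspace_iso s A V s' B W \<Phi>"
    and vs: "vector_space s" "vector_space s'"
    and V: "module.subspace s V" "\<forall>T\<in>A. linear_between s V s V T"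
    and W: "module.subspace s' W" "\<forall>T\<in>B. linear_between s' W s' W T"
  shows "\<Phi> {0} = {0}" "\<Phi> V = W"
proof -
  interpret v: complex_space s using vs(1) by (rule complex_space.intro)
  interpret w: complex_space s' using vs(2) by (rule complex_space.intro)
  let ?I = "{U. invariant_subspace s A V U}" and ?J = "{X. invariant_subspace s' B W X}"
  have bij: "\<Phi> ` ?I = ?J"
    using iso by (simp add: invariant_subspace_iso_def bij_betw_def)
  have le: "\<Phi> U \<subseteq> \<Phi> U' \<longleftrightarrow> U \<subseteq> U'" if "U \<in> ?I" "U' \<in> ?I" for U U'
    using iso that by (simp add: invariant_subspace_iso_def)
  have I: "{0} \<in> ?I" "V \<in> ?I" and J: "{0} \<in> ?J" "W \<in> ?J"
    using v.invariant_subspace_zero[OF V] v.invariant_subspace_self[OF V]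
      w.invariant_subspace_zero[OF W] w.invariant_subspace_self[OF W] by auto
  have v0: "0 \<in> U" and UV: "U \<subseteq> V" if "U \<in> ?I" for U
    using that by (auto simp: invariant_subspace_def intro: v.subspace_0)
  have w0: "0 \<in> X" and XW: "X \<subseteq> W" if "X \<in> ?J" for X
    using that by (auto simp: invariant_subspace_def intro: w.subspace_0)
  obtain U where U: "U \<in> ?I" "\<Phi> U = {0}" using J(1) bij by (metis (no_types, lifting) imageE)
  have "\<Phi> {0} \<subseteq> \<Phi> U" using le[OF I(1) U(1)] v0[OF U(1)] by auto
  moreover have "0 \<in> \<Phi> {0}" using w0 I(1) bij by blast
  ultimately show "\<Phi> {0} = {0}" using U(2) by auto
  obtain U where U: "U \<in> ?I" "\<Phi> U = W" using J(2) bij by (metis (no_types, lifting) imageE)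
  have "W \<subseteq> \<Phi> V" using le[OF U(1) I(2)] UV[OF U(1)] U(2) by auto
  moreover have "\<Phi> V \<subseteq> W" using XW I(2) bij by blast
  ultimately show "\<Phi> V = W" by auto
qed

lemma invariant_subspace_iso_finite_length:
  assumes iso: "invariant_subspace_iso s A V s' B W \<Phi>"
    and vs: "vector_space s" "vector_space s'"
    and V: "module.subspace s V" "\<forall>T\<in>A. linear_between s V s V T"
    and W: "module.subspace s' W" "\<forall>T\<in>B. linear_between s' W s' W T"
    and fl: "finite_length_under s A V"
  shows "finite_length_under s' B W"
proof -
  let ?I = "{U. invariant_subspace s A V U}" and ?J = "{X. invariant_subspace s' B W X}"
  have bij: "\<Phi> ` ?I = ?J"
    using iso by (simp add: invariant_subspace_iso_def bij_betw_def)
  have le: "\<Phi> U \<subseteq> \<Phi> U' \<longleftrightarrow> U \<subseteq> U'" if "U \<in> ?I" "U' \<in> ?I" for U U'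
    using iso that by (simp add: invariant_subspace_iso_def)
  note bounds = invariant_subspace_iso_bounds[OF iso vs V W]
  from fl obtain n :: nat and F where F: "F 0 = {0}" "F n = V" "\<And>i. i \<le> n \<Longrightarrow> F i \<in> ?I"
    "\<And>i. i < n \<Longrightarrow> F i \<subset> F (Suc i)"
    "\<And>i U. i < n \<Longrightarrow> U \<in> ?I \<Longrightarrow> F i \<subseteq> U \<Longrightarrow> U \<subseteq> F (Suc i) \<Longrightarrow> U = F i \<or> U = F (Suc i)"
    unfolding finite_length_under_def by auto
  have step: "\<Phi> (F i) \<subset> \<Phi> (F (Suc i)) \<and>
     (\<forall>X. X \<in> ?J \<and> \<Phi> (F i) \<subseteq> X \<and> X \<subseteq> \<Phi> (F (Suc i)) \<longrightarrow> X = \<Phi> (F i) \<or> X = \<Phi> (F (Suc i)))"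
    if i: "i < n" for i
  proof (intro conjI allI impI)
    have I: "F i \<in> ?I" "F (Suc i) \<in> ?I" using F(3)[of i] F(3)[of "Suc i"] i by auto
    show "\<Phi> (F i) \<subset> \<Phi> (F (Suc i))"
      using le[OF I] le[OF I(2,1)] F(4)[OF i] by blast
    fix X assume X: "X \<in> ?J \<and> \<Phi> (F i) \<subseteq> X \<and> X \<subseteq> \<Phi> (F (Suc i))"
    then obtain U where U: "U \<in> ?I" "X = \<Phi> U" using bij by blast
    then have "F i \<subseteq> U" "U \<subseteq> F (Suc i)" using X le I by blast+
    then show "X = \<Phi> (F i) \<or> X = \<Phi> (F (Suc i))" using F(5)[OF i U(1)] U(2) by blast
  qed
  show ?thesis
    unfolding finite_length_under_def
    apply (rule exI[of _ n], rule exI[of _ "\<lambda>i. \<Phi> (F i)"])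
    using F(1,2,3) step bounds bij by auto
qed

lemma invariant_subspace_iso_simple:
  assumes iso: "invariant_subspace_iso s A V s' B W \<Phi>"
    and vs: "vector_space s" "vector_space s'"
    and V: "module.subspace s V" "\<forall>T\<in>A. linear_between s V s V T"
    and W: "module.subspace s' W" "\<forall>T\<in>B. linear_between s' W s' W T"
    and N: "invariant_subspace s A V N" "simple_under s A N"
  shows "simple_under s' B (\<Phi> N)"
proof -
  interpret v: complex_space s using vs(1) by (rule complex_space.intro)
  interpret w: complex_space s' using vs(2) by (rule complex_space.intro)
  let ?I = "{U. invariant_subspace s A V U}" and ?J = "{X. invariant_subspace s' B W X}"
  have bij: "\<Phi> ` ?I = ?J" "inj_on \<Phi> ?I"
    using iso by (simp_all add: invariant_subspace_iso_def bij_betw_def)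
  have le: "\<Phi> U \<subseteq> \<Phi> U' \<longleftrightarrow> U \<subseteq> U'" if "U \<in> ?I" "U' \<in> ?I" for U U'
    using iso that by (simp add: invariant_subspace_iso_def)
  note b0 = invariant_subspace_iso_bounds(1)[OF iso vs V W]
  have I0: "{0} \<in> ?I" using v.invariant_subspace_zero[OF V] by simp
  have NI: "N \<in> ?I" and NJ: "invariant_subspace s' B W (\<Phi> N)" using N(1) bij by auto
  have ne: "\<Phi> N \<noteq> {0}"
    using N(2) b0 inj_onD[OF bij(2) _ NI I0] by (auto simp: simple_under_def)
  have "X = {0} \<or> X = \<Phi> N" if X: "invariant_subspace s' B W X" "X \<subseteq> \<Phi> N" for X
  proof -
    from X(1) obtain U where U: "U \<in> ?I" "X = \<Phi> U" using bij by blast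
    then have "U \<subseteq> N" using le[OF U(1) NI] X by blast
    then have "U = {0} \<or> U = N"
      using U(1) N v.invariant_subspace_simple_iff[OF N(1)] by blast
    then show ?thesis using U(2) b0 by blast
  qed
  then show ?thesis using w.invariant_subspace_simple_iff[OF NJ] ne by blast
qed

section \<open>Left cosets of open subgroups\<close>

text \<open>The symbol \<open><#\<close> is reserved for left cosets.\<close>

no_notation subset_mset (infix "<#" 50)

text \<open>Sums over left cosets of functions that are constant on them are evaluated at representatives.\<close>

definition rep :: "'g set \<Rightarrow> 'g" where
  "rep C = (SOME x. x \<in> C)"

context group
begin

lemma mult_inv_cancel [simp]:
  assumes "x \<in> carrier G" "y \<in> carrier G"
  shows "x \<otimes> (inv x \<otimes> y) = y" "inv x \<otimes> (x \<otimes> y) = y"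
  using assms by (simp_all add: m_assoc[symmetric])

lemma coset_eq_iff:
  assumes "subgroup H G" "x \<in> carrier G" "y \<in> carrier G"
  shows "x <# H = y <# H \<longleftrightarrow> y \<in> x <# H"
proof
  assume "x <# H = y <# H"
  then show "y \<in> x <# H"
    using subgroup.one_closed[OF assms(1)] assms(3) by (force simp: l_coset_def)
next
  assume "y \<in> x <# H"
  then show "x <# H = y <# H" using l_repr_independence[OF _ assms(2,1)] by simp
qed

lemma coset_mult_right:
  assumes "subgroup H G" "x \<in> carrier G" "k \<in> H"
  shows "(x \<otimes> k) <# H = x <# H"
proof -
  have "k \<in> carrier G" using assms subgroup.mem_carrier by metis
  then show ?thesis
    using coset_eq_iff[OF assms(1,2), of "x \<otimes> k"] assms by (auto simp: l_coset_def)
qed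

lemma coset_eqE:
  assumes "subgroup H G" "x \<in> carrier G" "y \<in> carrier G" "x <# H = y <# H"
  obtains k where "k \<in> H" "y = x \<otimes> k"
  using assms coset_eq_iff[OF assms(1-3)] by (auto simp: l_coset_def)

lemma rep_coset:
  assumes "subgroup H G" "x \<in> carrier G"
  obtains k where "k \<in> H" "rep (x <# H) = x \<otimes> k"
proof -
  have "x \<in> x <# H" using coset_eq_iff[OF assms assms(2)] by simp
  then have "rep (x <# H) \<in> x <# H" unfolding rep_def by (rule someI)
  then show thesis using that by (auto simp: l_coset_def)
qed

lemma rep_coset_carrier:
  assumes "subgroup H G" "x \<in> carrier G"
  shows "rep (x <# H) \<in> carrier G" "rep (x <# H) <# H = x <# H"
proof -
  obtain k where k: "k \<in> H" "rep (x <# H) = x \<otimes> k" by (rule rep_coset[OF assms])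
  moreover have "k \<in> carrier G" using k(1) assms(1) subgroup.mem_carrier by metis
  ultimately show "rep (x <# H) \<in> carrier G" "rep (x <# H) <# H = x <# H"
    using assms coset_mult_right by auto
qed

lemma fun_rep_coset:
  assumes "subgroup H G" "x \<in> carrier G" "\<And>y k. y \<in> carrier G \<Longrightarrow> k \<in> H \<Longrightarrow> h (y \<otimes> k) = h y"
  shows "h (rep (x <# H)) = h x"
  using rep_coset[OF assms(1,2)] assms(2,3) by metis

lemma translate_coset:
  assumes "subgroup H G" "x \<in> carrier G" "y \<in> carrier G"
  shows "x <# (y <# H) = (x \<otimes> y) <# H"
  using assms by (simp add: lcos_m_assoc subgroup.subset)

lemma translate_cancel:
  assumes "x \<in> carrier G" "C \<subseteq> carrier G" "D \<subseteq> carrier G"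
  shows "x <# C = x <# D \<longleftrightarrow> C = D"
  using assms lcos_m_assoc[of C "inv x" x] lcos_m_assoc[of D "inv x" x]
  by (metis inv_closed l_inv lcos_mult_one)

lemma inj_on_translate:
  assumes "x \<in> carrier G" "\<And>C. C \<in> \<C> \<Longrightarrow> C \<subseteq> carrier G"
  shows "inj_on (\<lambda>C. x <# C) \<C>"
  using assms translate_cancel by (auto simp: inj_on_def)

lemma sum_translate:
  fixes h :: "'a \<Rightarrow> 'c::comm_monoid_add"
  assumes H: "subgroup H G" and x: "x \<in> carrier G"
    and \<C>: "\<And>C. C \<in> \<C> \<Longrightarrow> \<exists>y\<in>carrier G. C = y <# H"
    and h: "\<And>y k. y \<in> carrier G \<Longrightarrow> k \<in> H \<Longrightarrow> h (y \<otimes> k) = h y"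
  shows "(\<Sum>C\<in>(\<lambda>C. x <# C) ` \<C>. h (rep C)) = (\<Sum>C\<in>\<C>. h (x \<otimes> rep C))"
proof -
  have "inj_on (\<lambda>C. x <# C) \<C>"
    using \<C> l_coset_subset_G subgroup.subset[OF H] x by (intro inj_on_translate) blast+
  then have "(\<Sum>C\<in>(\<lambda>C. x <# C) ` \<C>. h (rep C)) = (\<Sum>C\<in>\<C>. h (rep (x <# C)))"
    by (simp add: sum.reindex)
  also have "\<dots> = (\<Sum>C\<in>\<C>. h (x \<otimes> rep C))"
  proof (rule sum.cong[OF refl])
    fix C assume "C \<in> \<C>"
    then obtain y where y: "y \<in> carrier G" "C = y <# H" using \<C> by blast
    have "h (rep (x <# C)) = h (x \<otimes> y)"
      using fun_rep_coset[OF H _ h, of "x \<otimes> y"] x y translate_coset[OF H] by simp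
    also have "\<dots> = h (x \<otimes> rep C)"
    proof -
      obtain k where k: "k \<in> H" "rep C = y \<otimes> k" using rep_coset[OF H y(1)] y(2) by blast
      then have "x \<otimes> rep C = (x \<otimes> y) \<otimes> k"
        using x y(1) subgroup.mem_carrier[OF H] by (simp add: m_assoc)
      then show ?thesis using h[of "x \<otimes> y" k] x y(1) k(1) by simp
    qed
    finally show "h (rep (x <# C)) = h (x \<otimes> rep C)" .
  qed
  finally show ?thesis .
qed

end

locale open_compact_pair = group G for G :: "'g topgroup" (structure) +
  fixes K :: "'g set"
  assumes topgrp: "topological_group G"
    and hausdorff: "Hausdorff_space (gtop G)"
    and open_compact: "open_compact_subgroup G K"
begin

lemma topspace_G [simp]: "topspace (gtop G) = carrier G"
  using topgrp by (simp add: topological_group_def)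

lemma subgroup_K: "subgroup K G" and open_K: "openin (gtop G) K" and compact_K: "compactin (gtop G) K"
  using open_compact by (simp_all add: open_compact_subgroup_def)

lemma K_carrier [simp]: "k \<in> K \<Longrightarrow> k \<in> carrier G"
  using subgroup_K by (rule subgroup.mem_carrier)

lemma K_closed [simp]: "\<one> \<in> K" "k \<in> K \<Longrightarrow> inv k \<in> K" "k \<in> K \<Longrightarrow> k' \<in> K \<Longrightarrow> k \<otimes> k' \<in> K"
  using subgroup_K by (auto simp: subgroup.one_closed subgroup.m_inv_closed subgroup.m_closed)

lemma continuous_mult:
  assumes "continuous_map X (gtop G) f" "continuous_map X (gtop G) g"
  shows "continuous_map X (gtop G) (\<lambda>x. f x \<otimes> g x)"
proof -
  have "continuous_map X (prod_topology (gtop G) (gtop G)) (\<lambda>x. (f x, g x))"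
    using assms by (simp add: continuous_map_pairwise o_def)
  moreover have "continuous_map (prod_topology (gtop G) (gtop G)) (gtop G) (\<lambda>(x, y). x \<otimes> y)"
    using topgrp by (simp add: topological_group_def)
  ultimately show ?thesis
    using continuous_map_compose by (fastforce simp: o_def)
qed

lemma continuous_left_mult: "x \<in> carrier G \<Longrightarrow> continuous_map (gtop G) (gtop G) (\<lambda>y. x \<otimes> y)"
  and continuous_right_mult: "x \<in> carrier G \<Longrightarrow> continuous_map (gtop G) (gtop G) (\<lambda>y. y \<otimes> x)"
  by (auto intro!: continuous_mult continuous_map_id[unfolded id_def] simp: continuous_map_const)

text \<open>Written as a preimage under a translation, a coset of an open set is visibly open.\<close>

lemma coset_eq_preimage:
  assumes "x \<in> carrier G" "H \<subseteq> carrier G"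
  shows "x <# H = {y \<in> carrier G. inv x \<otimes> y \<in> H}"
proof (intro Set.set_eqI iffI)
  fix y assume "y \<in> x <# H"
  then show "y \<in> {y \<in> carrier G. inv x \<otimes> y \<in> H}"
    using assms by (auto simp: l_coset_def m_assoc[symmetric] subset_iff)
next
  fix y assume y: "y \<in> {y \<in> carrier G. inv x \<otimes> y \<in> H}"
  then have "y = x \<otimes> (inv x \<otimes> y)" using assms by (simp add: m_assoc[symmetric])
  then show "y \<in> x <# H" using y by (auto simp: l_coset_def)
qed

lemma open_coset:
  assumes "openin (gtop G) H" "x \<in> carrier G"
  shows "openin (gtop G) (x <# H)"
proof -
  have "H \<subseteq> carrier G" using openin_subset[OF assms(1)] by simp
  then show ?thesis
    using openin_continuous_map_preimage[OF continuous_left_mult[of "inv x"] assms(1)] assms(2)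
    by (simp add: coset_eq_preimage)
qed

lemma compact_coset:
  assumes "x \<in> carrier G" shows "compactin (gtop G) (x <# K)"
proof -
  have "x <# K = (\<lambda>y. x \<otimes> y) ` K" by (auto simp: l_coset_def)
  then show ?thesis using image_compactin[OF compact_K continuous_left_mult[OF assms]] by simp
qed

text \<open>The cosets of an open subgroup are open and disjoint, so a finite cover by some of them
  already contains all those that meet the compact set.\<close>

lemma finite_cosets:
  assumes H: "subgroup H G" "openin (gtop G) H" and C: "compactin (gtop G) C"
  shows "finite ((\<lambda>x. x <# H) ` C)"
proof -
  have C_carrier: "C \<subseteq> carrier G" using compactin_subset_topspace[OF C] by simp
  let ?U = "(\<lambda>x. x <# H) ` C"
  have self: "x \<in> x <# H" if "x \<in> carrier G" for x
    using coset_eq_iff[OF H(1) that that] by simp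
  have "\<forall>U\<in>?U. openin (gtop G) U" using open_coset H(2) C_carrier by blast
  moreover have "C \<subseteq> \<Union>?U" using self C_carrier by blast
  ultimately obtain F where F: "finite F" "F \<subseteq> ?U" "C \<subseteq> \<Union>F"
    using C unfolding compactin_def by blast
  have "?U \<subseteq> F"
  proof
    fix U assume "U \<in> ?U"
    then obtain x where x: "x \<in> C" "U = x <# H" by blast
    then obtain U' where U': "U' \<in> F" "x \<in> U'" using F(3) by blast
    then obtain y where y: "y \<in> C" "U' = y <# H" using F(2) by blast
    have "U = U'" using coset_eq_iff[OF H(1), of y x] x y U' C_carrier by blast
    then show "U \<in> F" using U'(1) by simp
  qed
  then show ?thesis using F(1) finite_subset by blast
qed

lemma open_conj:
  assumes "g \<in> carrier G"
  shows "subgroup {k \<in> K. inv g \<otimes> k \<otimes> g \<in> K} G" "openin (gtop G) {k \<in> K. inv g \<otimes> k \<otimes> g \<in> K}"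
proof -
  have m: "inv g \<otimes> (k \<otimes> k') \<otimes> g = (inv g \<otimes> k \<otimes> g) \<otimes> (inv g \<otimes> k' \<otimes> g)"
    if "k \<in> K" "k' \<in> K" for k k'
  proof -
    have "(inv g \<otimes> k \<otimes> g) \<otimes> (inv g \<otimes> k' \<otimes> g) = inv g \<otimes> k \<otimes> (g \<otimes> inv g) \<otimes> k' \<otimes> g"
      using that assms by (simp add: m_assoc del: r_inv)
    then show ?thesis using that assms by (simp add: m_assoc)
  qed
  have i: "inv g \<otimes> inv k \<otimes> g = inv (inv g \<otimes> k \<otimes> g)" if "k \<in> K" for k
    using that assms by (simp add: inv_mult_group m_assoc)
  show "subgroup {k \<in> K. inv g \<otimes> k \<otimes> g \<in> K} G"
    by (rule subgroupI) (use assms m i in \<open>auto intro!: exI[of _ \<one>]\<close>)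
  have "continuous_map (gtop G) (gtop G) (\<lambda>k. inv g \<otimes> k \<otimes> g)"
    using assms by (intro continuous_mult continuous_map_id[unfolded id_def])
      (auto simp: continuous_map_const intro!: continuous_mult)
  then have "openin (gtop G) {k \<in> carrier G. inv g \<otimes> k \<otimes> g \<in> K}"
    using openin_continuous_map_preimage open_K by fastforce
  then have "openin (gtop G) (K \<inter> {k \<in> carrier G. inv g \<otimes> k \<otimes> g \<in> K})"
    using open_K by blast
  moreover have "K \<inter> {k \<in> carrier G. inv g \<otimes> k \<otimes> g \<in> K} = {k \<in> K. inv g \<otimes> k \<otimes> g \<in> K}" by auto
  ultimately show "openin (gtop G) {k \<in> K. inv g \<otimes> k \<otimes> g \<in> K}" by simp
qed

text \<open>A double coset \<open>KgK\<close> is represented by the finite set of its left cosets, over which sums and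
  averages run.\<close>

definition orb :: "'g \<Rightarrow> 'g set set" where
  "orb g = (\<lambda>k. (k \<otimes> g) <# K) ` K"

lemma orb_coset: "g \<in> carrier G \<Longrightarrow> C \<in> orb g \<Longrightarrow> \<exists>y\<in>carrier G. C = y <# K"
  by (auto simp: orb_def)

lemma orb_self: "g \<in> carrier G \<Longrightarrow> g <# K \<in> orb g"
  by (auto simp: orb_def intro!: image_eqI[of _ _ \<one>])

lemma finite_orb: assumes "g \<in> carrier G" shows "finite (orb g)"
proof -
  have "orb g = (\<lambda>x. x <# K) ` (\<lambda>k. k \<otimes> g) ` K" by (auto simp: orb_def)
  moreover have "compactin (gtop G) ((\<lambda>k. k \<otimes> g) ` K)"
    using image_compactin[OF compact_K continuous_right_mult[OF assms]] .
  ultimately show ?thesis using finite_cosets[OF subgroup_K open_K] by simp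
qed

lemma card_orb: "g \<in> carrier G \<Longrightarrow> card (orb g) > 0"
  using finite_orb orb_self by (auto simp: card_gt_0_iff)

lemma translate_orb:
  assumes "k \<in> K" "g \<in> carrier G" shows "(\<lambda>C. k <# C) ` orb g = orb g"
proof -
  have eq: "(\<lambda>C. k <# C) ` orb g = (\<lambda>k'. (k \<otimes> k' \<otimes> g) <# K) ` K"
    using assms translate_coset[OF subgroup_K]
    by (auto simp: orb_def m_assoc image_image intro!: image_cong)
  have "(\<lambda>k'. k \<otimes> k') ` K = K"
  proof -
    have "x \<in> (\<lambda>k'. k \<otimes> k') ` K" if "x \<in> K" for x
      using that assms(1) by (intro image_eqI[of _ _ "inv k \<otimes> x"]) (auto simp: m_assoc[symmetric])
    then show ?thesis using assms(1) by auto
  qed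
  then have "orb g = (\<lambda>k'. (k' \<otimes> g) <# K) ` (\<lambda>k'. k \<otimes> k') ` K" by (simp add: orb_def)
  then show ?thesis using eq by (simp add: image_image)
qed

lemma orb_right: "g \<in> carrier G \<Longrightarrow> k \<in> K \<Longrightarrow> orb (g \<otimes> k) = orb g"
  unfolding orb_def
  by (intro image_cong refl) (simp add: m_assoc[symmetric] coset_mult_right[OF subgroup_K])

lemma orb_left:
  assumes "k \<in> K" "g \<in> carrier G" shows "orb (k \<otimes> g) = orb g"
proof -
  have "(\<lambda>k'. k' \<otimes> k) ` K = K"
  proof -
    have "x \<in> (\<lambda>k'. k' \<otimes> k) ` K" if "x \<in> K" for x
      using that assms(1) by (intro image_eqI[of _ _ "x \<otimes> inv k"]) (auto simp: m_assoc)
    then show ?thesis using assms(1) by auto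
  qed
  then have "orb g = (\<lambda>k'. (k' \<otimes> g) <# K) ` (\<lambda>k'. k' \<otimes> k) ` K" by (simp add: orb_def)
  also have "\<dots> = orb (k \<otimes> g)"
    using assms by (auto simp: orb_def image_image m_assoc intro!: image_cong)
  finally show ?thesis by simp
qed

lemma orb_eq_iff:
  assumes "x \<in> carrier G" "g \<in> carrier G"
  shows "orb x = orb g \<longleftrightarrow> x <# K \<in> orb g"
proof
  assume "orb x = orb g" then show "x <# K \<in> orb g" using orb_self assms by blast
next
  assume "x <# K \<in> orb g"
  then obtain k where k: "k \<in> K" "x <# K = (k \<otimes> g) <# K" by (auto simp: orb_def)
  then obtain k' where "k' \<in> K" "k \<otimes> g = x \<otimes> k'"
    using coset_eqE[OF subgroup_K, of x "k \<otimes> g"] assms by auto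
  then show "orb x = orb g" using orb_right orb_left assms k by metis
qed

lemma orb_eqE:
  assumes "x \<in> carrier G" "g \<in> carrier G" "orb x = orb g"
  obtains k k' where "k \<in> K" "k' \<in> K" "x = k \<otimes> g \<otimes> k'"
proof -
  obtain k where k: "k \<in> K" "x <# K = (k \<otimes> g) <# K"
    using assms orb_eq_iff by (auto simp: orb_def)
  then obtain k' where "k' \<in> K" "x = k \<otimes> g \<otimes> k'"
    using coset_eqE[OF subgroup_K, of "k \<otimes> g" x] assms by auto
  then show thesis using that k by blast
qed

lemma orb_rep:
  assumes "g \<in> carrier G" "C \<in> orb g"
  shows "rep C \<in> carrier G" "orb (rep C) = orb g" "rep C <# K = C"
proof -
  obtain y where y: "y \<in> carrier G" "C = y <# K" using orb_coset assms by blast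
  show "rep C \<in> carrier G" "rep C <# K = C" using rep_coset_carrier[OF subgroup_K y(1)] y(2) by auto
  then show "orb (rep C) = orb g" using orb_eq_iff assms by simp
qed

lemma orb_one: "orb \<one> = {K}"
proof -
  have "k <# K = K" if "k \<in> K" for k
    using coset_mult_right[OF subgroup_K, of \<one> k] that subgroup.subset[OF subgroup_K]
    by (simp add: lcos_mult_one)
  then show ?thesis by (auto simp: orb_def intro: image_eqI[of _ _ \<one>])
qed

text \<open>The group \<open>K\<close> permutes the cosets in \<open>KgK\<close> transitively, so that the map from \<open>K/H\<close> to
  \<open>KgK/K\<close> has fibres of equal size.\<close>

lemma sum_over_orb:
  fixes h :: "'g set \<Rightarrow> 'c::ab_group_add"
  assumes H: "subgroup H G" "openin (gtop G) H" "H \<subseteq> {k \<in> K. inv g \<otimes> k \<otimes> g \<in> K}"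
    and g: "g \<in> carrier G" and vs: "complex_space s"
  defines "Q \<equiv> (\<lambda>k. k <# H) ` K"
  shows "s (of_nat (card (orb g))) (\<Sum>C\<in>Q. h ((rep C \<otimes> g) <# K)) = s (of_nat (card Q)) (\<Sum>D\<in>orb g. h D)"
proof -
  interpret complex_space s by (rule vs)
  let ?\<phi> = "\<lambda>C. (rep C \<otimes> g) <# K"
  define c where "c = card {C \<in> Q. ?\<phi> C = g <# K}"
  have finQ: "finite Q" unfolding Q_def using finite_cosets[OF H(1,2) compact_K] .
  have phi: "?\<phi> (k <# H) = (k \<otimes> g) <# K" if k: "k \<in> K" for k
  proof -
    obtain h where h: "h \<in> H" "rep (k <# H) = k \<otimes> h" using rep_coset[OF H(1), of k] k by auto
    have hK: "h \<in> K" "inv g \<otimes> h \<otimes> g \<in> K" using h(1) H(3) by auto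
    have "k \<otimes> h \<otimes> g = (k \<otimes> g) \<otimes> (inv g \<otimes> h \<otimes> g)"
    proof -
      have "(k \<otimes> g) \<otimes> (inv g \<otimes> h \<otimes> g) = k \<otimes> (g \<otimes> inv g) \<otimes> h \<otimes> g"
        using k g hK(1) by (simp add: m_assoc del: r_inv)
      then show ?thesis using k g hK(1) by simp
    qed
    then show ?thesis using coset_mult_right[OF subgroup_K _ hK(2), of "k \<otimes> g"] h(2) k g by simp
  qed
  \<comment> \<open>An element of \<open>K\<close> that carries \<open>gK\<close> to \<open>D\<close> also carries the fibre over \<open>gK\<close> to the fibre over \<open>D\<close>.\<close>
  have fib: "card {C \<in> Q. ?\<phi> C = D} = c" if D: "D \<in> orb g" for D
  proof -
    obtain k where k: "k \<in> K" "D = (k \<otimes> g) <# K" using D by (auto simp: orb_def)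
    have "bij_betw (\<lambda>C. k <# C) {C \<in> Q. ?\<phi> C = g <# K} {C \<in> Q. ?\<phi> C = D}"
    proof (rule bij_betw_imageI)
      show "inj_on (\<lambda>C. k <# C) {C \<in> Q. ?\<phi> C = g <# K}"
      proof (rule inj_on_translate)
        fix C assume "C \<in> {C \<in> Q. ?\<phi> C = g <# K}"
        then obtain k' where "k' \<in> K" "C = k' <# H" by (auto simp: Q_def)
        then show "C \<subseteq> carrier G"
          using l_coset_subset_G[OF subgroup.subset[OF H(1)]] by simp
      qed (use k in simp)
      have step: "?\<phi> (k' <# H) = g <# K \<longleftrightarrow> ?\<phi> ((k \<otimes> k') <# H) = D" if k': "k' \<in> K" for k'
      proof -
        have "?\<phi> (k' <# H) = (k' \<otimes> g) <# K" "?\<phi> ((k \<otimes> k') <# H) = (k \<otimes> k' \<otimes> g) <# K"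
          using phi k k' by auto
        moreover have "(k \<otimes> k' \<otimes> g) <# K = k <# ((k' \<otimes> g) <# K)" "D = k <# (g <# K)"
          using translate_coset[OF subgroup_K] k k' g by (auto simp: m_assoc)
        moreover have "(k' \<otimes> g) <# K \<subseteq> carrier G" "g <# K \<subseteq> carrier G"
          using l_coset_subset_G subgroup.subset[OF subgroup_K] k' g by auto
        ultimately show ?thesis
          using translate_cancel[of k "(k' \<otimes> g) <# K" "g <# K"] k by auto
      qed
      show "(\<lambda>C. k <# C) ` {C \<in> Q. ?\<phi> C = g <# K} = {C \<in> Q. ?\<phi> C = D}"
      proof (intro Set.set_eqI iffI)
        fix C assume "C \<in> (\<lambda>C. k <# C) ` {C \<in> Q. ?\<phi> C = g <# K}"
        then obtain k' where k': "k' \<in> K" "?\<phi> (k' <# H) = g <# K" "C = k <# (k' <# H)"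
          by (auto simp: Q_def)
        then have "C = (k \<otimes> k') <# H" using translate_coset[OF H(1)] k by simp
        then show "C \<in> {C \<in> Q. ?\<phi> C = D}" using step[OF k'(1)] k' k by (auto simp: Q_def)
      next
        fix C assume "C \<in> {C \<in> Q. ?\<phi> C = D}"
        then obtain k'' where k'': "k'' \<in> K" "?\<phi> C = D" "C = k'' <# H" by (auto simp: Q_def)
        let ?k = "inv k \<otimes> k''"
        have kk: "?k \<in> K" "k \<otimes> ?k = k''" using k k'' by (auto simp: m_assoc[symmetric])
        then have "?\<phi> (?k <# H) = g <# K" using step[of ?k] k'' by simp
        moreover have "C = k <# (?k <# H)" using translate_coset[OF H(1), of k ?k] kk k k'' by simp
        ultimately show "C \<in> (\<lambda>C. k <# C) ` {C \<in> Q. ?\<phi> C = g <# K}"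
          using kk by (auto simp: Q_def)
      qed
    qed
    from bij_betw_same_card[OF this] show ?thesis by (simp only: c_def)
  qed
  have img: "?\<phi> ` Q \<subseteq> orb g"
    using phi by (auto simp: Q_def orb_def)
  have "(\<Sum>C\<in>Q. h (?\<phi> C)) = (\<Sum>D\<in>orb g. \<Sum>C\<in>{C\<in>Q. ?\<phi> C = D}. h (?\<phi> C))"
    using sum.group[OF finQ finite_orb[OF g] img, of "\<lambda>C. h (?\<phi> C)"] by simp
  also have "\<dots> = (\<Sum>D\<in>orb g. \<Sum>C\<in>{C\<in>Q. ?\<phi> C = D}. h D)"
    by (intro sum.cong refl) auto
  also have "\<dots> = (\<Sum>D\<in>orb g. s (of_nat c) (h D))"
    using fib by (intro sum.cong refl) (simp add: sum_constant_scale)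
  also have "\<dots> = s (of_nat c) (\<Sum>D\<in>orb g. h D)" by (simp add: scale_sum_right)
  finally have 1: "(\<Sum>C\<in>Q. h (?\<phi> C)) = s (of_nat c) (\<Sum>D\<in>orb g. h D)" .
  have "card Q = (\<Sum>D\<in>orb g. card {C\<in>Q. ?\<phi> C = D})"
    using sum.group[OF finQ finite_orb[OF g] img, of "\<lambda>C. 1::nat"] by simp
  also have "\<dots> = card (orb g) * c" using fib by simp
  finally show ?thesis using 1 by simp
qed

end

section \<open>The representation generated by a Hecke module\<close>

lemma sum_fun_apply: "(\<Sum>i\<in>I. f i) x = (\<Sum>i\<in>I. (f i x :: 'c::comm_monoid_add))"
  by (induction I rule: infinite_finite_induct) (auto simp: zero_fun_def)

text \<open>The operator \<open>E g\<close> stands for the action of the normalised indicator function of \<open>KgK\<close>, that is,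
  for \<open>e\<^sub>K g e\<^sub>K\<close>. The last assumption is the multiplication rule \<open>e\<^sub>K y e\<^sub>K g e\<^sub>K = \<integral> e\<^sub>K y k g e\<^sub>K dk\<close>, with
  the integral over \<open>K\<close> written as an average over the left cosets in \<open>KgK\<close>.\<close>

locale hecke_operators = open_compact_pair G K + complex_space s
  for G :: "'g topgroup" (structure) and K :: "'g set"
    and s :: "complex \<Rightarrow> 'w::ab_group_add \<Rightarrow> 'w" +
  fixes W :: "'w set" and E :: "'g \<Rightarrow> 'w \<Rightarrow> 'w"
  assumes W: "subspace W"
    and E_linear: "g \<in> carrier G \<Longrightarrow> linear_between s W s W (E g)"
    and E_bi: "k \<in> K \<Longrightarrow> k' \<in> K \<Longrightarrow> g \<in> carrier G \<Longrightarrow> w \<in> W \<Longrightarrow> E (k \<otimes> g \<otimes> k') w = E g w"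
    and E_one: "w \<in> W \<Longrightarrow> E \<one> w = w"
    and E_mult: "y \<in> carrier G \<Longrightarrow> g \<in> carrier G \<Longrightarrow> w \<in> W \<Longrightarrow>
      s (of_nat (card (orb g))) (E y (E g w)) = (\<Sum>D\<in>orb g. E (y \<otimes> rep D) w)"
begin

abbreviation fscale :: "complex \<Rightarrow> ('g \<Rightarrow> 'w) \<Rightarrow> 'g \<Rightarrow> 'w" where
  "fscale \<equiv> fun_scale s"

sublocale fs: complex_space fscale
  by unfold_locales (auto simp: fun_scale_def fun_eq_iff scale_right_distrib scale_left_distrib)

lemma E_W [simp]: "g \<in> carrier G \<Longrightarrow> w \<in> W \<Longrightarrow> E g w \<in> W"
  and E_add: "g \<in> carrier G \<Longrightarrow> v \<in> W \<Longrightarrow> w \<in> W \<Longrightarrow> E g (v + w) = E g v + E g w"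
  and E_scale: "g \<in> carrier G \<Longrightarrow> w \<in> W \<Longrightarrow> E g (s c w) = s c (E g w)"
  using E_linear[of g] by (auto simp: linear_between_def)

lemma E_left [simp]: "k \<in> K \<Longrightarrow> g \<in> carrier G \<Longrightarrow> w \<in> W \<Longrightarrow> E (k \<otimes> g) w = E g w"
  and E_right [simp]: "k \<in> K \<Longrightarrow> g \<in> carrier G \<Longrightarrow> w \<in> W \<Longrightarrow> E (g \<otimes> k) w = E g w"
  using E_bi[of k \<one> g w] E_bi[of \<one> k g w] by simp_all

lemma W_0: "0 \<in> W" using W by (rule subspace_0)

lemma E_zero: "g \<in> carrier G \<Longrightarrow> E g 0 = 0"
  using E_scale[of g 0 0] W_0 by simp

text \<open>Functions on the group are extended by zero, which is where the case distinctions come from.\<close>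

definition shift :: "'g \<Rightarrow> ('g \<Rightarrow> 'w) \<Rightarrow> 'g \<Rightarrow> 'w" where
  "shift g F = (\<lambda>x. if x \<in> carrier G then F (x \<otimes> g) else 0)"

text \<open>A fixed vector \<open>w\<close> becomes the function \<open>g \<mapsto> e\<^sub>K \<pi>(g) w\<close>, since \<open>e\<^sub>K \<pi>(g) e\<^sub>K\<close> acts as \<open>E g\<close>.\<close>

definition emb :: "'w \<Rightarrow> 'g \<Rightarrow> 'w" where
  "emb w = (\<lambda>x. if x \<in> carrier G then E x w else 0)"

definition gen :: "'w set \<Rightarrow> ('g \<Rightarrow> 'w) set" where
  "gen X = fs.span {shift g (emb w) |g w. g \<in> carrier G \<and> w \<in> X}"

abbreviation "V \<equiv> gen W"

lemma shift_add: "shift g (F + F') = shift g F + shift g F'"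
  and shift_scale: "shift g (fscale c F) = fscale c (shift g F)"
  by (auto simp: shift_def fun_scale_def fun_eq_iff)

lemma shift_mult:
  "g \<in> carrier G \<Longrightarrow> h \<in> carrier G \<Longrightarrow> shift g (shift h F) = shift (g \<otimes> h) F"
  by (auto simp: shift_def fun_eq_iff m_assoc)

lemma emb_add: "v \<in> W \<Longrightarrow> w \<in> W \<Longrightarrow> emb (v + w) = emb v + emb w"
  and emb_scale: "w \<in> W \<Longrightarrow> emb (s c w) = fscale c (emb w)"
  by (auto simp: emb_def E_add E_scale fun_scale_def fun_eq_iff)

lemma emb_zero: "emb 0 = 0"
  by (auto simp: emb_def E_zero fun_eq_iff)

lemma emb_one: "w \<in> W \<Longrightarrow> emb w \<one> = w"
  by (simp add: emb_def E_one)

lemma shift_emb: "g \<in> carrier G \<Longrightarrow> w \<in> X \<Longrightarrow> shift g (emb w) \<in> gen X"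
  unfolding gen_def by (rule fs.span_base) blast

lemma shift_one_emb: "shift \<one> (emb w) = emb w"
  by (auto simp: shift_def emb_def)

lemma emb_gen: "w \<in> X \<Longrightarrow> emb w \<in> gen X"
  using shift_emb[of \<one>] by (simp add: shift_one_emb)

lemma gen_subspace: "fs.subspace (gen X)"
  unfolding gen_def by (rule fs.subspace_span)

lemma gen_mono: "X \<subseteq> Y \<Longrightarrow> gen X \<subseteq> gen Y"
  unfolding gen_def by (rule fs.span_mono) blast

lemma gen_minimal:
  assumes "fs.subspace U" "\<And>g w. g \<in> carrier G \<Longrightarrow> w \<in> X \<Longrightarrow> shift g (emb w) \<in> U"
  shows "gen X \<subseteq> U"
  unfolding gen_def using assms by (intro fs.span_minimal) auto

lemma gen_outside: "F \<in> gen X \<Longrightarrow> x \<notin> carrier G \<Longrightarrow> F x = 0"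
proof -
  have "gen X \<subseteq> {F. \<forall>x. x \<notin> carrier G \<longrightarrow> F x = 0}"
    by (rule gen_minimal, rule fs.subspaceI) (auto simp: fun_scale_def shift_def)
  then show "F \<in> gen X \<Longrightarrow> x \<notin> carrier G \<Longrightarrow> F x = 0" by blast
qed

lemma gen_shift:
  assumes "F \<in> gen X" "g \<in> carrier G" shows "shift g F \<in> gen X"
proof -
  have "gen X \<subseteq> {F. shift g F \<in> gen X}"
  proof (rule gen_minimal, rule fs.subspaceI)
    show "0 \<in> {F. shift g F \<in> gen X}"
    proof -
      have "shift g 0 = 0" by (auto simp: shift_def fun_eq_iff)
      then show ?thesis using fs.subspace_0[OF gen_subspace] by simp
    qed
  qed (use assms(2) in \<open>auto simp: shift_add shift_scale shift_mult shift_emb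
        fs.subspace_add[OF gen_subspace] fs.subspace_scale[OF gen_subspace]\<close>)
  then show ?thesis using assms by blast
qed

lemma shift_linear: "g \<in> carrier G \<Longrightarrow> linear_between fscale V fscale V (shift g)"
  by (auto simp: linear_between_def shift_add shift_scale gen_shift)

abbreviation "submodule X \<equiv> invariant_subspace s (E ` carrier G) W X"
abbreviation "subrep U \<equiv> invariant_subspace fscale (shift ` carrier G) V U"

lemma submodule_D:
  assumes "submodule X"
  shows "X \<subseteq> W" "subspace X" "\<And>g w. g \<in> carrier G \<Longrightarrow> w \<in> X \<Longrightarrow> E g w \<in> X"
  using assms by (auto simp: invariant_subspace_def)

lemma subrep_D:
  assumes "subrep U"
  shows "U \<subseteq> V" "fs.subspace U" "\<And>g F. g \<in> carrier G \<Longrightarrow> F \<in> U \<Longrightarrow> shift g F \<in> U"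
  using assms by (auto simp: invariant_subspace_def)

lemma gen_values:
  assumes "submodule X" "F \<in> gen X" shows "F x \<in> X"
proof -
  have 0: "0 \<in> X" using submodule_D(2)[OF assms(1)] by (rule subspace_0)
  have "gen X \<subseteq> {F. \<forall>x. F x \<in> X}"
  proof (rule gen_minimal, rule fs.subspaceI)
    fix g w assume "g \<in> carrier G" "w \<in> X"
    then show "shift g (emb w) \<in> {F. \<forall>x. F x \<in> X}"
      using submodule_D[OF assms(1)] 0 by (auto simp: shift_def emb_def)
  qed (use submodule_D(2)[OF assms(1)] 0 in \<open>auto simp: fun_scale_def subspace_add subspace_scale\<close>)
  then show ?thesis using assms by blast
qed

lemma submodule_W: "submodule W"
  using E_linear W by (auto simp: invariant_subspace_def)

lemma V_values: "F \<in> V \<Longrightarrow> F x \<in> W"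
  using gen_values[OF submodule_W] .

lemma subrep_gen: "X \<subseteq> W \<Longrightarrow> subrep (gen X)"
  using gen_subspace gen_shift gen_mono[of X W] by (auto simp: invariant_subspace_def)

text \<open>Averaging over \<open>K\<close> is done over the cosets of a subgroup \<open>H\<close> of \<open>K\<close> that is small enough,
  uniformly in \<open>H\<close> so that sums of functions can be treated. For \<open>F x = E (xg) w\<close> the formula
  is \<open>E_mult\<close>.\<close>

definition averaged_by :: "'g set \<Rightarrow> ('g \<Rightarrow> 'w) \<Rightarrow> bool" where
  "averaged_by H F \<longleftrightarrow> subgroup H G \<and> openin (gtop G) H \<and> H \<subseteq> K \<and> (\<forall>h\<in>H. shift h F = F) \<and>
     (\<forall>y\<in>carrier G. s (of_nat (card ((\<lambda>k. k <# H) ` K))) (E y (F \<one>)) =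
        (\<Sum>C\<in>(\<lambda>k. k <# H) ` K. F (y \<otimes> rep C)))"

definition eventually_averaged :: "('g \<Rightarrow> 'w) \<Rightarrow> bool" where
  "eventually_averaged F \<longleftrightarrow> (\<exists>H0. subgroup H0 G \<and> openin (gtop G) H0 \<and> H0 \<subseteq> K \<and>
     (\<forall>H. subgroup H G \<longrightarrow> openin (gtop G) H \<longrightarrow> H \<subseteq> H0 \<longrightarrow> averaged_by H F))"

text \<open>Right translation by \<open>g\<close> is undone by conjugation: averaging over \<open>K\<close> modulo \<open>K \<inter> gKg\<^sup>-\<^sup>1\<close> runs
  through the cosets in \<open>KgK\<close> with constant multiplicity.\<close>

lemma eventually_averaged_generator:
  assumes g: "g \<in> carrier G" and w: "w \<in> W"
  shows "eventually_averaged (shift g (emb w))"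
proof -
  let ?F = "shift g (emb w)"
  let ?H0 = "{k \<in> K. inv g \<otimes> k \<otimes> g \<in> K}"
  have "averaged_by H ?F" if H: "subgroup H G" "openin (gtop G) H" "H \<subseteq> ?H0" for H
    unfolding averaged_by_def
  proof (intro conjI ballI)
    fix h assume "h \<in> H"
    then have h: "h \<in> K" "inv g \<otimes> h \<otimes> g \<in> K" using H(3) by auto
    have "E (x \<otimes> h \<otimes> g) w = E (x \<otimes> g) w" if x: "x \<in> carrier G" for x
    proof -
      have "x \<otimes> h \<otimes> g = (x \<otimes> g) \<otimes> (inv g \<otimes> h \<otimes> g)" using x g h(1) by (simp add: m_assoc)
      then show ?thesis using E_right[OF h(2), of "x \<otimes> g" w] x g w by simp
    qed
    then show "shift h ?F = ?F" using h(1) g by (auto simp: shift_def emb_def fun_eq_iff)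
  next
    fix y assume y: "y \<in> carrier G"
    let ?Q = "(\<lambda>k. k <# H) ` K"
    define n where "n = complex_of_nat (card (orb g))"
    have n: "n \<noteq> 0" using card_orb[OF g] by (simp add: n_def)
    have rQ: "rep C \<in> carrier G" if "C \<in> ?Q" for C
      using that rep_coset_carrier[OF H(1)] by auto
    have "s n (\<Sum>C\<in>?Q. ?F (y \<otimes> rep C)) = s n (\<Sum>C\<in>?Q. E (y \<otimes> rep ((rep C \<otimes> g) <# K)) w)"
    proof (intro arg_cong[where f = "s n"] sum.cong refl)
      fix C assume C: "C \<in> ?Q"
      have "E (y \<otimes> rep ((rep C \<otimes> g) <# K)) w = E (y \<otimes> (rep C \<otimes> g)) w"
        using fun_rep_coset[OF subgroup_K, of "rep C \<otimes> g" "\<lambda>z. E (y \<otimes> z) w"] rQ[OF C] y g w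
        by (simp add: m_assoc[symmetric])
      then show "?F (y \<otimes> rep C) = E (y \<otimes> rep ((rep C \<otimes> g) <# K)) w"
        using rQ[OF C] y g by (simp add: shift_def emb_def m_assoc)
    qed
    also have "\<dots> = s (of_nat (card ?Q)) (\<Sum>D\<in>orb g. E (y \<otimes> rep D) w)"
      using sum_over_orb[OF H g complex_space_axioms, of "\<lambda>D. E (y \<otimes> rep D) w"]
      by (simp only: n_def)
    also have "\<dots> = s n (s (of_nat (card ?Q)) (E y (E g w)))"
      unfolding E_mult[OF y g w, symmetric] n_def by (rule scale_left_commute)
    also have "E y (E g w) = E y (?F \<one>)" using g by (simp add: shift_def emb_def)
    finally show "s (of_nat (card ?Q)) (E y (?F \<one>)) = (\<Sum>C\<in>?Q. ?F (y \<otimes> rep C))"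
      by (rule scale_left_imp_eq[OF n, symmetric])
  qed (use H in auto)
  then show ?thesis
    unfolding eventually_averaged_def using open_conj[OF g] by (intro exI[of _ ?H0]) auto
qed

lemma eventually_averaged_V:
  assumes "F \<in> V" shows "eventually_averaged F"
proof -
  have "V \<subseteq> {F \<in> V. eventually_averaged F}"
  proof (rule gen_minimal, rule fs.subspaceI)
    have "E y 0 = 0" "shift h 0 = 0" if "y \<in> carrier G" for y h
      using that by (auto simp: E_zero shift_def)
    then show "0 \<in> {F \<in> V. eventually_averaged F}"
      using fs.subspace_0[OF gen_subspace] subgroup_K open_K
      by (auto simp: eventually_averaged_def averaged_by_def intro!: exI[of _ K])
  next
    fix F F' assume F: "F \<in> {F \<in> V. eventually_averaged F}" "F' \<in> {F \<in> V. eventually_averaged F}"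
    obtain H where H: "subgroup H G" "openin (gtop G) H" "H \<subseteq> K"
      "\<And>H'. subgroup H' G \<Longrightarrow> openin (gtop G) H' \<Longrightarrow> H' \<subseteq> H \<Longrightarrow> averaged_by H' F"
      using F by (auto simp: eventually_averaged_def)
    obtain H' where H': "subgroup H' G" "openin (gtop G) H'" "H' \<subseteq> K"
      "\<And>H''. subgroup H'' G \<Longrightarrow> openin (gtop G) H'' \<Longrightarrow> H'' \<subseteq> H' \<Longrightarrow> averaged_by H'' F'"
      using F by (auto simp: eventually_averaged_def)
    have "averaged_by H'' (F + F')"
      if "subgroup H'' G" "openin (gtop G) H''" "H'' \<subseteq> H \<inter> H'" for H''
    proof -
      have "averaged_by H'' F" "averaged_by H'' F'" using that H(4) H'(4) by auto
      then show ?thesis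
        using V_values F
        by (auto simp: averaged_by_def shift_add E_add scale_right_distrib sum.distrib)
    qed
    moreover have "subgroup (H \<inter> H') G" "openin (gtop G) (H \<inter> H')" "H \<inter> H' \<subseteq> K"
      using H H' subgroups_Inter_pair by auto
    ultimately have "eventually_averaged (F + F')" unfolding eventually_averaged_def by blast
    then show "F + F' \<in> {F \<in> V. eventually_averaged F}"
      using F fs.subspace_add[OF gen_subspace] by blast
  next
    fix c F assume F: "F \<in> {F \<in> V. eventually_averaged F}"
    have "averaged_by H (fscale c F)" if H: "averaged_by H F" for H
    proof -
      let ?Q = "(\<lambda>k. k <# H) ` K"
      have "s (of_nat (card ?Q)) (E y (fscale c F \<one>)) = (\<Sum>C\<in>?Q. fscale c F (y \<otimes> rep C))"
        if y: "y \<in> carrier G" for y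
      proof -
        have "s (of_nat (card ?Q)) (E y (fscale c F \<one>)) = s c (s (of_nat (card ?Q)) (E y (F \<one>)))"
          using y F V_values by (simp add: fun_scale_def E_scale mult.commute)
        also have "\<dots> = s c (\<Sum>C\<in>?Q. F (y \<otimes> rep C))" using H y by (simp add: averaged_by_def)
        finally show ?thesis by (simp add: fun_scale_def scale_sum_right)
      qed
      then show ?thesis using H by (simp add: averaged_by_def shift_scale)
    qed
    then have "eventually_averaged (fscale c F)"
      using F unfolding eventually_averaged_def by blast
    then show "fscale c F \<in> {F \<in> V. eventually_averaged F}"
      using F fs.subspace_scale[OF gen_subspace] by blast
  qed (auto simp: eventually_averaged_generator shift_emb)
  then show ?thesis using assms by blast
qed

text \<open>The projection of \<open>F\<close> to the \<open>K\<close>-fixed vectors is \<open>emb (F \<one>)\<close>.\<close>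

lemma average_eq_emb:
  assumes "F \<in> V"
  obtains Q :: "'g set set" where "card Q \<noteq> 0" "\<And>C. C \<in> Q \<Longrightarrow> rep C \<in> K"
    "fscale (of_nat (card Q)) (emb (F \<one>)) = (\<Sum>C\<in>Q. shift (rep C) F)"
proof -
  obtain H where H: "averaged_by H F"
    using eventually_averaged_V[OF assms] by (auto simp: eventually_averaged_def)
  let ?Q = "(\<lambda>k. k <# H) ` K"
  have sub: "subgroup H G" "openin (gtop G) H" "H \<subseteq> K" using H by (auto simp: averaged_by_def)
  have "K \<noteq> {}" using K_closed(1) by blast
  then have "card ?Q \<noteq> 0" using finite_cosets[OF sub(1,2) compact_K] by (simp add: card_eq_0_iff)
  moreover have "rep C \<in> K" if "C \<in> ?Q" for C
  proof -
    obtain k where k: "k \<in> K" "C = k <# H" using \<open>C \<in> ?Q\<close> by blast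
    obtain h where "h \<in> H" "rep C = k \<otimes> h" using rep_coset[OF sub(1), of k] k by auto
    then show ?thesis using k(1) sub(3) by auto
  qed
  moreover have "fscale (of_nat (card ?Q)) (emb (F \<one>)) = (\<Sum>C\<in>?Q. shift (rep C) F)"
  proof
    fix y show "fscale (of_nat (card ?Q)) (emb (F \<one>)) y = (\<Sum>C\<in>?Q. shift (rep C) F) y"
      using H by (auto simp: averaged_by_def fun_scale_def emb_def sum_fun_apply shift_def)
  qed
  ultimately show thesis using that by blast
qed

text \<open>An average of translates of \<open>F\<close> lies in every subrepresentation containing \<open>F\<close>. So a nonzero
  subrepresentation has nonzero \<open>K\<close>-fixed vectors.\<close>

lemma emb_value_mem:
  assumes U: "subrep U" and F: "F \<in> U" and x: "x \<in> carrier G"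
  shows "emb (F x) \<in> U"
proof -
  note sub = subrep_D[OF U]
  have "emb (F \<one>) \<in> U" if F: "F \<in> U" for F
  proof -
    obtain Q :: "'g set set" where Q: "card Q \<noteq> 0" "\<And>C. C \<in> Q \<Longrightarrow> rep C \<in> K"
      "fscale (of_nat (card Q)) (emb (F \<one>)) = (\<Sum>C\<in>Q. shift (rep C) F)"
      using average_eq_emb[of F] F sub(1) by blast
    let ?n = "complex_of_nat (card Q)"
    have "fscale ?n (emb (F \<one>)) \<in> U"
      unfolding Q(3) using sub(2) by (rule fs.subspace_sum) (use sub(3) F Q(2) in auto)
    then have "fscale (inverse ?n) (fscale ?n (emb (F \<one>))) \<in> U"
      by (rule fs.subspace_scale[OF sub(2)])
    then show ?thesis using Q(1) by simp
  qed
  from this[of "shift x F"] show ?thesis using F sub(3) x by (simp add: shift_def)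
qed

text \<open>A fixed vector is its own average.\<close>

lemma fixed_eq_emb:
  assumes F: "F \<in> V" and fixed: "\<And>k. k \<in> K \<Longrightarrow> shift k F = F"
  shows "F = emb (F \<one>)"
proof -
  obtain Q :: "'g set set" where Q: "card Q \<noteq> 0" "\<And>C. C \<in> Q \<Longrightarrow> rep C \<in> K"
    "fscale (of_nat (card Q)) (emb (F \<one>)) = (\<Sum>C\<in>Q. shift (rep C) F)"
    using average_eq_emb[OF F] by blast
  have "(\<Sum>C\<in>Q. shift (rep C) F) = (\<Sum>C\<in>Q. F)" using Q(2) fixed by (intro sum.cong) auto
  also have "\<dots> = fscale (of_nat (card Q)) F" by (rule fs.sum_constant_scale)
  finally show ?thesis using Q(1,3) by simp
qed

lemma shift_K_emb: "k \<in> K \<Longrightarrow> w \<in> W \<Longrightarrow> shift k (emb w) = emb w"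
  by (auto simp: shift_def emb_def fun_eq_iff)

lemma fixed_vectors_eq: "fixed_vectors V shift K = emb ` W"
proof (intro Set.set_eqI iffI)
  fix F assume "F \<in> fixed_vectors V shift K"
  then have "F \<in> V" "F = emb (F \<one>)" using fixed_eq_emb by (auto simp: fixed_vectors_def)
  then show "F \<in> emb ` W" using V_values by blast
qed (auto simp: fixed_vectors_def emb_gen shift_K_emb)

lemma V_smooth: "smooth_rep G fscale V shift"
proof -
  have "openin (gtop G) {g \<in> carrier G. shift g F = F}" if F: "F \<in> V" for F
  proof -
    obtain H where "averaged_by H F"
      using eventually_averaged_V[OF F] by (auto simp: eventually_averaged_def)
    then have H: "subgroup H G" "openin (gtop G) H" "\<And>h. h \<in> H \<Longrightarrow> shift h F = F"
      by (auto simp: averaged_by_def)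
    let ?S = "{g \<in> carrier G. shift g F = F}"
    have "x <# H \<subseteq> ?S" if "x \<in> ?S" for x
      using that H(1,3) by (auto simp: l_coset_def subgroup.mem_carrier shift_mult[symmetric])
    moreover have "x \<in> x <# H" if "x \<in> ?S" for x
      using coset_eq_iff[OF H(1), of x x] that by simp
    ultimately have "?S = \<Union>((\<lambda>x. x <# H) ` ?S)" by blast
    moreover have "openin (gtop G) (\<Union>((\<lambda>x. x <# H) ` ?S))"
      using open_coset[OF H(2)] by (intro openin_Union) blast
    ultimately show ?thesis by simp
  qed
  moreover have "shift \<one> F = F" if "F \<in> V" for F
    using gen_outside[OF that] by (auto simp: shift_def fun_eq_iff)
  ultimately show ?thesis
    using gen_subspace shift_linear fs.vector_space_axioms
    by (auto simp: smooth_rep_def shift_mult)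
qed

subsection \<open>Subrepresentations and submodules\<close>

abbreviation fixed_part :: "('g \<Rightarrow> 'w) set \<Rightarrow> 'w set" where
  "fixed_part U \<equiv> {w \<in> W. emb w \<in> U}"

lemma fixed_part_submodule:
  assumes U: "subrep U" shows "submodule (fixed_part U)"
proof -
  note sub = subrep_D[OF U]
  have "subspace (fixed_part U)"
    by (rule subspaceI)
      (auto simp: W_0 emb_zero emb_add emb_scale fs.subspace_0[OF sub(2)] fs.subspace_add[OF sub(2)]
        fs.subspace_scale[OF sub(2)] subspace_add[OF W] subspace_scale[OF W])
  moreover have "emb (E g w) \<in> U" if "g \<in> carrier G" "emb w \<in> U" for g w
    using emb_value_mem[OF U that(2,1)] that(1) by (simp add: emb_def)
  ultimately show ?thesis by (auto simp: invariant_subspace_def)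
qed

lemma fixed_part_gen:
  assumes X: "submodule X" shows "fixed_part (gen X) = X"
proof (intro Set.set_eqI iffI)
  fix w assume "w \<in> fixed_part (gen X)"
  then show "w \<in> X" using gen_values[OF X, of "emb w" \<one>] by (simp add: emb_one)
qed (use submodule_D[OF X] emb_gen in auto)

lemma gen_fixed_part_subset:
  assumes "subrep U" shows "gen (fixed_part U) \<subseteq> U"
  using subrep_D[OF assms] by (intro gen_minimal) auto

text \<open>Every value of a function in \<open>U\<close> gives a fixed vector of \<open>U\<close>.\<close>

lemma subrep_trivial:
  assumes U: "subrep U" and "fixed_part U \<subseteq> {0}" shows "U \<subseteq> {0}"
proof
  fix F assume F: "F \<in> U"
  have "F x = 0" for x
  proof (cases "x \<in> carrier G")
    case True
    then have "F x \<in> fixed_part U"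
      using emb_value_mem[OF U F] V_values subrep_D(1)[OF U] F by auto
    then show ?thesis using assms(2) by auto
  next
    case False
    then show ?thesis using gen_outside subrep_D(1)[OF U] F by blast
  qed
  then show "F \<in> {0}" by (auto simp: fun_eq_iff)
qed

lemma E_linear_all: "\<forall>T\<in>E ` carrier G. linear_between s W s W T"
  and shift_linear_all: "\<forall>T\<in>shift ` carrier G. linear_between fscale V fscale V T"
  using E_linear shift_linear by auto

text \<open>With a complement \<open>Y\<close> of the submodule \<open>X = U\<^sup>K\<close>, every element of \<open>U\<close> is congruent modulo
  \<open>gen X\<close> to an element of \<open>U \<inter> gen Y\<close>, a subrepresentation without \<open>K\<close>-fixed vectors.\<close>

lemma gen_fixed_part:
  assumes U: "subrep U" and ss: "semisimple_under s (E ` carrier G) W"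
  shows "gen (fixed_part U) = U"
proof (rule antisym[OF gen_fixed_part_subset[OF U]])
  let ?X = "fixed_part U"
  note X = fixed_part_submodule[OF U] and sub = subrep_D[OF U]
  obtain Y where Y: "submodule Y" "?X \<inter> Y = {0}"
    and dec: "\<And>w. w \<in> W \<Longrightarrow> \<exists>u\<in>?X. \<exists>v\<in>Y. w = u + v"
    using semisimple_complement[OF W E_linear_all ss X] by blast
  have YW: "Y \<subseteq> W" using submodule_D[OF Y(1)] by simp
  have "subrep (U \<inter> gen Y)" using fs.invariant_subspace_Int[OF U subrep_gen[OF YW]] .
  moreover have "fixed_part (U \<inter> gen Y) = ?X \<inter> Y"
    using fixed_part_gen[OF Y(1)] by blast
  ultimately have triv: "U \<inter> gen Y \<subseteq> {0}" using subrep_trivial Y(2) by blast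
  have "V \<subseteq> {F + F' |F F'. F \<in> gen ?X \<and> F' \<in> gen Y}"
  proof (rule gen_minimal)
    show "fs.subspace {F + F' |F F'. F \<in> gen ?X \<and> F' \<in> gen Y}"
      using fs.subspace_sums[OF gen_subspace gen_subspace] .
    fix g w assume g: "g \<in> carrier G" and "w \<in> W"
    then obtain u v where uv: "u \<in> ?X" "v \<in> Y" "w = u + v" using dec by blast
    then have "shift g (emb w) = shift g (emb u) + shift g (emb v)"
      using YW by (auto simp: emb_add shift_add)
    then show "shift g (emb w) \<in> {F + F' |F F'. F \<in> gen ?X \<and> F' \<in> gen Y}"
      using shift_emb[OF g uv(1)] shift_emb[OF g uv(2)] by auto
  qed
  moreover have "F + F' \<in> gen ?X" if "F + F' \<in> U" "F \<in> gen ?X" "F' \<in> gen Y" for F F'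
  proof -
    have "F' = (F + F') - F" by simp
    then have "F' \<in> U"
      using that(1,2) gen_fixed_part_subset[OF U] fs.subspace_diff[OF sub(2)] by (metis subsetD)
    then show ?thesis using triv that by auto
  qed
  ultimately show "U \<subseteq> gen ?X" using sub(1) by blast
qed

lemma fixed_part_iso:
  assumes ss: "semisimple_under s (E ` carrier G) W"
  shows "invariant_subspace_iso fscale (shift ` carrier G) V s (E ` carrier G) W fixed_part"
  unfolding invariant_subspace_iso_def
proof (intro conjI allI impI)
  show "bij_betw fixed_part {U. subrep U} {X. submodule X}"
    by (rule bij_betw_byWitness[where f' = gen])
      (auto simp: gen_fixed_part[OF _ ss] fixed_part_gen subrep_gen submodule_D(1) simp del: mem_Collect_eq
        intro!: fixed_part_submodule)
next
  fix U U' assume "subrep U" "subrep U'"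
  then show "fixed_part U \<subseteq> fixed_part U' \<longleftrightarrow> U \<subseteq> U'"
    using gen_mono[of "fixed_part U" "fixed_part U'"] gen_fixed_part[OF _ ss] by auto
qed

text \<open>The subrepresentations generated by the simple submodules are simple, and together they contain
  all generators of \<open>V\<close>.\<close>

lemma V_semisimple:
  assumes ss: "semisimple_under s (E ` carrier G) W"
  shows "semisimple_under fscale (shift ` carrier G) V"
proof -
  let ?soc = "socle fscale (shift ` carrier G) V"
  note inv = fs.socle_invariant[OF gen_subspace shift_linear_all]
  note iso = invariant_subspace_iso_inv[OF fixed_part_iso[OF ss]]
  have "N \<subseteq> fixed_part ?soc" if N: "submodule N" "simple_under s (E ` carrier G) N" for N
  proof -
    let ?I = "{U. subrep U}"
    have bij: "bij_betw fixed_part ?I {X. submodule X}"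
      using fixed_part_iso[OF ss] by (simp add: invariant_subspace_iso_def)
    have "inv_into ?I fixed_part N = gen N"
      using inv_into_f_f[OF bij_betw_imp_inj_on[OF bij], of "gen N"]
        subrep_gen[OF submodule_D(1)[OF N(1)]] fixed_part_gen[OF N(1)] by simp
    then have "simple_under fscale (shift ` carrier G) (gen N)"
      using invariant_subspace_iso_simple[OF iso vector_space_axioms fs.vector_space_axioms
          W E_linear_all gen_subspace shift_linear_all N] by simp
    then have "gen N \<subseteq> ?soc"
      using fs.simple_subset_socle[OF subrep_gen[OF submodule_D(1)[OF N(1)]]] by blast
    then show ?thesis using emb_gen submodule_D(1)[OF N(1)] by blast
  qed
  then have "socle s (E ` carrier G) W \<subseteq> fixed_part ?soc"
    using submodule_D(2)[OF fixed_part_submodule[OF inv]] by (intro socle_minimal)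
  then have "V \<subseteq> ?soc"
    using ss gen_fixed_part_subset[OF inv] gen_mono[of W "fixed_part ?soc"]
    by (auto simp: semisimple_under_def)
  then show ?thesis
    using fs.socle_subset[OF gen_subspace] unfolding semisimple_under_def by (intro antisym)
qed

end

section \<open>Twisting\<close>

locale twisted_pair = open_compact_pair G K for G :: "'g topgroup" (structure) and K :: "'g set" +
  fixes S :: "('g, 'x) twisted" and \<omega> :: "'g \<Rightarrow> complex" and \<delta>\<^sub>1 :: 'x
  assumes twisted: "twisted_space G S"
    and base: "\<delta>\<^sub>1 \<in> topspace (stop S)"
    and char: "character G \<omega>"
    and \<omega>_K: "\<And>k. k \<in> K \<Longrightarrow> \<omega> k = 1"
    and twist_K: "twist S \<delta>\<^sub>1 ` K = K"
begin

abbreviation \<theta> :: "'g \<Rightarrow> 'g" where "\<theta> \<equiv> twist S \<delta>\<^sub>1"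

definition \<theta>' :: "'g \<Rightarrow> 'g" where "\<theta>' = inv_into (carrier G) \<theta>"

abbreviation pt :: "'g \<Rightarrow> 'x" where "pt x \<equiv> lact S x \<delta>\<^sub>1"

definition pt' :: "'x \<Rightarrow> 'g" where "pt' = inv_into (carrier G) pt"

lemma \<omega>_nonzero [simp]: "x \<in> carrier G \<Longrightarrow> \<omega> x \<noteq> 0"
  and \<omega>_mult: "x \<in> carrier G \<Longrightarrow> y \<in> carrier G \<Longrightarrow> \<omega> (x \<otimes> y) = \<omega> x * \<omega> y"
  using char by (auto simp: character_def)

lemma \<theta>_iso: "\<theta> \<in> iso G G"
  using twisted base by (auto simp: twisted_space_def)

lemma \<theta>_bij: "bij_betw \<theta> (carrier G) (carrier G)"
  and \<theta>_mult: "x \<in> carrier G \<Longrightarrow> y \<in> carrier G \<Longrightarrow> \<theta> (x \<otimes> y) = \<theta> x \<otimes> \<theta> y"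
  using \<theta>_iso by (auto simp: iso_def hom_def)

lemma \<theta>_closed [simp]: "x \<in> carrier G \<Longrightarrow> \<theta> x \<in> carrier G"
  and \<theta>'_closed [simp]: "x \<in> carrier G \<Longrightarrow> \<theta>' x \<in> carrier G"
  and \<theta>_\<theta>' [simp]: "x \<in> carrier G \<Longrightarrow> \<theta> (\<theta>' x) = x"
  and \<theta>'_\<theta> [simp]: "x \<in> carrier G \<Longrightarrow> \<theta>' (\<theta> x) = x"
  using \<theta>_bij bij_betw_inv_into[OF \<theta>_bij] bij_betw_inv_into_left[OF \<theta>_bij]
    bij_betw_inv_into_right[OF \<theta>_bij]
  unfolding \<theta>'_def by (auto intro: bij_betw_apply)

lemma \<theta>'_mult: "x \<in> carrier G \<Longrightarrow> y \<in> carrier G \<Longrightarrow> \<theta>' (x \<otimes> y) = \<theta>' x \<otimes> \<theta>' y"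
  using \<theta>_mult[of "\<theta>' x" "\<theta>' y"] \<theta>'_\<theta>[of "\<theta>' x \<otimes> \<theta>' y"] by simp

lemma \<theta>_inv: "x \<in> carrier G \<Longrightarrow> \<theta> (inv x) = inv (\<theta> x)"
  using group_hom.hom_inv[of G G \<theta>] \<theta>_iso by (auto simp: group_hom_def group_hom_axioms_def iso_def)

lemma \<theta>_K [simp]: "k \<in> K \<Longrightarrow> \<theta> k \<in> K"
  using twist_K by blast

lemma \<theta>'_K [simp]: "k \<in> K \<Longrightarrow> \<theta>' k \<in> K"
proof -
  assume "k \<in> K"
  then obtain k' where "k' \<in> K" "k = \<theta> k'" using twist_K by blast
  then show "\<theta>' k \<in> K" by simp
qed

lemma \<theta>_K_iff: "x \<in> carrier G \<Longrightarrow> \<theta> x \<in> K \<longleftrightarrow> x \<in> K"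
  using \<theta>'_K[of "\<theta> x"] by auto

lemma pt_homeomorphic: "homeomorphic_map (gtop G) (stop S) pt"
  using twisted base by (auto simp: twisted_space_def)

lemma pt_bij: "bij_betw pt (carrier G) (topspace (stop S))"
  using homeomorphic_imp_injective_map[OF pt_homeomorphic]
    homeomorphic_imp_surjective_map[OF pt_homeomorphic] by (simp add: bij_betw_def)

lemma pt_mem [simp]: "x \<in> carrier G \<Longrightarrow> pt x \<in> topspace (stop S)"
  and pt'_closed [simp]: "\<delta> \<in> topspace (stop S) \<Longrightarrow> pt' \<delta> \<in> carrier G"
  and pt_pt' [simp]: "\<delta> \<in> topspace (stop S) \<Longrightarrow> pt (pt' \<delta>) = \<delta>"
  and pt'_pt [simp]: "x \<in> carrier G \<Longrightarrow> pt' (pt x) = x"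
  using pt_bij bij_betw_inv_into[OF pt_bij] bij_betw_inv_into_left[OF pt_bij]
    bij_betw_inv_into_right[OF pt_bij]
  unfolding pt'_def by (auto intro: bij_betw_apply)

lemma lact_pt: "x \<in> carrier G \<Longrightarrow> y \<in> carrier G \<Longrightarrow> lact S x (pt y) = pt (x \<otimes> y)"
  using twisted base by (auto simp: twisted_space_def)

lemma twist_pt:
  "x \<in> carrier G \<Longrightarrow> y \<in> carrier G \<Longrightarrow> twist S (pt x) y = x \<otimes> \<theta> y \<otimes> inv x"
  using twisted base by (auto simp: twisted_space_def)

lemma ract_pt:
  assumes "x \<in> carrier G" "y \<in> carrier G" shows "ract S (pt x) y = pt (x \<otimes> \<theta> y)"
  using assms by (simp add: ract_def twist_pt lact_pt m_assoc)

lemma orb_\<theta>_eq: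
  assumes "x \<in> carrier G" "g \<in> carrier G" "orb x = orb g" shows "orb (\<theta> x) = orb (\<theta> g)"
proof -
  obtain k k' where "k \<in> K" "k' \<in> K" "x = k \<otimes> g \<otimes> k'" using orb_eqE assms by metis
  then show ?thesis using assms by (simp add: \<theta>_mult orb_left orb_right)
qed

lemma orb_\<theta>'_eq:
  assumes "x \<in> carrier G" "g \<in> carrier G" "orb x = orb g" shows "orb (\<theta>' x) = orb (\<theta>' g)"
proof -
  obtain k k' where "k \<in> K" "k' \<in> K" "x = k \<otimes> g \<otimes> k'" using orb_eqE assms by metis
  then show ?thesis using assms by (simp add: \<theta>'_mult orb_left orb_right)
qed

text \<open>As \<open>\<theta>\<close> maps \<open>xK\<close> to \<open>\<theta>(x)K\<close>, it identifies the left cosets in \<open>KgK\<close> and in \<open>K\<theta>(g)K\<close>. In terms of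
  volumes, \<open>\<theta>\<close> preserves the volume of double cosets.\<close>

lemma card_orb_\<theta>:
  assumes g: "g \<in> carrier G" shows "card (orb (\<theta> g)) = card (orb g)"
proof -
  have img: "\<theta> ` (x <# K) = \<theta> x <# K" if "x \<in> carrier G" for x
  proof -
    have "\<theta> ` (x <# K) = (\<lambda>k. \<theta> x \<otimes> k) ` \<theta> ` K"
      using that by (auto simp: l_coset_def \<theta>_mult image_iff)
    then show ?thesis by (auto simp: twist_K l_coset_def image_iff)
  qed
  have "(\<lambda>C. \<theta> ` C) ` orb g = (\<lambda>k. (\<theta> k \<otimes> \<theta> g) <# K) ` K"
    using g by (auto simp: orb_def image_image img \<theta>_mult intro!: image_cong)
  also have "\<dots> = (\<lambda>k. (k \<otimes> \<theta> g) <# K) ` \<theta> ` K" by (simp add: image_image)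
  also have "\<dots> = orb (\<theta> g)" by (simp only: twist_K orb_def)
  finally have eq: "(\<lambda>C. \<theta> ` C) ` orb g = orb (\<theta> g)" .
  have "C \<subseteq> carrier G" if "C \<in> orb g" for C
    using orb_coset[OF g that] l_coset_subset_G subgroup.subset[OF subgroup_K] by blast
  then have "inj_on (\<lambda>C. \<theta> ` C) (orb g)"
    using \<theta>_bij by (intro inj_onI) (meson bij_betw_def inj_on_image_eq_iff)
  then show ?thesis using card_image eq by metis
qed

end

text \<open>The operator \<open>T\<close> is the action on the \<open>K\<close>-fixed vectors of the base point \<open>\<delta>\<^sub>1\<close>, which normalises \<open>K\<close>.\<close>

locale twisted_operators = twisted_pair G K S \<omega> \<delta>\<^sub>1 + hecke_operators G K s W E
  for G :: "'g topgroup" (structure) and K :: "'g set" and S :: "('g, 'x) twisted"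
    and \<omega> :: "'g \<Rightarrow> complex" and \<delta>\<^sub>1 :: 'x
    and s :: "complex \<Rightarrow> 'w::ab_group_add \<Rightarrow> 'w" and W :: "'w set" and E :: "'g \<Rightarrow> 'w \<Rightarrow> 'w" +
  fixes T :: "'w \<Rightarrow> 'w"
  assumes T_linear: "linear_between s W s W T"
    and T_bij: "bij_betw T W W"
    and T_E: "g \<in> carrier G \<Longrightarrow> w \<in> W \<Longrightarrow> s (\<omega> g) (T (E g w)) = E (\<theta> g) (T w)"
begin

lemma T_W [simp]: "w \<in> W \<Longrightarrow> T w \<in> W"
  and T_add: "v \<in> W \<Longrightarrow> w \<in> W \<Longrightarrow> T (v + w) = T v + T w"
  and T_scale: "w \<in> W \<Longrightarrow> T (s c w) = s c (T w)"
  using T_linear by (auto simp: linear_between_def)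

lemma T_zero: "T 0 = 0"
  using T_scale[of 0 0] W_0 by simp

lemma T_inj: "v \<in> W \<Longrightarrow> w \<in> W \<Longrightarrow> T v = T w \<longleftrightarrow> v = w"
  using T_bij by (auto simp: bij_betw_def inj_on_def)

lemma T_surj: "w \<in> W \<Longrightarrow> \<exists>v\<in>W. T v = w"
  using bij_betw_imp_surj_on[OF T_bij] by (metis imageE)

lemma E_T:
  assumes "g \<in> carrier G" "w \<in> W"
  shows "E g (T w) = T (s (\<omega> (\<theta>' g)) (E (\<theta>' g) w))"
  using T_E[of "\<theta>' g" w] assms by (simp add: T_scale)

subsection \<open>Semisimplicity\<close>

lemma image_T_submodule: assumes X: "submodule X" shows "submodule (T ` X)"
proof -
  note sub = submodule_D[OF X]
  have "subspace (T ` X)"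
  proof (rule subspaceI)
    show "0 \<in> T ` X" using subspace_0[OF sub(2)] T_zero by force
  next
    fix v w assume "v \<in> T ` X" "w \<in> T ` X"
    then obtain v' w' where "v' \<in> X" "w' \<in> X" "v = T v'" "w = T w'" by blast
    then show "v + w \<in> T ` X"
      using sub(1) subspace_add[OF sub(2)]
      by (intro image_eqI[of _ _ "v' + w'"]) (auto simp: T_add subset_iff)
  next
    fix c v assume "v \<in> T ` X"
    then obtain v' where "v' \<in> X" "v = T v'" by blast
    then show "s c v \<in> T ` X"
      using sub(1) subspace_scale[OF sub(2)]
      by (intro image_eqI[of _ _ "s c v'"]) (auto simp: T_scale subset_iff)
  qed
  moreover have "E g (T x) \<in> T ` X" if "g \<in> carrier G" "x \<in> X" for g x
  proof -
    have "s (\<omega> (\<theta>' g)) (E (\<theta>' g) x) \<in> X" using that sub by (simp add: subspace_scale)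
    then show ?thesis using E_T[of g x] that sub(1) by (simp add: subset_iff)
  qed
  ultimately show ?thesis using sub(1) by (auto simp: invariant_subspace_def)
qed

lemma preimage_T_submodule: assumes X: "submodule X" shows "submodule {w \<in> W. T w \<in> X}"
proof -
  note sub = submodule_D[OF X]
  have "subspace {w \<in> W. T w \<in> X}"
    by (rule subspaceI) (use sub(2) W in \<open>auto simp: W_0 T_zero T_add T_scale subspace_0 subspace_add subspace_scale\<close>)
  moreover have "T (E g w) \<in> X" if "g \<in> carrier G" "w \<in> W" "T w \<in> X" for g w
  proof -
    have "s (inverse (\<omega> g)) (E (\<theta> g) (T w)) \<in> X" using that sub by (auto intro!: subspace_scale)
    then show ?thesis using that by (simp add: T_E[symmetric])
  qed
  ultimately show ?thesis by (auto simp: invariant_subspace_def)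
qed

text \<open>Up to a nonzero scalar, moving \<open>T\<close> past the operators \<open>E g\<close> only permutes them, so images and
  preimages of submodules under \<open>T\<close> are submodules.\<close>

lemma image_T_iso: "invariant_subspace_iso s (E ` carrier G) W s (E ` carrier G) W (image T)"
  unfolding invariant_subspace_iso_def
proof (intro conjI allI impI)
  have "T ` {w \<in> W. T w \<in> X} = X" if "submodule X" for X
  proof (intro Set.set_eqI iffI)
    fix x assume x: "x \<in> X"
    obtain v where "v \<in> W" "T v = x" using T_surj[of x] submodule_D(1)[OF \<open>submodule X\<close>] x by blast
    then show "x \<in> T ` {w \<in> W. T w \<in> X}" using x by blast
  qed blast
  moreover have "{w \<in> W. T w \<in> T ` X} = X" if "submodule X" for X
  proof (intro Set.set_eqI iffI)
    fix w assume "w \<in> {w \<in> W. T w \<in> T ` X}"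
    then obtain x where "w \<in> W" "x \<in> X" "T w = T x" by blast
    then show "w \<in> X" using T_inj[of w x] submodule_D(1)[OF \<open>submodule X\<close>] by auto
  qed (use submodule_D(1)[OF that] in blast)
  ultimately show "bij_betw (image T) {X. submodule X} {X. submodule X}"
    by (intro bij_betw_byWitness[where f' = "\<lambda>X. {w \<in> W. T w \<in> X}"])
      (simp_all add: image_T_submodule preimage_T_submodule image_subset_iff)
next
  fix X Y assume "submodule X" "submodule Y"
  then have "X \<subseteq> W" "Y \<subseteq> W" using submodule_D(1) by blast+
  moreover have "inj_on T W" using T_bij by (simp add: bij_betw_def)
  ultimately show "T ` X \<subseteq> T ` Y \<longleftrightarrow> X \<subseteq> Y" by (simp add: inj_on_image_subset_iff)
qed

text \<open>The bijection \<open>T\<close> permutes the simple submodules, so it maps the socle onto itself.\<close>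

lemma W_semisimple:
  assumes simple: "\<And>X. submodule X \<Longrightarrow> X \<noteq> {0} \<Longrightarrow> T ` X = X \<Longrightarrow> X = W"
    and soc: "socle s (E ` carrier G) W \<noteq> {0}"
  shows "semisimple_under s (E ` carrier G) W"
proof -
  let ?soc = "socle s (E ` carrier G) W" and ?simple = "simple_under s (E ` carrier G)"
  let ?T' = "inv_into {X. submodule X} (image T)"
  note inv = socle_invariant[OF W E_linear_all]
  note simple_image = invariant_subspace_iso_simple[OF _ vector_space_axioms vector_space_axioms
      W E_linear_all W E_linear_all]
  note sub_soc = simple_subset_socle[of "E ` carrier G" W]
  have bij: "bij_betw (image T) {X. submodule X} {X. submodule X}"
    using image_T_iso by (simp add: invariant_subspace_iso_def)
  have "N \<subseteq> {w \<in> W. T w \<in> ?soc}" if N: "submodule N" "?simple N" for N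
    using sub_soc[OF image_T_submodule[OF N(1)] simple_image[OF image_T_iso N]] submodule_D(1)[OF N(1)]
    by blast
  then have 1: "?soc \<subseteq> {w \<in> W. T w \<in> ?soc}"
    using submodule_D(2)[OF preimage_T_submodule[OF inv]] by (intro socle_minimal)
  have "N \<subseteq> T ` ?soc" if N: "submodule N" "?simple N" for N
  proof -
    have N': "submodule (?T' N)" "T ` ?T' N = N"
      using bij_betw_apply[OF bij_betw_inv_into[OF bij], of N] bij_betw_inv_into_right[OF bij, of N] N(1)
      by auto
    have "?simple (?T' N)"
      by (rule simple_image[OF invariant_subspace_iso_inv[OF image_T_iso] N])
    then show ?thesis using sub_soc N' by blast
  qed
  then have 2: "?soc \<subseteq> T ` ?soc"
    using submodule_D(2)[OF image_T_submodule[OF inv]] by (intro socle_minimal)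
  have "?soc = W" by (rule simple[OF inv soc]) (use 1 2 in blast)
  then show ?thesis by (simp add: semisimple_under_def)
qed

subsection \<open>The twisted representation\<close>

text \<open>The operator \<open>twisting\<close> is the action of \<open>\<delta>\<^sub>1\<close>. Its formula is forced by
  the rule \<open>\<Pi>(\<delta>\<^sub>1) \<pi>(g) = \<omega>(g)\<^sup>-\<^sup>1 \<pi>(\<theta> g) \<Pi>(\<delta>\<^sub>1)\<close> and by \<open>\<Pi>(\<delta>\<^sub>1) = T\<close> on the \<open>K\<close>-fixed vectors: the
  value of \<open>F\<close> at \<open>x\<close> is the projection of \<open>\<pi>(x) F\<close> to these.\<close>

definition twisting :: "('g \<Rightarrow> 'w) \<Rightarrow> 'g \<Rightarrow> 'w" where
  "twisting F = (\<lambda>x. if x \<in> carrier G then s (\<omega> (\<theta>' x)) (T (F (\<theta>' x))) else 0)"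

definition tw_rep :: "'x \<Rightarrow> ('g \<Rightarrow> 'w) \<Rightarrow> 'g \<Rightarrow> 'w" where
  "tw_rep \<delta> F = shift (pt' \<delta>) (twisting F)"

lemma twisting_add: "F \<in> V \<Longrightarrow> F' \<in> V \<Longrightarrow> twisting (F + F') = twisting F + twisting F'"
  and twisting_scale: "F \<in> V \<Longrightarrow> twisting (fscale c F) = fscale c (twisting F)"
  using V_values by (auto simp: twisting_def T_add T_scale fun_scale_def fun_eq_iff
      scale_right_distrib mult.commute)

lemma twisting_emb: assumes "w \<in> W" shows "twisting (emb w) = emb (T w)"
proof -
  have "s (\<omega> (\<theta>' x)) (T (E (\<theta>' x) w)) = E x (T w)" if "x \<in> carrier G" for x
    using T_E[of "\<theta>' x" w] that assms by simp
  then show ?thesis using assms by (auto simp: twisting_def emb_def fun_eq_iff)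
qed

lemma twisting_shift:
  assumes "g \<in> carrier G" "F \<in> V"
  shows "fscale (\<omega> g) (twisting (shift g F)) = shift (\<theta> g) (twisting F)"
proof
  fix x show "fscale (\<omega> g) (twisting (shift g F)) x = shift (\<theta> g) (twisting F) x"
    using assms by (auto simp: twisting_def shift_def fun_scale_def \<theta>'_mult \<omega>_mult mult.commute)
qed

lemma twisting_V: assumes "F \<in> V" shows "twisting F \<in> V"
proof -
  have "V \<subseteq> {F \<in> V. twisting F \<in> V}"
  proof (rule gen_minimal, rule fs.subspaceI)
    have "twisting 0 = 0" by (auto simp: twisting_def T_zero fun_eq_iff)
    then show "0 \<in> {F \<in> V. twisting F \<in> V}" using fs.subspace_0[OF gen_subspace] by simp
  next
    fix g w assume g: "g \<in> carrier G" and w: "w \<in> W"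
    let ?F = "shift g (emb w)"
    have "fscale (\<omega> g) (twisting ?F) \<in> V"
      using twisting_shift[OF g emb_gen[OF w]] g w by (simp add: twisting_emb shift_emb)
    then have "fscale (inverse (\<omega> g)) (fscale (\<omega> g) (twisting ?F)) \<in> V"
      by (rule fs.subspace_scale[OF gen_subspace])
    then show "?F \<in> {F \<in> V. twisting F \<in> V}" using g w by (simp add: shift_emb)
  qed (auto simp: twisting_add twisting_scale fs.subspace_add[OF gen_subspace]
      fs.subspace_scale[OF gen_subspace])
  then show ?thesis using assms by blast
qed

lemma twisting_inj:
  assumes "F \<in> V" "F' \<in> V" "twisting F = twisting F'" shows "F = F'"
proof
  fix x
  show "F x = F' x"
  proof (cases "x \<in> carrier G")
    case True
    have "s (\<omega> x) (T (F x)) = s (\<omega> x) (T (F' x))"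
      using fun_cong[OF assms(3), of "\<theta> x"] True by (simp add: twisting_def)
    then show ?thesis using True V_values assms(1,2) T_inj by simp
  next
    case False
    then show ?thesis using gen_outside assms(1,2) by metis
  qed
qed

lemma twisting_surj: "V \<subseteq> twisting ` V"
proof (rule gen_minimal, rule fs.subspaceI)
  have "twisting 0 = 0" by (auto simp: twisting_def T_zero fun_eq_iff)
  then show "0 \<in> twisting ` V" using fs.subspace_0[OF gen_subspace] by force
next
  fix F F' assume "F \<in> twisting ` V" "F' \<in> twisting ` V"
  then obtain H H' where "H \<in> V" "H' \<in> V" "F = twisting H" "F' = twisting H'" by blast
  then show "F + F' \<in> twisting ` V"
    using fs.subspace_add[OF gen_subspace] by (intro image_eqI[of _ _ "H + H'"]) (auto simp: twisting_add)
next
  fix c F assume "F \<in> twisting ` V"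
  then obtain H where "H \<in> V" "F = twisting H" by blast
  then show "fscale c F \<in> twisting ` V"
    using fs.subspace_scale[OF gen_subspace]
    by (intro image_eqI[of _ _ "fscale c H"]) (auto simp: twisting_scale)
next
  fix g w assume g: "g \<in> carrier G" and "w \<in> W"
  then obtain v where v: "v \<in> W" "T v = w" using T_surj by blast
  let ?F = "shift (\<theta>' g) (emb v)"
  have F: "?F \<in> V" using shift_emb v(1) g by simp
  have "twisting (fscale (\<omega> (\<theta>' g)) ?F) = shift g (emb w)"
    using twisting_shift[of "\<theta>' g" "emb v"] g v emb_gen[OF v(1)] F by (simp add: twisting_scale twisting_emb)
  then show "shift g (emb w) \<in> twisting ` V"
    using fs.subspace_scale[OF gen_subspace F] by (metis imageI)
qed

lemma twisting_bij: "bij_betw twisting V V"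
  using twisting_surj twisting_V twisting_inj by (auto simp: bij_betw_def inj_on_def)

lemma shift_one: "F \<in> V \<Longrightarrow> shift \<one> F = F"
  using V_smooth by (simp add: smooth_rep_def)

lemma shift_bij: assumes "g \<in> carrier G" shows "bij_betw (shift g) V V"
  using assms gen_shift
  by (intro bij_betw_byWitness[where f' = "shift (inv g)"]) (auto simp: shift_mult shift_one)

lemma tw_rep_pt: "x \<in> carrier G \<Longrightarrow> tw_rep (pt x) F = shift x (twisting F)"
  by (simp add: tw_rep_def)

lemma V_twisted_rep: "smooth_twisted_rep G S \<omega> fscale V shift tw_rep"
  unfolding smooth_twisted_rep_def
proof (intro conjI ballI V_smooth)
  fix \<delta> assume \<delta>: "\<delta> \<in> topspace (stop S)"
  show "linear_between fscale V fscale V (tw_rep \<delta>)"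
    using \<delta> by (auto simp: linear_between_def tw_rep_def twisting_add twisting_scale
        shift_add shift_scale twisting_V gen_shift)
  have "tw_rep \<delta> = shift (pt' \<delta>) \<circ> twisting" by (auto simp: tw_rep_def)
  then show "bij_betw (tw_rep \<delta>) V V"
    using bij_betw_trans[OF twisting_bij shift_bij] \<delta> by simp
next
  fix x \<gamma> y F
  assume x: "x \<in> carrier G" and \<gamma>: "\<gamma> \<in> topspace (stop S)" and y: "y \<in> carrier G" and F: "F \<in> V"
  obtain z where z: "z \<in> carrier G" "\<gamma> = pt z" using pt'_closed[OF \<gamma>] pt_pt'[OF \<gamma>] by metis
  have "tw_rep (lact S x (ract S \<gamma> y)) F = shift x (shift z (shift (\<theta> y) (twisting F)))"
    using x y z by (simp add: ract_pt lact_pt tw_rep_pt shift_mult m_assoc)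
  also have "\<dots> = fscale (\<omega> y) (shift x (shift z (twisting (shift y F))))"
    by (simp add: shift_scale twisting_shift[OF y F, symmetric])
  finally show "tw_rep (lact S x (ract S \<gamma> y)) F = fscale (\<omega> y) (shift x (tw_rep \<gamma> (shift y F)))"
    using z by (simp add: tw_rep_pt)
qed

text \<open>Stability under all operators of the twisted space amounts to stability under \<open>G\<close> and under the
  action of \<open>\<delta>\<^sub>1\<close>, both of which pass to the \<open>K\<close>-fixed vectors.\<close>

lemma V_irreducible:
  assumes simple: "\<And>X. submodule X \<Longrightarrow> X \<noteq> {0} \<Longrightarrow> T ` X = X \<Longrightarrow> X = W" and ne: "W \<noteq> {0}"
  shows "irreducible_twisted S fscale V tw_rep"
  unfolding irreducible_twisted_def
proof (intro conjI allI impI)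
  show "V \<noteq> {0}"
  proof
    assume "V = {0}"
    then have "w = 0" if "w \<in> W" for w
      using emb_gen[OF that] emb_one[OF that] by (metis singletonD zero_fun_apply)
    then show False using ne W_0 by blast
  qed
next
  fix U assume U: "fs.subspace U \<and> U \<subseteq> V \<and> U \<noteq> {0} \<and> (\<forall>\<delta>\<in>topspace (stop S). tw_rep \<delta> ` U = U)"
  have sh: "(\<lambda>F. shift x (twisting F)) ` U = U" if "x \<in> carrier G" for x
  proof -
    have "tw_rep (pt x) ` U = U" using U that by simp
    then show ?thesis using that by (simp add: tw_rep_pt)
  qed
  \<comment> \<open>The base point itself acts by \<open>twisting\<close>.\<close>
  have tw: "twisting ` U = U"
  proof -
    have "(\<lambda>F. shift \<one> (twisting F)) ` U = twisting ` U"
      using U twisting_V by (intro image_cong refl shift_one) blast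
    then show ?thesis using sh[of \<one>] by simp
  qed
  have "shift x ` U \<subseteq> U" if "x \<in> carrier G" for x
    using sh[OF that] tw by (metis image_image subset_refl)
  then have sub: "subrep U" using U by (auto simp: invariant_subspace_def)
  let ?X = "fixed_part U"
  have "U \<noteq> {0}" "0 \<in> U" using U fs.subspace_0 by simp_all
  then have "?X \<noteq> {0}" using subrep_trivial[OF sub] by auto
  moreover have "T ` ?X = ?X"
  proof (intro Set.set_eqI iffI)
    fix v assume "v \<in> T ` ?X"
    then obtain w where w: "w \<in> W" "emb w \<in> U" "v = T w" by blast
    then have "emb v = twisting (emb w)" by (simp add: twisting_emb)
    then show "v \<in> ?X" using tw w by auto
  next
    fix w assume w: "w \<in> ?X"
    then obtain v where v: "v \<in> W" "T v = w" using T_surj by blast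
    obtain F where F: "F \<in> U" "emb w = twisting F" using w tw by blast
    have "F = emb v"
    proof (rule twisting_inj)
      show "F \<in> V" using F(1) U by blast
      show "twisting F = twisting (emb v)" using F(2) v by (simp add: twisting_emb)
    qed (rule emb_gen[OF v(1)])
    then show "w \<in> T ` ?X" using F v by auto
  qed
  ultimately have "?X = W" using simple[OF fixed_part_submodule[OF sub]] by blast
  then have "V \<subseteq> U" using gen_fixed_part_subset[OF sub] by simp
  then show "U = V" using U by blast
qed

end

section \<open>Integrals over finitely many cosets\<close>

lemma LINT_blocks:
  fixes h :: "'a \<Rightarrow> complex"
  assumes I: "finite I" and disj: "disjoint_family_on B I"
    and B: "\<And>i. i \<in> I \<Longrightarrow> B i \<in> sets M" "\<And>i. i \<in> I \<Longrightarrow> emeasure M (B i) < \<infinity>"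
    and m: "\<And>i. i \<in> I \<Longrightarrow> measure M (B i) = m"
    and h: "\<And>i x. i \<in> I \<Longrightarrow> x \<in> B i \<Longrightarrow> h x = val i"
    and h0: "\<And>x. x \<in> space M \<Longrightarrow> x \<notin> (\<Union>i\<in>I. B i) \<Longrightarrow> h x = 0"
  shows "(LINT x|M. h x) = of_real m * (\<Sum>i\<in>I. val i)"
proof -
  have sum: "h x = (\<Sum>i\<in>I. indicat_real (B i) x *\<^sub>R val i)" if x: "x \<in> space M" for x
  proof (cases "x \<in> (\<Union>i\<in>I. B i)")
    case True
    then obtain j where j: "j \<in> I" "x \<in> B j" by blast
    have "indicat_real (B i) x *\<^sub>R val i = (if i = j then val j else 0)" if i: "i \<in> I" for i
    proof (cases "i = j")
      case False
      then have "x \<notin> B i" using disjoint_family_onD[OF disj i j(1)] j(2) by blast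
      then show ?thesis using False by simp
    qed (use j in simp)
    then have "(\<Sum>i\<in>I. indicat_real (B i) x *\<^sub>R val i) = (\<Sum>i\<in>I. if i = j then val j else 0)"
      by (intro sum.cong refl)
    then show ?thesis using j I h by simp
  next
    case False
    then have "(\<Sum>i\<in>I. indicat_real (B i) x *\<^sub>R val i) = 0" by (intro sum.neutral) auto
    then show ?thesis using h0[OF x False] by simp
  qed
  have "(LINT x|M. h x) = (LINT x|M. (\<Sum>i\<in>I. indicat_real (B i) x *\<^sub>R val i))"
    using sum by (intro Bochner_Integration.integral_cong refl)
  also have "\<dots> = (\<Sum>i\<in>I. measure M (B i) *\<^sub>R val i)"
    by (intro has_bochner_integral_integral_eq has_bochner_integral_sum
        has_bochner_integral_scaleR_left has_bochner_integral_real_indicator B)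
  also have "\<dots> = of_real m * (\<Sum>i\<in>I. val i)"
    by (simp add: m scaleR_conv_of_real sum_distrib_left)
  finally show ?thesis .
qed

lemma simple_integral_blocks:
  fixes F :: "'a \<Rightarrow> 'v::ab_group_add"
  assumes vs: "complex_space s"
    and I: "finite I" and disj: "disjoint_family_on B I"
    and B: "\<And>i. i \<in> I \<Longrightarrow> B i \<in> sets M" "\<And>i. i \<in> I \<Longrightarrow> emeasure M (B i) < \<infinity>"
      "\<And>i. i \<in> I \<Longrightarrow> B i \<noteq> {}"
    and m: "\<And>i. i \<in> I \<Longrightarrow> measure M (B i) = m"
    and F: "\<And>i x. i \<in> I \<Longrightarrow> x \<in> B i \<Longrightarrow> F x = val i"
    and F0: "\<And>x. x \<in> space M \<Longrightarrow> x \<notin> (\<Union>i\<in>I. B i) \<Longrightarrow> F x = 0"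
  shows "simple_integral s M F = (\<Sum>i\<in>I. s (of_real m) (val i))"
proof -
  interpret complex_space s by (rule vs)
  let ?J = "{i \<in> I. val i \<noteq> 0}"
  have B_space: "x \<in> space M" if "i \<in> I" "x \<in> B i" for i x
    using sets.sets_into_space[OF B(1)[OF that(1)]] that(2) by blast
  have img: "F ` space M - {0} = val ` ?J"
  proof (intro Set.set_eqI iffI)
    fix v assume "v \<in> F ` space M - {0}"
    then obtain x where x: "x \<in> space M" "v = F x" "v \<noteq> 0" by blast
    then obtain i where "i \<in> I" "x \<in> B i" using F0 by blast
    then show "v \<in> val ` ?J" using F x by auto
  next
    fix v assume "v \<in> val ` ?J"
    then obtain i where i: "i \<in> I" "v = val i" "v \<noteq> 0" by blast
    then obtain x where "x \<in> B i" using B(3) by blast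
    then show "v \<in> F ` space M - {0}" using i F[OF i(1)] B_space[OF i(1)] by (intro DiffI) force+
  qed
  have lvl: "measure M {x \<in> space M. F x = v} = (\<Sum>i\<in>{i\<in>?J. val i = v}. m)" if v: "v \<noteq> 0" for v
  proof -
    have "{x \<in> space M. F x = v} = (\<Union>i\<in>{i\<in>?J. val i = v}. B i)"
    proof (intro Set.set_eqI iffI)
      fix x assume x: "x \<in> {x \<in> space M. F x = v}"
      then obtain i where "i \<in> I" "x \<in> B i" using F0[of x] v by blast
      then show "x \<in> (\<Union>i\<in>{i\<in>?J. val i = v}. B i)" using F[of i x] x v by auto
    next
      fix x assume "x \<in> (\<Union>i\<in>{i\<in>?J. val i = v}. B i)"
      then show "x \<in> {x \<in> space M. F x = v}" using F B_space by auto
    qed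
    moreover have "disjoint_family_on B {i\<in>?J. val i = v}"
      by (rule disjoint_family_on_mono[OF _ disj]) auto
    moreover have "emeasure M (B i) \<noteq> \<infinity>" if "i \<in> I" for i using B(2)[OF that] by auto
    ultimately have "measure M {x \<in> space M. F x = v} = (\<Sum>i\<in>{i\<in>?J. val i = v}. measure M (B i))"
      using I B(1) by (auto intro!: measure_finite_Union)
    then show ?thesis using m by simp
  qed
  have "simple_integral s M F =
      (\<Sum>v\<in>val ` ?J. s (of_real (\<Sum>i\<in>{i\<in>?J. val i = v}. m)) v)"
    unfolding simple_integral_def img using lvl by (intro sum.cong refl) auto
  also have "\<dots> = (\<Sum>v\<in>val ` ?J. \<Sum>i\<in>{i\<in>?J. val i = v}. s (of_real m) (val i))"
  proof (rule sum.cong[OF refl])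
    fix v
    have "s (of_real (\<Sum>i\<in>{i\<in>?J. val i = v}. m)) v = (\<Sum>i\<in>{i\<in>?J. val i = v}. s (of_real m) v)"
      by (simp only: of_real_sum scale_sum_left)
    also have "\<dots> = (\<Sum>i\<in>{i\<in>?J. val i = v}. s (of_real m) (val i))" by (rule sum.cong) auto
    finally show "s (of_real (\<Sum>i\<in>{i\<in>?J. val i = v}. m)) v = \<dots>" .
  qed
  also have "\<dots> = (\<Sum>i\<in>?J. s (of_real m) (val i))"
    using I by (intro sum.group) auto
  also have "\<dots> = (\<Sum>i\<in>I. s (of_real m) (val i))"
    using I by (intro sum.mono_neutral_left) auto
  finally show ?thesis .
qed

lemma space_borel_sets [simp]: "space (borel_sets X) = topspace X"
  unfolding borel_sets_def by (rule space_measure_of) (auto dest: openin_subset)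

lemma sets_borel_sets: "sets (borel_sets X) = sigma_sets (topspace X) {U. openin X U}"
  unfolding borel_sets_def by (rule sets_measure_of) (auto dest: openin_subset)

lemma open_borel_sets: "openin X U \<Longrightarrow> U \<in> sets (borel_sets X)"
  by (auto simp: sets_borel_sets)

lemma continuous_measurable_borel_sets:
  assumes "continuous_map X Y f" "sets M = sets (borel_sets X)"
  shows "f \<in> measurable M (borel_sets Y)"
proof (rule measurable_sigma_sets[OF sets_borel_sets])
  have sp: "space M = topspace X" using sets_eq_imp_space_eq[OF assms(2)] by simp
  show "{U. openin Y U} \<subseteq> Pow (topspace Y)" by (auto dest: openin_subset)
  show "f \<in> space M \<rightarrow> topspace Y" using continuous_map_funspace[OF assms(1)] sp by simp
  fix U assume "U \<in> {U. openin Y U}"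
  then have "openin X {x \<in> topspace X. f x \<in> U}"
    using openin_continuous_map_preimage[OF assms(1)] by simp
  moreover have "f -` U \<inter> space M = {x \<in> topspace X. f x \<in> U}" using sp by auto
  ultimately show "f -` U \<inter> space M \<in> sets M" using assms(2) open_borel_sets by metis
qed

locale haar_pair = open_compact_pair G K for G :: "'g topgroup" (structure) and K :: "'g set" +
  fixes \<mu> :: "'g measure"
  assumes haar: "left_haar_measure G \<mu>"
begin

lemma sets_\<mu>: "sets \<mu> = sets (borel_sets (gtop G))"
  using haar by (simp add: left_haar_measure_def)

lemma space_\<mu> [simp]: "space \<mu> = carrier G"
  using sets_eq_imp_space_eq[OF sets_\<mu>] by simp

abbreviation vol :: real where "vol \<equiv> measure \<mu> K"

lemma coset_sets: "x \<in> carrier G \<Longrightarrow> x <# K \<in> sets \<mu>"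
  using open_coset[OF open_K] open_borel_sets sets_\<mu> by metis

lemma K_sets: "K \<in> sets \<mu>"
  using open_K open_borel_sets sets_\<mu> by metis

lemma emeasure_coset: "x \<in> carrier G \<Longrightarrow> emeasure \<mu> (x <# K) = emeasure \<mu> K"
  using haar K_sets unfolding left_haar_measure_def by blast

lemma emeasure_coset_finite: "x \<in> carrier G \<Longrightarrow> emeasure \<mu> (x <# K) < \<infinity>"
  using haar compact_K emeasure_coset unfolding left_haar_measure_def by metis

lemma measure_coset: "x \<in> carrier G \<Longrightarrow> measure \<mu> (x <# K) = vol"
  by (simp add: measure_def emeasure_coset)

text \<open>By inner regularity, a Haar measure vanishing on \<open>K\<close> would vanish on every compact set, and then on \<open>G\<close>.\<close>

lemma vol_pos: "vol > 0"
proof (rule ccontr)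
  assume "\<not> vol > 0"
  then have "vol = 0" using measure_nonneg[of \<mu> K] by linarith
  moreover have "emeasure \<mu> K < \<infinity>" using haar compact_K by (simp add: left_haar_measure_def)
  ultimately have K0: "emeasure \<mu> K = 0" by (auto simp: measure_def enn2real_eq_0_iff)
  have C0: "emeasure \<mu> C = 0" if C: "compactin (gtop G) C" for C
  proof -
    have C_carrier: "C \<subseteq> carrier G" using compactin_subset_topspace[OF C] by simp
    have "C \<subseteq> \<Union>((\<lambda>x. x <# K) ` C)"
      using coset_eq_iff[OF subgroup_K] C_carrier by blast
    moreover have fin: "finite ((\<lambda>x. x <# K) ` C)" using finite_cosets[OF subgroup_K open_K C] .
    moreover have U: "\<Union>((\<lambda>x. x <# K) ` C) \<in> sets \<mu>"
      using fin coset_sets C_carrier by (intro sets.finite_Union) auto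
    ultimately have "emeasure \<mu> C \<le> emeasure \<mu> (\<Union>((\<lambda>x. x <# K) ` C))"
      by (intro emeasure_mono)
    also have "\<dots> = 0"
    proof -
      have "\<Union>((\<lambda>x. x <# K) ` C) \<in> null_sets \<mu>"
        using fin coset_sets emeasure_coset K0 C_carrier
        by (intro null_sets.finite_Union) (auto intro!: null_setsI)
      then show ?thesis by (rule null_setsD1)
    qed
    finally show ?thesis by simp
  qed
  have "openin (gtop G) (carrier G)" using openin_topspace[of "gtop G"] by simp
  then have "emeasure \<mu> (carrier G) = (SUP C\<in>{C. compactin (gtop G) C \<and> C \<subseteq> carrier G}. emeasure \<mu> C)"
    using haar by (simp add: left_haar_measure_def)
  also have "\<dots> = 0" using C0 by (auto simp: bot_ennreal intro!: antisym SUP_least)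
  finally show False using haar by (simp add: left_haar_measure_def)
qed

lemma disjoint_cosets:
  assumes "\<And>C. C \<in> \<C> \<Longrightarrow> \<exists>y\<in>carrier G. C = y <# K"
  shows "disjoint_family_on (\<lambda>C. C) \<C>"
  unfolding disjoint_family_on_def
proof (intro ballI impI)
  fix C D assume CD: "C \<in> \<C>" "D \<in> \<C>" "C \<noteq> D"
  then obtain y z where yz: "y \<in> carrier G" "C = y <# K" "z \<in> carrier G" "D = z <# K"
    using assms by metis
  have "False" if "x \<in> C" "x \<in> D" for x
  proof -
    have "x \<in> carrier G"
      using that(1) yz l_coset_subset_G[OF subgroup.subset[OF subgroup_K]] by blast
    then show False using that yz coset_eq_iff[OF subgroup_K] CD(3) by metis
  qed
  then show "C \<inter> D = {}" by blast
qed

lemma LINT_cosets: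
  fixes h :: "'g \<Rightarrow> complex"
  assumes \<C>: "finite \<C>" "\<And>C. C \<in> \<C> \<Longrightarrow> \<exists>y\<in>carrier G. C = y <# K"
    and h: "\<And>x k. x \<in> carrier G \<Longrightarrow> k \<in> K \<Longrightarrow> h (x \<otimes> k) = h x"
    and supp: "\<And>x. x \<in> carrier G \<Longrightarrow> h x \<noteq> 0 \<Longrightarrow> x <# K \<in> \<C>"
  shows "(LINT x|\<mu>. h x) = of_real vol * (\<Sum>C\<in>\<C>. h (rep C))"
proof (rule LINT_blocks[where B = "\<lambda>C. C", OF \<C>(1) disjoint_cosets[OF \<C>(2)]])
  fix C x assume C: "C \<in> \<C>" "x \<in> C"
  then obtain y where y: "y \<in> carrier G" "C = y <# K" using \<C>(2) by blast
  obtain k where "k \<in> K" "x = y \<otimes> k" using C(2) y(2) by (auto simp: l_coset_def)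
  then show "h x = h (rep C)" using h y fun_rep_coset[OF subgroup_K y(1), of h] by simp
next
  fix x assume x: "x \<in> space \<mu>" "x \<notin> (\<Union>C\<in>\<C>. C)"
  then have "x \<in> x <# K" using coset_eq_iff[OF subgroup_K, of x x] by simp
  then show "h x = 0" using supp[of x] x by auto
qed (use \<C>(2) coset_sets measure_coset emeasure_coset_finite in \<open>blast+\<close>)

lemma LINT_coset:
  fixes h :: "'g \<Rightarrow> complex"
  assumes y: "y \<in> carrier G"
    and h: "\<And>x k. x \<in> carrier G \<Longrightarrow> k \<in> K \<Longrightarrow> h (x \<otimes> k) = h x"
    and supp: "\<And>x. x \<in> carrier G \<Longrightarrow> h x \<noteq> 0 \<Longrightarrow> x \<in> y <# K"
  shows "(LINT x|\<mu>. h x) = of_real vol * h y"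
proof -
  have "x <# K = y <# K" if "x \<in> carrier G" "h x \<noteq> 0" for x
    using supp[OF that] coset_eq_iff[OF subgroup_K y that(1)] by simp
  then have "(LINT x|\<mu>. h x) = of_real vol * (\<Sum>C\<in>{y <# K}. h (rep C))"
    using y h by (intro LINT_cosets) auto
  then show ?thesis using fun_rep_coset[OF subgroup_K y, of h] h by simp
qed

section \<open>The Hecke algebra\<close>

definition supp_cosets :: "('g \<Rightarrow> complex) \<Rightarrow> 'g set set" where
  "supp_cosets f = {x <# K |x. x \<in> carrier G \<and> f x \<noteq> 0}"

lemma supp_cosets_coset: "C \<in> supp_cosets f \<Longrightarrow> \<exists>y\<in>carrier G. C = y <# K"
  by (auto simp: supp_cosets_def)

definition bi_invariant :: "('g \<Rightarrow> complex) \<Rightarrow> bool" where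
  "bi_invariant f \<longleftrightarrow> (\<forall>x. x \<notin> carrier G \<longrightarrow> f x = 0) \<and>
     (\<forall>k\<in>K. \<forall>k'\<in>K. \<forall>x\<in>carrier G. f (k \<otimes> x \<otimes> k') = f x)"

lemma bi_invariant_D:
  assumes "bi_invariant f" "x \<in> carrier G" "k \<in> K"
  shows "f (k \<otimes> x) = f x" "f (x \<otimes> k) = f x"
proof -
  have "f (k \<otimes> x \<otimes> \<one>) = f x" "f (\<one> \<otimes> x \<otimes> k) = f x"
    using assms K_closed(1) unfolding bi_invariant_def by blast+
  then show "f (k \<otimes> x) = f x" "f (x \<otimes> k) = f x" using assms(2,3) by simp_all
qed

lemma bi_invariant_orb:
  assumes "bi_invariant f" "x \<in> carrier G" "y \<in> carrier G" "orb x = orb y" shows "f x = f y"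
proof -
  obtain k k' where "k \<in> K" "k' \<in> K" "x = k \<otimes> y \<otimes> k'" using orb_eqE assms by metis
  then show ?thesis using assms by (simp add: bi_invariant_def)
qed

text \<open>Local constancy makes continuity automatic and reduces compact support to finitely many cosets.\<close>

lemma hecke_iff: "f \<in> hecke G K \<longleftrightarrow> bi_invariant f \<and> finite (supp_cosets f)"
proof
  assume f: "f \<in> hecke G K"
  let ?Z = "{x \<in> carrier G. f x \<noteq> 0}"
  have C: "compactin (gtop G) (gtop G closure_of ?Z)" using f by (simp add: hecke_def)
  have "?Z \<subseteq> gtop G closure_of ?Z" by (rule closure_of_subset) auto
  then have "supp_cosets f \<subseteq> (\<lambda>x. x <# K) ` (gtop G closure_of ?Z)"
    by (auto simp: supp_cosets_def)
  then show "bi_invariant f \<and> finite (supp_cosets f)"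
    using f finite_subset[OF _ finite_cosets[OF subgroup_K open_K C]] by (simp add: hecke_def bi_invariant_def)
next
  assume f: "bi_invariant f \<and> finite (supp_cosets f)"
  have self: "x \<in> x <# K" if "x \<in> carrier G" for x
    using coset_eq_iff[OF subgroup_K that that] by simp
  have cosetD: "y \<in> carrier G \<and> f y = f x" if "x \<in> carrier G" "y \<in> x <# K" for x y
    using that f bi_invariant_D(2)[of f x] by (auto simp: l_coset_def)
  have "openin (gtop G) {x \<in> carrier G. f x \<in> U}" for U
  proof (subst openin_subopen, intro ballI)
    fix x assume x: "x \<in> {x \<in> carrier G. f x \<in> U}"
    then have "x <# K \<subseteq> {x \<in> carrier G. f x \<in> U}" using cosetD by auto
    then show "\<exists>T. openin (gtop G) T \<and> x \<in> T \<and> T \<subseteq> {x \<in> carrier G. f x \<in> U}"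
      using x self open_coset[OF open_K] by blast
  qed
  then have cont: "continuous_map (gtop G) euclidean f"
    by (simp add: continuous_map_def)
  have Z: "{x \<in> carrier G. f x \<noteq> 0} = \<Union>(supp_cosets f)"
  proof (intro Set.set_eqI iffI)
    fix x assume "x \<in> {x \<in> carrier G. f x \<noteq> 0}"
    then show "x \<in> \<Union>(supp_cosets f)" using self by (auto simp: supp_cosets_def)
  next
    fix x assume "x \<in> \<Union>(supp_cosets f)"
    then show "x \<in> {x \<in> carrier G. f x \<noteq> 0}" using cosetD by (auto simp: supp_cosets_def)
  qed
  have comp: "compactin (gtop G) (\<Union>(supp_cosets f))"
    using f compact_coset by (intro compactin_Union) (auto simp: supp_cosets_def)
  then have "closedin (gtop G) (\<Union>(supp_cosets f))"
    using hausdorff compactin_imp_closedin by blast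
  then have "gtop G closure_of {x \<in> carrier G. f x \<noteq> 0} = \<Union>(supp_cosets f)"
    unfolding Z by (rule closure_of_closedin)
  then show "f \<in> hecke G K" using f cont comp by (simp add: hecke_def bi_invariant_def)
qed

lemma hecke_D:
  assumes "f \<in> hecke G K"
  shows "bi_invariant f" "\<And>x. x \<notin> carrier G \<Longrightarrow> f x = 0"
    "\<And>x k. x \<in> carrier G \<Longrightarrow> k \<in> K \<Longrightarrow> f (k \<otimes> x) = f x"
    "\<And>x k. x \<in> carrier G \<Longrightarrow> k \<in> K \<Longrightarrow> f (x \<otimes> k) = f x"
  using assms bi_invariant_D by (auto simp: hecke_iff bi_invariant_def)

text \<open>The indicator function of \<open>KgK\<close>, normalised to have integral 1.\<close>

definition dchar :: "'g \<Rightarrow> 'g \<Rightarrow> complex" where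
  "dchar g x = (if x \<in> carrier G \<and> orb x = orb g then 1 / (of_nat (card (orb g)) * of_real vol) else 0)"

lemma dchar_cong: "orb g = orb g' \<Longrightarrow> dchar g = dchar g'"
  by (simp add: dchar_def fun_eq_iff)

lemma bi_invariant_dchar: "bi_invariant (dchar g)"
  by (auto simp: bi_invariant_def dchar_def orb_left orb_right)

lemma dchar_hecke: assumes "g \<in> carrier G" shows "dchar g \<in> hecke G K"
proof -
  have "supp_cosets (dchar g) \<subseteq> orb g"
    using orb_eq_iff assms by (auto simp: supp_cosets_def dchar_def split: if_splits)
  then show ?thesis using bi_invariant_dchar finite_orb[OF assms] finite_subset by (auto simp: hecke_iff)
qed

lemma orb_one_iff: "x \<in> carrier G \<Longrightarrow> orb x = orb \<one> \<longleftrightarrow> x \<in> K"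
proof -
  assume x: "x \<in> carrier G"
  have "x <# K = K \<longleftrightarrow> x \<in> K"
    using coset_eq_iff[OF subgroup_K, of \<one> x] x lcos_mult_one[OF subgroup.subset[OF subgroup_K]] by auto
  then show "orb x = orb \<one> \<longleftrightarrow> x \<in> K" using orb_eq_iff[OF x one_closed] orb_one by simp
qed

lemma dchar_one: "x \<in> carrier G \<Longrightarrow> dchar \<one> x = (if x \<in> K then 1 / of_real vol else 0)"
  by (simp add: dchar_def orb_one_iff) (simp add: orb_one)

text \<open>Every double coset \<open>KgK\<close> is counted once for each of its left cosets, which cancels the number of
  cosets in the normalisation of \<open>dchar g\<close>.\<close>

lemma sum_dchar:
  assumes f: "bi_invariant f" and \<C>: "finite \<C>" "\<And>C. C \<in> \<C> \<Longrightarrow> \<exists>y\<in>carrier G. C = y <# K"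
    and supp: "\<And>x. x \<in> carrier G \<Longrightarrow> f x \<noteq> 0 \<Longrightarrow> x <# K \<in> \<C>"
  shows "f = (\<lambda>x. \<Sum>C\<in>\<C>. (of_real vol * f (rep C)) * dchar (rep C) x)"
proof
  fix x
  show "f x = (\<Sum>C\<in>\<C>. (of_real vol * f (rep C)) * dchar (rep C) x)"
  proof (cases "x \<in> carrier G")
    case x: True
    have eq: "(of_real vol * f (rep C)) * dchar (rep C) x =
        (if C \<in> orb x then f x / of_nat (card (orb x)) else 0)" if C: "C \<in> \<C>" for C
    proof -
      obtain y where y: "y \<in> carrier G" "C = y <# K" using \<C>(2)[OF C] by blast
      have r: "rep C \<in> carrier G" "rep C <# K = C" using rep_coset_carrier[OF subgroup_K y(1)] y(2) by auto
      then have "orb (rep C) = orb x \<longleftrightarrow> C \<in> orb x" using orb_eq_iff[OF r(1) x] by simp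
      moreover have "f (rep C) = f x" if "orb (rep C) = orb x"
        using bi_invariant_orb[OF f r(1) x that] .
      ultimately show ?thesis using x vol_pos by (auto simp: dchar_def)
    qed
    have "(\<Sum>C\<in>\<C>. (of_real vol * f (rep C)) * dchar (rep C) x) =
        (\<Sum>C\<in>\<C>. if C \<in> orb x then f x / of_nat (card (orb x)) else 0)"
      using eq by (intro sum.cong refl)
    also have "\<dots> = (\<Sum>C\<in>\<C> \<inter> orb x. f x / of_nat (card (orb x)))"
      by (rule sum.inter_restrict[symmetric, OF \<C>(1)])
    also have "\<dots> = f x"
    proof (cases "f x = 0")
      case False
      have "C \<in> \<C>" if C: "C \<in> orb x" for C
        using supp[of "rep C"] orb_rep[OF x C] bi_invariant_orb[OF f _ x, of "rep C"] False by simp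
      then have "\<C> \<inter> orb x = orb x" by blast
      then show ?thesis using card_orb[OF x] by simp
    qed simp
    finally show ?thesis by simp
  next
    case False
    then show ?thesis using f by (simp add: bi_invariant_def dchar_def)
  qed
qed

text \<open>Only the coset \<open>K\<close> contributes to the integral.\<close>

lemma conv_dchar_one:
  assumes f: "f \<in> hecke G K" shows "conv G \<mu> (dchar \<one>) f = f"
proof
  fix x
  show "conv G \<mu> (dchar \<one>) f x = f x"
  proof (cases "x \<in> carrier G")
    case x: True
    have "(LINT g|\<mu>. dchar \<one> g * f (inv g \<otimes> x)) = of_real vol * (dchar \<one> \<one> * f (inv \<one> \<otimes> x))"
    proof (rule LINT_coset)
      fix g k assume "g \<in> carrier G" "k \<in> K"
      then show "dchar \<one> (g \<otimes> k) * f (inv (g \<otimes> k) \<otimes> x) = dchar \<one> g * f (inv g \<otimes> x)"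
        using x hecke_D[OF f] bi_invariant_D[OF bi_invariant_dchar] by (simp add: inv_mult_group m_assoc)
    next
      fix g assume g: "g \<in> carrier G" "dchar \<one> g * f (inv g \<otimes> x) \<noteq> 0"
      then have "g \<in> K" by (auto simp: dchar_one split: if_splits)
      then show "g \<in> \<one> <# K" using subgroup.subset[OF subgroup_K] by (simp add: lcos_mult_one)
    qed simp
    then show ?thesis using x vol_pos by (simp add: conv_def dchar_one)
  next
    case False
    then show ?thesis using hecke_D[OF f] by (simp add: conv_def)
  qed
qed

lemma conv_dchar:
  assumes y: "y \<in> carrier G" and g: "g \<in> carrier G" and u: "u \<in> carrier G"
  shows "conv G \<mu> (dchar y) (dchar g) u =
    (1 / of_nat (card (orb y))) * (\<Sum>X\<in>orb y. dchar g (inv (rep X) \<otimes> u))"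
proof -
  let ?n = "of_nat (card (orb y)) :: complex"
  have "(LINT v|\<mu>. dchar y v * dchar g (inv v \<otimes> u)) =
      of_real vol * (\<Sum>X\<in>orb y. dchar y (rep X) * dchar g (inv (rep X) \<otimes> u))"
  proof (rule LINT_cosets[OF finite_orb[OF y] orb_coset[OF y]])
    fix v k assume "v \<in> carrier G" "k \<in> K"
    then show "dchar y (v \<otimes> k) * dchar g (inv (v \<otimes> k) \<otimes> u) = dchar y v * dchar g (inv v \<otimes> u)"
      using u bi_invariant_D[OF bi_invariant_dchar] by (simp add: inv_mult_group m_assoc)
  next
    fix v assume "v \<in> carrier G" "dchar y v * dchar g (inv v \<otimes> u) \<noteq> 0"
    then show "v <# K \<in> orb y" using orb_eq_iff[OF _ y] by (auto simp: dchar_def split: if_splits)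
  qed
  also have "\<dots> = of_real vol * (\<Sum>X\<in>orb y. 1 / (?n * of_real vol) * dchar g (inv (rep X) \<otimes> u))"
    using orb_rep[OF y] by (intro arg_cong2[where f = "(*)"] sum.cong refl) (simp add: dchar_def)
  also have "\<dots> = (1 / ?n) * (\<Sum>X\<in>orb y. dchar g (inv (rep X) \<otimes> u))"
    using vol_pos by (simp add: sum_distrib_left)
  finally show ?thesis using u by (simp add: conv_def)
qed

lemma bi_invariant_conv_dchar:
  assumes y: "y \<in> carrier G" and g: "g \<in> carrier G"
  shows "bi_invariant (conv G \<mu> (dchar y) (dchar g))"
  unfolding bi_invariant_def
proof (intro conjI allI impI ballI)
  fix k k' u assume k: "k \<in> K" "k' \<in> K" and u: "u \<in> carrier G"
  let ?h = "\<lambda>z. dchar g (inv z \<otimes> u)"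
  have "(\<Sum>X\<in>orb y. dchar g (inv (rep X) \<otimes> (k \<otimes> u \<otimes> k'))) = (\<Sum>X\<in>orb y. ?h (inv k \<otimes> rep X))"
  proof (rule sum.cong[OF refl])
    fix X assume "X \<in> orb y"
    then have r: "rep X \<in> carrier G" using orb_rep[OF y] by blast
    have "inv (rep X) \<otimes> (k \<otimes> u \<otimes> k') = (inv (inv k \<otimes> rep X) \<otimes> u) \<otimes> k'"
      using r k u by (simp add: inv_mult_group m_assoc)
    then show "dchar g (inv (rep X) \<otimes> (k \<otimes> u \<otimes> k')) = ?h (inv k \<otimes> rep X)"
      using bi_invariant_D(2)[OF bi_invariant_dchar _ k(2)] r k(1) u by simp
  qed
  also have "\<dots> = (\<Sum>X\<in>(\<lambda>C. inv k <# C) ` orb y. ?h (rep X))"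
    by (rule sum_translate[symmetric, OF subgroup_K])
      (use k u orb_coset[OF y] bi_invariant_D(1)[OF bi_invariant_dchar] in \<open>auto simp: inv_mult_group m_assoc\<close>)
  also have "(\<lambda>C. inv k <# C) ` orb y = orb y" using translate_orb k y by simp
  finally show "conv G \<mu> (dchar y) (dchar g) (k \<otimes> u \<otimes> k') = conv G \<mu> (dchar y) (dchar g) u"
    using y g u k by (simp add: conv_dchar)
qed (simp add: conv_def)

end

section \<open>Modules over the Hecke algebra\<close>

locale haar_module = haar_pair G K \<mu> + complex_space s
  for G :: "'g topgroup" (structure) and K :: "'g set" and \<mu> :: "'g measure"
    and s :: "complex \<Rightarrow> 'w::ab_group_add \<Rightarrow> 'w" +
  fixes W :: "'w set" and a :: "('g \<Rightarrow> complex) \<Rightarrow> 'w \<Rightarrow> 'w"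
  assumes module: "hecke_module G \<mu> K s W a"
begin

lemma W_subspace: "subspace W"
  and a_linear: "f \<in> hecke G K \<Longrightarrow> linear_between s W s W (a f)"
  and a_add: "f \<in> hecke G K \<Longrightarrow> f' \<in> hecke G K \<Longrightarrow> w \<in> W \<Longrightarrow> a (\<lambda>x. f x + f' x) w = a f w + a f' w"
  and a_scale: "f \<in> hecke G K \<Longrightarrow> w \<in> W \<Longrightarrow> a (\<lambda>x. c * f x) w = s c (a f w)"
  and a_conv: "f \<in> hecke G K \<Longrightarrow> f' \<in> hecke G K \<Longrightarrow> w \<in> W \<Longrightarrow> a (conv G \<mu> f f') w = a f (a f' w)"
  using module by (auto simp: hecke_module_def)

lemma a_W [simp]: "f \<in> hecke G K \<Longrightarrow> w \<in> W \<Longrightarrow> a f w \<in> W"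
  using a_linear[of f] by (auto simp: linear_between_def)

lemma a_zero: assumes "f \<in> hecke G K" shows "a f 0 = 0"
proof -
  have "a f (s 0 0) = s 0 (a f 0)"
    using a_linear[OF assms] subspace_0[OF W_subspace] unfolding linear_between_def by blast
  then show ?thesis by simp
qed

definition E :: "'g \<Rightarrow> 'w \<Rightarrow> 'w" where
  "E g = a (dchar g)"

lemma E_cong: "orb g = orb g' \<Longrightarrow> E g = E g'"
  unfolding E_def by (metis dchar_cong)

lemma E_left: "k \<in> K \<Longrightarrow> g \<in> carrier G \<Longrightarrow> E (k \<otimes> g) = E g"
  and E_right: "k \<in> K \<Longrightarrow> g \<in> carrier G \<Longrightarrow> E (g \<otimes> k) = E g"
  by (intro E_cong orb_left orb_right; simp)+

lemma E_closed [simp]: "g \<in> carrier G \<Longrightarrow> w \<in> W \<Longrightarrow> E g w \<in> W"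
  by (simp add: E_def dchar_hecke)

lemma hecke_scale: assumes "f \<in> hecke G K" shows "(\<lambda>x. c * f x) \<in> hecke G K"
proof -
  have "supp_cosets (\<lambda>x. c * f x) \<subseteq> supp_cosets f" by (auto simp: supp_cosets_def)
  then show ?thesis using assms finite_subset by (auto simp: hecke_iff bi_invariant_def)
qed

lemma hecke_add:
  assumes "f \<in> hecke G K" "f' \<in> hecke G K" shows "(\<lambda>x. f x + f' x) \<in> hecke G K"
proof -
  have "supp_cosets (\<lambda>x. f x + f' x) \<subseteq> supp_cosets f \<union> supp_cosets f'"
  proof
    fix C assume "C \<in> supp_cosets (\<lambda>x. f x + f' x)"
    then obtain x where x: "x \<in> carrier G" "C = x <# K" "f x + f' x \<noteq> 0"
      by (auto simp: supp_cosets_def)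
    then have "f x \<noteq> 0 \<or> f' x \<noteq> 0" by auto
    then show "C \<in> supp_cosets f \<union> supp_cosets f'" using x by (auto simp: supp_cosets_def)
  qed
  then show ?thesis using assms finite_subset by (auto simp: hecke_iff bi_invariant_def)
qed

lemma a_sum_dchar:
  assumes "finite I" "\<And>i. i \<in> I \<Longrightarrow> g i \<in> carrier G" and w: "w \<in> W"
  shows "(\<lambda>x. \<Sum>i\<in>I. c i * dchar (g i) x) \<in> hecke G K \<and>
    a (\<lambda>x. \<Sum>i\<in>I. c i * dchar (g i) x) w = (\<Sum>i\<in>I. s (c i) (E (g i) w))"
  using assms(1,2)
proof (induction I)
  case empty
  have "(\<lambda>x. 0 * dchar \<one> x) \<in> hecke G K" "a (\<lambda>x. 0 * dchar \<one> x) w = 0"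
    using hecke_scale[of "dchar \<one>" 0] a_scale[of "dchar \<one>" w 0] dchar_hecke w by simp_all
  then show ?case by simp
next
  case (insert i I)
  have i: "dchar (g i) \<in> hecke G K" using insert.prems dchar_hecke by simp
  have IH: "(\<lambda>x. \<Sum>i\<in>I. c i * dchar (g i) x) \<in> hecke G K"
    "a (\<lambda>x. \<Sum>i\<in>I. c i * dchar (g i) x) w = (\<Sum>i\<in>I. s (c i) (E (g i) w))"
    using insert by auto
  show ?case
    using insert.hyps IH hecke_add[OF hecke_scale[OF i, of "c i"] IH(1)]
      a_add[OF hecke_scale[OF i, of "c i"] IH(1) w] a_scale[OF i w, of "c i"]
    by (simp add: E_def)
qed

lemma a_expand:
  assumes f: "bi_invariant f" and \<C>: "finite \<C>" "\<And>C. C \<in> \<C> \<Longrightarrow> \<exists>y\<in>carrier G. C = y <# K"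
    and supp: "\<And>x. x \<in> carrier G \<Longrightarrow> f x \<noteq> 0 \<Longrightarrow> x <# K \<in> \<C>" and w: "w \<in> W"
  shows "a f w = (\<Sum>C\<in>\<C>. s (of_real vol * f (rep C)) (E (rep C) w))"
proof -
  have r: "rep C \<in> carrier G" if C: "C \<in> \<C>" for C
    using \<C>(2)[OF C] rep_coset_carrier[OF subgroup_K] by auto
  have "a f w = a (\<lambda>x. \<Sum>C\<in>\<C>. (of_real vol * f (rep C)) * dchar (rep C) x) w"
    using sum_dchar[OF f \<C> supp] by simp
  then show ?thesis using a_sum_dchar[OF \<C>(1) r w] by simp
qed

lemma a_expand_supp:
  assumes f: "f \<in> hecke G K" and w: "w \<in> W"
  shows "a f w = (\<Sum>C\<in>supp_cosets f. s (of_real vol * f (rep C)) (E (rep C) w))"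
proof (rule a_expand)
  show "finite (supp_cosets f)" "bi_invariant f" using f by (auto simp: hecke_iff)
qed (use w supp_cosets_coset in \<open>auto simp: supp_cosets_def\<close>)

text \<open>The product of the normalised indicator functions of \<open>KyK\<close> and \<open>KgK\<close> is the average over
  \<open>xzK\<close>, with \<open>xK\<close> in \<open>KyK\<close> and \<open>zK\<close> in \<open>KgK\<close>. After summation over \<open>z\<close> the terms no longer depend
  on \<open>x\<close>, because \<open>K\<close> permutes the cosets \<open>zK\<close>.\<close>

lemma E_product:
  assumes y: "y \<in> carrier G" and g: "g \<in> carrier G" and w: "w \<in> W"
  shows "s (of_nat (card (orb g))) (E y (E g w)) = (\<Sum>D\<in>orb g. E (y \<otimes> rep D) w)"
proof -
  let ?f = "conv G \<mu> (dchar y) (dchar g)"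
  let ?n = "of_nat (card (orb y)) :: complex" and ?m = "of_nat (card (orb g)) :: complex"
  have n: "?n \<noteq> 0" "?m \<noteq> 0" using card_orb y g by auto
  define \<C> where "\<C> = (\<Union>X\<in>orb y. (\<lambda>D. rep X <# D) ` orb g)"
  define B where "B x = (\<Sum>D\<in>orb g. E (x \<otimes> rep D) w)" for x
  have ry: "rep X \<in> carrier G" if "X \<in> orb y" for X using orb_rep[OF y that] by simp
  have rg: "rep D \<in> carrier G" if "D \<in> orb g" for D using orb_rep[OF g that] by simp
  have fin: "finite \<C>" unfolding \<C>_def using finite_orb y g by blast
  have cosets: "\<exists>z\<in>carrier G. C = z <# K" if "C \<in> \<C>" for C
  proof -
    obtain X D where "X \<in> orb y" "D \<in> orb g" and C: "C = rep X <# D"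
      using \<open>C \<in> \<C>\<close> unfolding \<C>_def by blast
    then have r: "rep X \<in> carrier G" "rep D \<in> carrier G" "rep D <# K = D"
      using ry orb_rep[OF g] by auto
    then have "C = (rep X \<otimes> rep D) <# K" using translate_coset[OF subgroup_K r(1,2)] C by simp
    then show ?thesis using r by blast
  qed
  have rC: "rep C \<in> carrier G" if C: "C \<in> \<C>" for C
    using cosets[OF C] rep_coset_carrier[OF subgroup_K] by auto
  \<comment> \<open>For fixed \<open>x\<close> in \<open>KyK\<close>, only the cosets in \<open>xKgK\<close> contribute.\<close>
  have mem: "u <# K \<in> (\<lambda>D. rep X <# D) ` orb g"
    if X: "X \<in> orb y" and u: "u \<in> carrier G" and ne: "dchar g (inv (rep X) \<otimes> u) \<noteq> 0" for X u
  proof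
    have "orb (inv (rep X) \<otimes> u) = orb g" using ne by (auto simp: dchar_def split: if_splits)
    then show "(inv (rep X) \<otimes> u) <# K \<in> orb g" using orb_eq_iff g ry[OF X] u by simp
    show "u <# K = rep X <# ((inv (rep X) \<otimes> u) <# K)"
      using translate_coset[OF subgroup_K, of "rep X" "inv (rep X) \<otimes> u"] ry[OF X] u by simp
  qed
  have "a ?f w = (\<Sum>C\<in>\<C>. s (of_real vol * ?f (rep C)) (E (rep C) w))"
  proof (rule a_expand[OF bi_invariant_conv_dchar[OF y g] fin cosets _ w])
    fix u assume u: "u \<in> carrier G" "?f u \<noteq> 0"
    then have "(\<Sum>X\<in>orb y. dchar g (inv (rep X) \<otimes> u)) \<noteq> 0" by (auto simp: conv_dchar[OF y g])
    then obtain X where X: "X \<in> orb y" "dchar g (inv (rep X) \<otimes> u) \<noteq> 0" by (meson sum.neutral)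
    show "u <# K \<in> \<C>" using mem[OF X(1) u(1) X(2)] X(1) unfolding \<C>_def by blast
  qed
  also have "\<dots> = (\<Sum>C\<in>\<C>. \<Sum>X\<in>orb y. s (of_real vol / ?n * dchar g (inv (rep X) \<otimes> rep C)) (E (rep C) w))"
    by (intro sum.cong refl) (simp add: conv_dchar[OF y g rC] sum_distrib_left scale_sum_left)
  also have "\<dots> = (\<Sum>X\<in>orb y. \<Sum>C\<in>\<C>. s (of_real vol / ?n * dchar g (inv (rep X) \<otimes> rep C)) (E (rep C) w))"
    by (rule sum.swap)
  also have "\<dots> = (\<Sum>X\<in>orb y. s (1 / (?n * ?m)) (B (rep X)))"
  proof (rule sum.cong[OF refl])
    fix X assume X: "X \<in> orb y"
    let ?h = "\<lambda>u. s (of_real vol / ?n * dchar g (inv (rep X) \<otimes> u)) (E u w)"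
    have "(\<Sum>C\<in>\<C>. ?h (rep C)) = (\<Sum>C\<in>(\<lambda>D. rep X <# D) ` orb g. ?h (rep C))"
    proof (rule sum.mono_neutral_right[OF fin])
      show "(\<lambda>D. rep X <# D) ` orb g \<subseteq> \<C>" using X unfolding \<C>_def by blast
      show "\<forall>C\<in>\<C> - (\<lambda>D. rep X <# D) ` orb g. ?h (rep C) = 0"
      proof
        fix C assume C: "C \<in> \<C> - (\<lambda>D. rep X <# D) ` orb g"
        then have "rep C <# K = C" using cosets rep_coset_carrier[OF subgroup_K] by fastforce
        then have "dchar g (inv (rep X) \<otimes> rep C) = 0" using mem[OF X, of "rep C"] rC C by auto
        then show "?h (rep C) = 0" by simp
      qed
    qed
    also have "\<dots> = (\<Sum>D\<in>orb g. ?h (rep X \<otimes> rep D))"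
    proof (rule sum_translate[OF subgroup_K ry[OF X] orb_coset[OF g]])
      fix z k assume z: "z \<in> carrier G" and k: "k \<in> K"
      have "dchar g (inv (rep X) \<otimes> (z \<otimes> k)) = dchar g ((inv (rep X) \<otimes> z) \<otimes> k)"
        using z k ry[OF X] by (simp add: m_assoc)
      also have "\<dots> = dchar g (inv (rep X) \<otimes> z)"
        using bi_invariant_D(2)[OF bi_invariant_dchar _ k] z ry[OF X] by simp
      finally show "?h (z \<otimes> k) = ?h z" using E_right[OF k z] by simp
    qed
    also have "\<dots> = (\<Sum>D\<in>orb g. s (1 / (?n * ?m)) (E (rep X \<otimes> rep D) w))"
    proof (rule sum.cong[OF refl])
      fix D assume D: "D \<in> orb g"
      have "dchar g (inv (rep X) \<otimes> (rep X \<otimes> rep D)) = 1 / (?m * of_real vol)"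
        using ry[OF X] orb_rep[OF g D] by (simp add: dchar_def)
      then show "?h (rep X \<otimes> rep D) = s (1 / (?n * ?m)) (E (rep X \<otimes> rep D) w)"
        using vol_pos by simp
    qed
    finally show "(\<Sum>C\<in>\<C>. ?h (rep C)) = s (1 / (?n * ?m)) (B (rep X))"
      by (simp add: B_def scale_sum_right)
  qed
  also have "\<dots> = (\<Sum>X\<in>orb y. s (1 / (?n * ?m)) (B y))"
  proof (rule sum.cong[OF refl])
    fix X assume X: "X \<in> orb y"
    obtain k k' where k: "k \<in> K" "k' \<in> K" "rep X = k \<otimes> y \<otimes> k'"
      using orb_eqE[OF _ y] orb_rep[OF y X] by metis
    have "B (rep X) = (\<Sum>D\<in>orb g. E (y \<otimes> (k' \<otimes> rep D)) w)"
      unfolding B_def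
    proof (rule sum.cong[OF refl])
      fix D assume "D \<in> orb g"
      then have "rep X \<otimes> rep D = k \<otimes> (y \<otimes> (k' \<otimes> rep D))" using k y rg by (simp add: m_assoc)
      then show "E (rep X \<otimes> rep D) w = E (y \<otimes> (k' \<otimes> rep D)) w"
        using E_left[OF k(1)] k y rg[OF \<open>D \<in> orb g\<close>] by simp
    qed
    also have "\<dots> = (\<Sum>D\<in>(\<lambda>C. k' <# C) ` orb g. E (y \<otimes> rep D) w)"
    proof (rule sum_translate[symmetric, OF subgroup_K _ orb_coset[OF g]])
      fix z l assume "z \<in> carrier G" "l \<in> K"
      then show "E (y \<otimes> (z \<otimes> l)) w = E (y \<otimes> z) w" using y by (simp add: m_assoc[symmetric] E_right)
    qed (use k in simp)
    also have "\<dots> = B y" by (simp only: translate_orb[OF k(2) g] B_def)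
    finally show "s (1 / (?n * ?m)) (B (rep X)) = s (1 / (?n * ?m)) (B y)" by simp
  qed
  also have "\<dots> = s (1 / ?m) (B y)" using n by (simp add: sum_constant_scale)
  finally have "a ?f w = s (1 / ?m) (B y)" .
  then have "E y (E g w) = s (1 / ?m) (B y)"
    using a_conv[OF dchar_hecke[OF y] dchar_hecke[OF g] w] by (simp add: E_def)
  then show ?thesis using n by (simp add: B_def)
qed

text \<open>The functions \<open>dchar g\<close> span the Hecke algebra.\<close>

lemma invariant_subspace_hecke:
  "invariant_subspace s (a ` hecke G K) W = invariant_subspace s (E ` carrier G) W"
proof (rule ext)
  fix X
  show "invariant_subspace s (a ` hecke G K) W X = invariant_subspace s (E ` carrier G) W X"
  proof
    assume "invariant_subspace s (a ` hecke G K) W X"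
    then show "invariant_subspace s (E ` carrier G) W X"
      using dchar_hecke by (auto simp: invariant_subspace_def E_def)
  next
    assume X: "invariant_subspace s (E ` carrier G) W X"
    then have sub: "X \<subseteq> W" "subspace X" "\<And>g w. g \<in> carrier G \<Longrightarrow> w \<in> X \<Longrightarrow> E g w \<in> X"
      by (auto simp: invariant_subspace_def)
    have "a f w \<in> X" if f: "f \<in> hecke G K" and w: "w \<in> X" for f w
    proof -
      have "s c (E (rep C) w) \<in> X" if C: "C \<in> supp_cosets f" for c C
        using supp_cosets_coset[OF C] rep_coset_carrier[OF subgroup_K] sub w
        by (auto intro!: subspace_scale)
      moreover have "w \<in> W" using w sub by blast
      ultimately show ?thesis by (simp add: a_expand_supp[OF f] subspace_sum[OF sub(2)])
    qed
    then show "invariant_subspace s (a ` hecke G K) W X"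
      using sub by (auto simp: invariant_subspace_def)
  qed
qed

end

text \<open>The assumptions on \<open>b\<close> will make \<open>T = b (push e)\<close> bijective, where \<open>push e\<close> is the normalised
  indicator function of \<open>K\<delta>\<^sub>1\<close>.\<close>

locale twisted_module = twisted_pair G K S \<omega> \<delta>\<^sub>1 + haar_module G K \<mu> s W a
  for G :: "'g topgroup" (structure) and K :: "'g set" and S :: "('g, 'x) twisted"
    and \<omega> :: "'g \<Rightarrow> complex" and \<delta>\<^sub>1 :: 'x and \<mu> :: "'g measure"
    and s :: "complex \<Rightarrow> 'w::ab_group_add \<Rightarrow> 'w" and W :: "'w set"
    and a :: "('g \<Rightarrow> complex) \<Rightarrow> 'w \<Rightarrow> 'w" +
  fixes b :: "('x \<Rightarrow> complex) \<Rightarrow> 'w \<Rightarrow> 'w"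
  assumes tw_module: "twisted_hecke_module G S \<omega> \<mu> K s W a b"
    and no_killed: "no_killed_vectors S K W b"
    and nondegenerate: "nondegenerate S K s W b"
begin

text \<open>Functions on the twisted space are identified with functions on the group through the
  base point.\<close>

definition push :: "('g \<Rightarrow> complex) \<Rightarrow> 'x \<Rightarrow> complex" where
  "push f = (\<lambda>\<delta>. if \<delta> \<in> topspace (stop S) then f (pt' \<delta>) else 0)"

definition pull :: "('x \<Rightarrow> complex) \<Rightarrow> 'g \<Rightarrow> complex" where
  "pull \<phi> = (\<lambda>x. if x \<in> carrier G then \<phi> (pt x) else 0)"

lemma point_cases:
  assumes "\<delta> \<in> topspace (stop S)" obtains x where "x \<in> carrier G" "\<delta> = pt x"
  using that[of "pt' \<delta>"] assms by simp

lemma push_pt [simp]: "x \<in> carrier G \<Longrightarrow> push f (pt x) = f x"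
  by (simp add: push_def)

lemma push_cong: "(\<And>x. x \<in> carrier G \<Longrightarrow> f x = f' x) \<Longrightarrow> push f = push f'"
  by (auto simp: push_def)

lemma continuous_pt': "continuous_map (stop S) (gtop G) pt'"
proof -
  obtain j where j: "homeomorphic_maps (gtop G) (stop S) pt j"
    using pt_homeomorphic homeomorphic_map_maps by blast
  have "j \<delta> = pt' \<delta>" if "\<delta> \<in> topspace (stop S)" for \<delta>
  proof -
    have "j (pt (pt' \<delta>)) = pt' \<delta>"
      using j pt'_closed[OF that] by (simp add: homeomorphic_maps_def del: pt_pt')
    then show ?thesis using that by simp
  qed
  then show ?thesis using j continuous_map_eq unfolding homeomorphic_maps_def by blast
qed

lemma image_pt_support:
  "{\<delta> \<in> topspace (stop S). \<phi> \<delta> \<noteq> 0} = pt ` {x \<in> carrier G. \<phi> (pt x) \<noteq> 0}"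
  using pt_pt' by (force elim: point_cases)

lemma closure_pt: "A \<subseteq> carrier G \<Longrightarrow> stop S closure_of (pt ` A) = pt ` (gtop G closure_of A)"
  using homeomorphic_map_closure_of[OF pt_homeomorphic] by simp

lemma compact_pt_iff: "A \<subseteq> carrier G \<Longrightarrow> compactin (stop S) (pt ` A) \<longleftrightarrow> compactin (gtop G) A"
  using homeomorphic_map_compactness[OF pt_homeomorphic] by simp

lemma push_hecke: assumes f: "f \<in> hecke G K" shows "push f \<in> hecke_tw S K"
  unfolding hecke_tw_def
proof (intro CollectI conjI allI impI ballI)
  have "continuous_map (stop S) euclidean (f \<circ> pt')"
    using f by (intro continuous_map_compose[OF continuous_pt']) (simp add: hecke_def)
  then show "continuous_map (stop S) euclidean (push f)"
    by (rule continuous_map_eq) (simp add: push_def)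
  have "{\<delta> \<in> topspace (stop S). push f \<delta> \<noteq> 0} = pt ` {x \<in> carrier G. f x \<noteq> 0}"
    unfolding image_pt_support by (intro image_cong Collect_cong) auto
  moreover have "compactin (gtop G) (gtop G closure_of {x \<in> carrier G. f x \<noteq> 0})"
    using f by (simp add: hecke_def)
  ultimately show "compactin (stop S) (stop S closure_of {\<delta> \<in> topspace (stop S). push f \<delta> \<noteq> 0})"
    using closure_pt compact_pt_iff closure_of_subset_topspace[of "gtop G"] by auto
  fix k k' \<delta> assume k: "k \<in> K" "k' \<in> K" and "\<delta> \<in> topspace (stop S)"
  then obtain x where "x \<in> carrier G" "\<delta> = pt x" using point_cases by blast
  then show "push f (lact S k (ract S \<delta> k')) = push f \<delta>"
    using k hecke_D[OF f] by (simp add: ract_pt lact_pt)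
qed (simp add: push_def)

lemma pull_hecke: assumes \<phi>: "\<phi> \<in> hecke_tw S K" shows "pull \<phi> \<in> hecke G K"
  unfolding hecke_def
proof (intro CollectI conjI allI impI ballI)
  have "continuous_map (gtop G) euclidean (\<phi> \<circ> pt)"
    using \<phi> by (intro continuous_map_compose[OF homeomorphic_imp_continuous_map[OF pt_homeomorphic]])
      (simp add: hecke_tw_def)
  then show "continuous_map (gtop G) euclidean (pull \<phi>)"
    by (rule continuous_map_eq) (simp add: pull_def)
  have "{x \<in> carrier G. pull \<phi> x \<noteq> 0} = {x \<in> carrier G. \<phi> (pt x) \<noteq> 0}" by (auto simp: pull_def)
  moreover have "compactin (stop S) (stop S closure_of (pt ` {x \<in> carrier G. \<phi> (pt x) \<noteq> 0}))"
    using \<phi> unfolding hecke_tw_def image_pt_support[symmetric] by simp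
  ultimately show "compactin (gtop G) (gtop G closure_of {x \<in> carrier G. pull \<phi> x \<noteq> 0})"
    using closure_pt[of "{x \<in> carrier G. \<phi> (pt x) \<noteq> 0}"]
      compact_pt_iff[of "gtop G closure_of {x \<in> carrier G. \<phi> (pt x) \<noteq> 0}"]
      closure_of_subset_topspace[of "gtop G"] by auto
  fix k k' x assume k: "k \<in> K" "k' \<in> K" and x: "x \<in> carrier G"
  have "\<phi> (lact S k (ract S (pt x) (\<theta>' k'))) = \<phi> (pt x)"
    using \<phi> k x by (simp add: hecke_tw_def)
  then show "pull \<phi> (k \<otimes> x \<otimes> k') = pull \<phi> x"
    using k x by (simp add: ract_pt lact_pt pull_def m_assoc)
qed (simp add: pull_def)

lemma push_pull: assumes "\<phi> \<in> hecke_tw S K" shows "push (pull \<phi>) = \<phi>"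
proof
  fix \<delta>
  show "push (pull \<phi>) \<delta> = \<phi> \<delta>"
    using assms by (cases "\<delta> \<in> topspace (stop S)") (auto simp: push_def pull_def hecke_tw_def)
qed

abbreviation e :: "'g \<Rightarrow> complex" where "e \<equiv> dchar \<one>"

lemma e_hecke: "e \<in> hecke G K"
  by (simp add: dchar_hecke)

text \<open>The function \<open>push e\<close> generates the bimodule: convolution with it identifies the Hecke algebra
  with the functions on the twisted space, from either side up to \<open>\<theta>\<close>.\<close>

lemma lconv_push_e: assumes f: "f \<in> hecke G K" shows "lconv G S \<mu> f (push e) = push f"
proof
  fix \<delta>
  show "lconv G S \<mu> f (push e) \<delta> = push f \<delta>"
  proof (cases "\<delta> \<in> topspace (stop S)")
    case True
    then obtain x where x: "x \<in> carrier G" "\<delta> = pt x" using point_cases by blast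
    have "(LINT g|\<mu>. f g * push e (lact S (inv g) \<delta>)) = (LINT g|\<mu>. f g * e (inv g \<otimes> x))"
      using x by (intro Bochner_Integration.integral_cong refl) (simp add: lact_pt)
    also have "\<dots> = of_real vol * (f x * e (inv x \<otimes> x))"
    proof (rule LINT_coset[OF x(1)])
      fix g k assume "g \<in> carrier G" "k \<in> K"
      then show "f (g \<otimes> k) * e (inv (g \<otimes> k) \<otimes> x) = f g * e (inv g \<otimes> x)"
        using x hecke_D[OF f] bi_invariant_D[OF bi_invariant_dchar] by (simp add: inv_mult_group m_assoc)
    next
      fix g assume g: "g \<in> carrier G" "f g * e (inv g \<otimes> x) \<noteq> 0"
      then have "inv g \<otimes> x \<in> K" using x by (auto simp: dchar_one split: if_splits)
      then have "inv (inv g \<otimes> x) \<in> K" by simp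
      moreover have "inv (inv g \<otimes> x) = inv x \<otimes> g" using g x by (simp add: inv_mult_group)
      ultimately show "g \<in> x <# K"
        using coset_eq_preimage[OF x(1) subgroup.subset[OF subgroup_K]] g by simp
    qed
    finally show ?thesis using x True vol_pos by (simp add: lconv_def dchar_one)
  qed (simp add: lconv_def push_def)
qed

lemma rconv_push_e: assumes f: "f \<in> hecke G K" shows "rconv G S \<mu> (push f) e = push f"
proof
  fix \<delta>
  show "rconv G S \<mu> (push f) e \<delta> = push f \<delta>"
  proof (cases "\<delta> \<in> topspace (stop S)")
    case True
    then obtain x where x: "x \<in> carrier G" "\<delta> = pt x" using point_cases by blast
    have "(LINT g|\<mu>. push f (ract S \<delta> g) * e (inv g)) = (LINT g|\<mu>. f (x \<otimes> \<theta> g) * e (inv g))"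
      using x by (intro Bochner_Integration.integral_cong refl) (simp add: ract_pt)
    also have "\<dots> = of_real vol * (f (x \<otimes> \<theta> \<one>) * e (inv \<one>))"
    proof (rule LINT_coset[OF one_closed])
      fix g k assume "g \<in> carrier G" "k \<in> K"
      then show "f (x \<otimes> \<theta> (g \<otimes> k)) * e (inv (g \<otimes> k)) = f (x \<otimes> \<theta> g) * e (inv g)"
        using x hecke_D[OF f] bi_invariant_D[OF bi_invariant_dchar]
        by (simp add: inv_mult_group \<theta>_mult m_assoc[symmetric])
    next
      fix g assume g: "g \<in> carrier G" "f (x \<otimes> \<theta> g) * e (inv g) \<noteq> 0"
      then have "inv g \<in> K" by (auto simp: dchar_one split: if_splits)
      then have "inv (inv g) \<in> K" by (rule K_closed)
      then show "g \<in> \<one> <# K" using g subgroup.subset[OF subgroup_K] by (simp add: lcos_mult_one)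
    qed
    finally show ?thesis using x True vol_pos hecke_D(4)[OF f x(1), of "\<theta> \<one>"]
      by (simp add: rconv_def dchar_one)
  qed (simp add: rconv_def push_def)
qed

lemma rconv_e_push:
  assumes f: "f \<in> hecke G K" shows "rconv G S \<mu> (push e) f = push (\<lambda>x. f (\<theta>' x))"
proof
  fix \<delta>
  show "rconv G S \<mu> (push e) f \<delta> = push (\<lambda>x. f (\<theta>' x)) \<delta>"
  proof (cases "\<delta> \<in> topspace (stop S)")
    case True
    then obtain x where x: "x \<in> carrier G" "\<delta> = pt x" using point_cases by blast
    have "(LINT g|\<mu>. push e (ract S \<delta> g) * f (inv g)) = (LINT g|\<mu>. e (x \<otimes> \<theta> g) * f (inv g))"
      using x by (intro Bochner_Integration.integral_cong refl) (simp add: ract_pt)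
    \<comment> \<open>The first factor vanishes unless \<open>x \<theta>(g)\<close> lies in \<open>K\<close>, that is, unless \<open>g\<close> lies in the coset of \<open>\<theta>\<^sup>-\<^sup>1(x)\<^sup>-\<^sup>1\<close>.\<close>
    also have "\<dots> = of_real vol * (e (x \<otimes> \<theta> (inv (\<theta>' x))) * f (inv (inv (\<theta>' x))))"
    proof (rule LINT_coset)
      fix g k assume "g \<in> carrier G" "k \<in> K"
      then show "e (x \<otimes> \<theta> (g \<otimes> k)) * f (inv (g \<otimes> k)) = e (x \<otimes> \<theta> g) * f (inv g)"
        using x hecke_D[OF f] bi_invariant_D[OF bi_invariant_dchar]
        by (simp add: inv_mult_group \<theta>_mult m_assoc[symmetric])
    next
      fix g assume g: "g \<in> carrier G" "e (x \<otimes> \<theta> g) * f (inv g) \<noteq> 0"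
      then have "x \<otimes> \<theta> g \<in> K" using x by (auto simp: dchar_one split: if_splits)
      then have "\<theta> (\<theta>' x \<otimes> g) \<in> K" using x g by (simp add: \<theta>_mult)
      then have "\<theta>' x \<otimes> g \<in> K" using \<theta>_K_iff x g by simp
      then show "g \<in> inv (\<theta>' x) <# K"
        using coset_eq_preimage[OF _ subgroup.subset[OF subgroup_K], of "inv (\<theta>' x)"] x g by simp
    qed (use x in simp)
    finally show ?thesis using x True vol_pos by (simp add: rconv_def dchar_one \<theta>_inv)
  qed (simp add: rconv_def push_def)
qed

definition T :: "'w \<Rightarrow> 'w" where
  "T = b (push e)"

lemma b_linear: "\<phi> \<in> hecke_tw S K \<Longrightarrow> linear_between s W s W (b \<phi>)"
  and b_conv: "f \<in> hecke G K \<Longrightarrow> \<phi> \<in> hecke_tw S K \<Longrightarrow> f' \<in> hecke G K \<Longrightarrow> w \<in> W \<Longrightarrow>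
    b (rconv G S \<mu> (lconv G S \<mu> f \<phi>) f') w = a f (b \<phi> (a (\<lambda>x. \<omega> x * f' x) w))"
  using tw_module by (simp_all add: twisted_hecke_module_def)

lemma T_lin: "linear_between s W s W T"
  unfolding T_def using b_linear[OF push_hecke[OF e_hecke]] .

lemma T_closed [simp]: "w \<in> W \<Longrightarrow> T w \<in> W"
  using T_lin by (auto simp: linear_between_def)

lemma \<omega>_dchar: assumes "g \<in> carrier G" shows "(\<lambda>x. \<omega> x * dchar g x) = (\<lambda>x. \<omega> g * dchar g x)"
proof
  fix x
  have "\<omega> x = \<omega> g" if x: "x \<in> carrier G" "orb x = orb g"
  proof -
    obtain k k' where "k \<in> K" "k' \<in> K" "x = k \<otimes> g \<otimes> k'" using orb_eqE[OF x(1) assms x(2)] by metis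
    then show ?thesis using assms by (simp add: \<omega>_mult \<omega>_K)
  qed
  then show "\<omega> x * dchar g x = \<omega> g * dchar g x" by (auto simp: dchar_def)
qed

lemma b_push_e:
  assumes f: "f \<in> hecke G K" and w: "w \<in> W" shows "b (push f) w = a f (T (a e w))"
proof -
  have "b (push f) w = b (rconv G S \<mu> (lconv G S \<mu> f (push e)) e) w"
    by (simp add: lconv_push_e[OF f] rconv_push_e[OF f])
  also have "\<dots> = a f (T (a (\<lambda>x. \<omega> x * e x) w))"
    using b_conv[OF f push_hecke[OF e_hecke] e_hecke w] by (simp add: T_def)
  also have "(\<lambda>x. \<omega> x * e x) = e" using \<omega>_dchar[of \<one>] \<omega>_K[of \<one>] by simp
  finally show ?thesis .
qed

lemma span_b: "W = span {b \<phi> w |\<phi> w. \<phi> \<in> hecke_tw S K \<and> w \<in> W}"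
  using nondegenerate by (simp add: nondegenerate_def hecke_tw_span_def)

text \<open>Vectors of the form \<open>b \<phi> w\<close> lie in the image of the idempotent \<open>a e\<close>, and they span
  \<open>W\<close> by non-degeneracy.\<close>

lemma a_e: assumes "w \<in> W" shows "a e w = w"
proof -
  have "span {b \<phi> w |\<phi> w. \<phi> \<in> hecke_tw S K \<and> w \<in> W} \<subseteq> {w \<in> W. a e w = w}"
  proof (rule span_minimal)
    show "{b \<phi> w |\<phi> w. \<phi> \<in> hecke_tw S K \<and> w \<in> W} \<subseteq> {w \<in> W. a e w = w}"
    proof
      fix v assume "v \<in> {b \<phi> w |\<phi> w. \<phi> \<in> hecke_tw S K \<and> w \<in> W}"
      then obtain \<phi> w where \<phi>: "\<phi> \<in> hecke_tw S K" and w: "w \<in> W" and v: "v = b \<phi> w" by blast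
      let ?f = "pull \<phi>"
      have f: "?f \<in> hecke G K" using pull_hecke[OF \<phi>] .
      have v': "v = a ?f (T (a e w))" using b_push_e[OF f w] v push_pull[OF \<phi>] by simp
      have u: "T (a e w) \<in> W" using w e_hecke by simp
      have "a e v = v"
        unfolding v' using a_conv[OF e_hecke f u] conv_dchar_one[OF f] by simp
      then show "v \<in> {w \<in> W. a e w = w}" using v' f u by simp
    qed
    show "subspace {w \<in> W. a e w = w}"
    proof (rule subspaceI)
      show "0 \<in> {w \<in> W. a e w = w}" using subspace_0[OF W_subspace] a_zero[OF e_hecke] by simp
    qed (use a_linear[OF e_hecke] W_subspace in
        \<open>auto simp: linear_between_def subspace_add subspace_scale\<close>)
  qed
  then show ?thesis using assms span_b by blast
qed

lemma b_push: "f \<in> hecke G K \<Longrightarrow> w \<in> W \<Longrightarrow> b (push f) w = a f (T w)"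
  using b_push_e a_e by simp

lemma b_pull: "\<phi> \<in> hecke_tw S K \<Longrightarrow> w \<in> W \<Longrightarrow> b \<phi> w = a (pull \<phi>) (T w)"
  using b_push[OF pull_hecke] push_pull by metis

text \<open>Both sides are the action of one element of the twisted Hecke bimodule: moving a function on the
  group from the right of \<open>push e\<close> to its left composes it with \<open>\<theta>\<^sup>-\<^sup>1\<close>.\<close>

lemma T_E_\<theta>:
  assumes g: "g \<in> carrier G" and w: "w \<in> W" shows "s (\<omega> g) (T (E g w)) = E (\<theta> g) (T w)"
proof -
  note d = dchar_hecke[OF g]
  have "a e (T (a (\<lambda>x. \<omega> x * dchar g x) w)) = b (rconv G S \<mu> (lconv G S \<mu> e (push e)) (dchar g)) w"
    using b_conv[OF e_hecke push_hecke[OF e_hecke] d w] by (simp add: T_def)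
  also have "\<dots> = b (push (\<lambda>x. dchar g (\<theta>' x))) w"
    by (simp add: lconv_push_e[OF e_hecke] rconv_e_push[OF d])
  also have "push (\<lambda>x. dchar g (\<theta>' x)) = push (dchar (\<theta> g))"
  proof (rule push_cong)
    fix x assume x: "x \<in> carrier G"
    have "orb (\<theta>' x) = orb g \<longleftrightarrow> orb x = orb (\<theta> g)"
      using orb_\<theta>_eq[of "\<theta>' x" g] orb_\<theta>'_eq[of x "\<theta> g"] x g by auto
    then show "dchar g (\<theta>' x) = dchar (\<theta> g) x" using x g card_orb_\<theta> by (simp add: dchar_def)
  qed
  also have "b (push (dchar (\<theta> g))) w = E (\<theta> g) (T w)"
    using b_push[OF dchar_hecke w] g by (simp add: E_def)
  finally have 1: "a e (T (a (\<lambda>x. \<omega> x * dchar g x) w)) = E (\<theta> g) (T w)" .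
  have "a (\<lambda>x. \<omega> x * dchar g x) w = s (\<omega> g) (E g w)"
    unfolding \<omega>_dchar[OF g] using a_scale[OF d w] by (simp add: E_def)
  moreover have "T (s (\<omega> g) (E g w)) = s (\<omega> g) (T (E g w))"
    using T_lin g w by (auto simp: linear_between_def)
  moreover have "s (\<omega> g) (T (E g w)) \<in> W" using g w subspace_scale[OF W_subspace] by simp
  ultimately show ?thesis using 1 a_e by simp
qed

sublocale H: hecke_operators G K s W E
proof
  fix g assume g: "g \<in> carrier G"
  show "linear_between s W s W (E g)" unfolding E_def using a_linear[OF dchar_hecke[OF g]] .
  fix k k' w assume "k \<in> K" "k' \<in> K" "w \<in> W"
  then show "E (k \<otimes> g \<otimes> k') w = E g w" using g by (simp add: E_left E_right)
qed (use W_subspace E_product a_e in \<open>auto simp: E_def\<close>)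

text \<open>Injectivity of \<open>T\<close> is the absence of killed vectors, since \<open>b \<phi> w\<close> is
  \<open>a (pull \<phi>) (T w)\<close>. By the same formula, non-degeneracy says that \<open>T ` W\<close>, which is a submodule,
  generates \<open>W\<close>.\<close>

lemma T_bijective: "bij_betw T W W"
proof -
  have add: "T (v + w) = T v + T w" and scale: "T (s c v) = s c (T v)" if "v \<in> W" "w \<in> W" for v w c
    using T_lin that by (auto simp: linear_between_def)
  have inj: "v = w" if "v \<in> W" "w \<in> W" "T v = T w" for v w
  proof -
    \<comment> \<open>The difference of \<open>v\<close> and \<open>w\<close>, in a form to which additivity and homogeneity of \<open>T\<close> apply.\<close>
    let ?u = "v + s (- 1) w"
    have u: "?u \<in> W" using that subspace_add[OF W_subspace] subspace_scale[OF W_subspace] by blast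
    have "T ?u = T v + s (- 1) (T w)"
      by (simp only: add[OF that(1) subspace_scale[OF W_subspace that(2)]] scale[OF that(2,2)])
    then have "T ?u = 0" using that(3) by simp
    then have "b \<phi> ?u = 0" if \<phi>: "\<phi> \<in> hecke_tw S K" for \<phi>
      using b_pull[OF \<phi> u] a_zero[OF pull_hecke[OF \<phi>]] by simp
    then have "?u = 0" using no_killed u by (auto simp: no_killed_vectors_def)
    then show ?thesis by simp
  qed
  have "span {b \<phi> w |\<phi> w. \<phi> \<in> hecke_tw S K \<and> w \<in> W} \<subseteq> T ` W"
  proof (rule span_minimal)
    show sub: "subspace (T ` W)"
    proof (rule subspaceI)
      have "T (s 0 0) = s 0 (T 0)" using scale[OF H.W_0 H.W_0] .
      then show "0 \<in> T ` W" using H.W_0 by (metis imageI scale_zero_left)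
    next
      fix x y assume "x \<in> T ` W" "y \<in> T ` W"
      then obtain v w where vw: "v \<in> W" "w \<in> W" "x = T v" "y = T w" by blast
      then have "x + y = T (v + w)" using add by simp
      then show "x + y \<in> T ` W" using subspace_add[OF W_subspace vw(1,2)] by blast
    next
      fix c x assume "x \<in> T ` W"
      then obtain v where v: "v \<in> W" "x = T v" by blast
      then have "s c x = T (s c v)" using scale by simp
      then show "s c x \<in> T ` W" using subspace_scale[OF W_subspace v(1)] by blast
    qed
    show "{b \<phi> w |\<phi> w. \<phi> \<in> hecke_tw S K \<and> w \<in> W} \<subseteq> T ` W"
    proof
      fix v assume "v \<in> {b \<phi> w |\<phi> w. \<phi> \<in> hecke_tw S K \<and> w \<in> W}"
      then obtain \<phi> w where \<phi>: "\<phi> \<in> hecke_tw S K" and w: "w \<in> W" and v: "v = b \<phi> w" by blast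
      have E_T: "E g (T w) \<in> T ` W" if g: "g \<in> carrier G" for g
      proof
        show "s (\<omega> (\<theta>' g)) (E (\<theta>' g) w) \<in> W" using g w subspace_scale[OF W_subspace] by simp
        show "E g (T w) = T (s (\<omega> (\<theta>' g)) (E (\<theta>' g) w))"
          using T_E_\<theta>[of "\<theta>' g" w] g w scale[of "E (\<theta>' g) w"] by simp
      qed
      have "s c (E (rep C) (T w)) \<in> T ` W" if C: "C \<in> supp_cosets (pull \<phi>)" for c C
        using supp_cosets_coset[OF C] rep_coset_carrier[OF subgroup_K] E_T subspace_scale[OF sub] by auto
      then show "v \<in> T ` W"
        using w by (simp add: v b_pull[OF \<phi> w] a_expand_supp[OF pull_hecke[OF \<phi>]] subspace_sum[OF sub])
    qed
  qed
  then have "W \<subseteq> T ` W" using span_b by simp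
  then show ?thesis using inj by (auto simp: bij_betw_def inj_on_def)
qed

sublocale tw: twisted_operators G K S \<omega> \<delta>\<^sub>1 s W E T
  by unfold_locales (use T_lin T_bijective T_E_\<theta> in auto)

text \<open>The bimodule is generated by \<open>push e\<close>, whose action is \<open>T\<close>.\<close>

lemma hecke_tw_span_eq:
  assumes X: "H.submodule X" and TX: "T ` X = X" shows "hecke_tw_span S K s b X = X"
  unfolding hecke_tw_span_def
proof (rule antisym)
  have X': "invariant_subspace s (a ` hecke G K) W X" using X by (simp add: invariant_subspace_hecke)
  note sub = H.submodule_D[OF X]
  show "span {b \<phi> w |\<phi> w. \<phi> \<in> hecke_tw S K \<and> w \<in> X} \<subseteq> X"
  proof (rule span_minimal[OF _ sub(2)])
    have "b \<phi> w \<in> X" if \<phi>: "\<phi> \<in> hecke_tw S K" and w: "w \<in> X" for \<phi> w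
    proof -
      have "b \<phi> w = a (pull \<phi>) (T w)" using b_pull[OF \<phi>] sub(1) w by blast
      moreover have "T w \<in> X" using TX w by blast
      ultimately show ?thesis using X' pull_hecke[OF \<phi>] by (auto simp: invariant_subspace_def)
    qed
    then show "{b \<phi> w |\<phi> w. \<phi> \<in> hecke_tw S K \<and> w \<in> X} \<subseteq> X" by blast
  qed
  show "X \<subseteq> span {b \<phi> w |\<phi> w. \<phi> \<in> hecke_tw S K \<and> w \<in> X}"
  proof
    fix x assume "x \<in> X"
    then obtain w where "w \<in> X" "x = T w" using TX by blast
    then have "x \<in> {b \<phi> w |\<phi> w. \<phi> \<in> hecke_tw S K \<and> w \<in> X}"
      using push_hecke[OF e_hecke] unfolding T_def by blast
    then show "x \<in> span {b \<phi> w |\<phi> w. \<phi> \<in> hecke_tw S K \<and> w \<in> X}" by (rule span_base)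
  qed
qed

subsection \<open>The module of fixed vectors\<close>

text \<open>The integral is a sum over left cosets, and its value at \<open>\<one>\<close> is the expansion of \<open>a f w\<close> in
  the operators \<open>E g\<close>.\<close>

lemma rep_hecke_action_emb:
  assumes f: "f \<in> hecke G K" and w: "w \<in> W"
  shows "rep_hecke_action \<mu> H.fscale H.shift f (H.emb w) \<one> = a f w"
proof -
  let ?F = "\<lambda>g. H.fscale (f g) (H.shift g (H.emb w))"
  let ?\<C> = "supp_cosets f"
  have F_right: "?F (g \<otimes> k) = ?F g" if "g \<in> carrier G" "k \<in> K" for g k
    using that hecke_D(4)[OF f that] H.shift_K_emb[OF that(2) w] H.shift_mult[of g k "H.emb w"] by simp
  have "simple_integral H.fscale \<mu> ?F = (\<Sum>C\<in>?\<C>. H.fscale (of_real vol) (?F (rep C)))"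
  proof (rule simple_integral_blocks[where B = "\<lambda>C. C", OF H.fs.complex_space_axioms _ disjoint_cosets[OF supp_cosets_coset]])
    show "finite ?\<C>" using f by (simp add: hecke_iff)
  next
    fix C x assume C: "C \<in> ?\<C>" "x \<in> C"
    then obtain y where y: "y \<in> carrier G" "C = y <# K" using supp_cosets_coset by blast
    obtain k where "k \<in> K" "x = y \<otimes> k" using C(2) y(2) by (auto simp: l_coset_def)
    then show "?F x = ?F (rep C)"
      using F_right y fun_rep_coset[OF subgroup_K y(1), of ?F] by simp
  next
    fix x assume x: "x \<in> space \<mu>" "x \<notin> (\<Union>C\<in>?\<C>. C)"
    then have "x \<in> x <# K" using coset_eq_iff[OF subgroup_K, of x x] by simp
    then have "f x = 0" using x by (auto simp: supp_cosets_def)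
    then show "?F x = 0" by simp
  next
    fix C assume "C \<in> ?\<C>"
    then obtain y where y: "y \<in> carrier G" "C = y <# K" using supp_cosets_coset by blast
    show "C \<in> sets \<mu>" "emeasure \<mu> C < \<infinity>" "measure \<mu> C = vol"
      using y coset_sets emeasure_coset_finite measure_coset by auto
    show "C \<noteq> {}" using y coset_eq_iff[OF subgroup_K, of y y] by auto
  qed
  then have "rep_hecke_action \<mu> H.fscale H.shift f (H.emb w) \<one> =
      (\<Sum>C\<in>?\<C>. s (of_real vol * f (rep C)) (H.shift (rep C) (H.emb w) \<one>))"
    unfolding rep_hecke_action_def by (simp add: sum_fun_apply) (simp add: fun_scale_def)
  also have "\<dots> = (\<Sum>C\<in>?\<C>. s (of_real vol * f (rep C)) (E (rep C) w))"
  proof (rule sum.cong[OF refl])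
    fix C assume "C \<in> ?\<C>"
    then obtain y where y: "y \<in> carrier G" "C = y <# K" using supp_cosets_coset by blast
    then have "rep C \<in> carrier G" using rep_coset_carrier[OF subgroup_K] by simp
    then show "s (of_real vol * f (rep C)) (H.shift (rep C) (H.emb w) \<one>) =
        s (of_real vol * f (rep C)) (E (rep C) w)"
      by (simp add: H.shift_def H.emb_def)
  qed
  finally show ?thesis using a_expand_supp[OF f w] by simp
qed

text \<open>The preimage of a coset under \<open>g \<mapsto> \<delta>\<^sub>0 \<cdot> g\<close> is a left coset of \<open>\<theta>\<^sup>-\<^sup>1(K) = K\<close>, so its volume is that of
  \<open>K\<close> and no modulus appears.\<close>

lemma twisted_haar_pt:
  assumes \<delta>\<^sub>0: "\<delta>\<^sub>0 \<in> topspace (stop S)" and x: "x \<in> carrier G"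
  shows "pt ` (x <# K) \<in> sets (twisted_haar S \<delta>\<^sub>0 \<mu>)"
    "emeasure (twisted_haar S \<delta>\<^sub>0 \<mu>) (pt ` (x <# K)) = emeasure \<mu> K"
proof -
  have "openin (stop S) (pt ` (x <# K))"
    using homeomorphic_imp_open_map[OF pt_homeomorphic] open_coset[OF open_K x] by (simp add: open_map_def)
  then have P: "pt ` (x <# K) \<in> sets (borel_sets (stop S))" by (rule open_borel_sets)
  then show "pt ` (x <# K) \<in> sets (twisted_haar S \<delta>\<^sub>0 \<mu>)" by (simp add: twisted_haar_def)
  have "continuous_map (gtop G) (gtop G) (twist S \<delta>\<^sub>0)" "continuous_map (gtop G) (stop S) (\<lambda>g. lact S g \<delta>\<^sub>0)"
    using twisted \<delta>\<^sub>0 by (auto simp: twisted_space_def intro: homeomorphic_imp_continuous_map)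
  from continuous_map_compose[OF this] have "continuous_map (gtop G) (stop S) (\<lambda>g. ract S \<delta>\<^sub>0 g)"
    by (simp add: ract_def o_def)
  then have meas: "(\<lambda>g. ract S \<delta>\<^sub>0 g) \<in> measurable \<mu> (borel_sets (stop S))"
    using sets_\<mu> by (rule continuous_measurable_borel_sets)
  obtain y where y: "y \<in> carrier G" "\<delta>\<^sub>0 = pt y" using point_cases[OF \<delta>\<^sub>0] by blast
  \<comment> \<open>Chosen so that \<open>y \<theta>(g) \<in> xK\<close> if and only if \<open>g \<in> zK\<close>.\<close>
  let ?z = "inv (\<theta>' (inv x \<otimes> y))"
  have z: "?z \<in> carrier G" using x y by simp
  have "ract S \<delta>\<^sub>0 g \<in> pt ` (x <# K) \<longleftrightarrow> g \<in> ?z <# K" if g: "g \<in> carrier G" for g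
  proof -
    have "pt (y \<otimes> \<theta> g) \<in> pt ` (x <# K) \<longleftrightarrow> y \<otimes> \<theta> g \<in> x <# K"
      using pt_bij y g l_coset_subset_G[OF subgroup.subset[OF subgroup_K] x]
      by (intro inj_on_image_mem_iff[of pt "carrier G"]) (auto simp: bij_betw_def)
    also have "\<dots> \<longleftrightarrow> \<theta> (\<theta>' (inv x \<otimes> y) \<otimes> g) \<in> K"
      using coset_eq_preimage[OF x subgroup.subset[OF subgroup_K]] x y g by (simp add: \<theta>_mult m_assoc)
    also have "\<dots> \<longleftrightarrow> g \<in> ?z <# K"
      using coset_eq_preimage[OF z subgroup.subset[OF subgroup_K]] \<theta>_K_iff x y g by simp
    finally show ?thesis using y g by (simp add: ract_pt)
  qed
  then have "(\<lambda>g. ract S \<delta>\<^sub>0 g) -` (pt ` (x <# K)) \<inter> space \<mu> = ?z <# K"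
    using l_coset_subset_G[OF subgroup.subset[OF subgroup_K] z] by auto
  then show "emeasure (twisted_haar S \<delta>\<^sub>0 \<mu>) (pt ` (x <# K)) = emeasure \<mu> K"
    unfolding twisted_haar_def using emeasure_distr[OF meas P] emeasure_coset[OF z] by simp
qed

lemma rep_hecke_tw_action_emb:
  assumes \<delta>\<^sub>0: "\<delta>\<^sub>0 \<in> topspace (stop S)" and \<phi>: "\<phi> \<in> hecke_tw S K" and w: "w \<in> W"
  shows "rep_hecke_tw_action S \<delta>\<^sub>0 \<mu> H.fscale tw.tw_rep \<phi> (H.emb w) \<one> = b \<phi> w"
proof -
  let ?M = "twisted_haar S \<delta>\<^sub>0 \<mu>"
  let ?f = "pull \<phi>"
  let ?F = "\<lambda>\<delta>. H.fscale (\<phi> \<delta>) (tw.tw_rep \<delta> (H.emb w))"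
  let ?F' = "\<lambda>g. H.fscale (?f g) (H.shift g (H.emb (T w)))"
  let ?\<C> = "supp_cosets ?f"
  have f: "?f \<in> hecke G K" using pull_hecke[OF \<phi>] .
  have Tw: "T w \<in> W" using w by simp
  have F_pt: "?F (pt g) = ?F' g" if "g \<in> carrier G" for g
    using that w by (simp add: pull_def tw.tw_rep_pt tw.twisting_emb)
  have F_right: "?F' (g \<otimes> k) = ?F' g" if "g \<in> carrier G" "k \<in> K" for g k
    using that hecke_D(4)[OF f that] H.shift_K_emb[OF that(2) Tw] H.shift_mult[of g k "H.emb (T w)"] by simp
  have coset_carrier: "C \<subseteq> carrier G" if C: "C \<in> ?\<C>" for C
    using supp_cosets_coset[OF C] l_coset_subset_G[OF subgroup.subset[OF subgroup_K]] by blast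
  have "simple_integral H.fscale ?M ?F = (\<Sum>C\<in>?\<C>. H.fscale (of_real vol) (?F' (rep C)))"
  proof (rule simple_integral_blocks[where B = "\<lambda>C. pt ` C", OF H.fs.complex_space_axioms])
    show "finite ?\<C>" using f by (simp add: hecke_iff)
  next
    show "disjoint_family_on (\<lambda>C. pt ` C) ?\<C>"
      unfolding disjoint_family_on_def
    proof (intro ballI impI)
      fix C D assume CD: "C \<in> ?\<C>" "D \<in> ?\<C>" "C \<noteq> D"
      have "C \<inter> D = {}" using disjoint_family_onD[OF disjoint_cosets[OF supp_cosets_coset] CD] .
      then show "pt ` C \<inter> pt ` D = {}"
        using inj_on_image_Int[OF bij_betw_imp_inj_on[OF pt_bij] coset_carrier coset_carrier] CD
        by (metis image_empty)
    qed
  next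
    fix C \<delta> assume C: "C \<in> ?\<C>" "\<delta> \<in> pt ` C"
    then obtain y where y: "y \<in> carrier G" "C = y <# K" using supp_cosets_coset by blast
    obtain k where "k \<in> K" "\<delta> = pt (y \<otimes> k)" using C(2) y(2) by (auto simp: l_coset_def)
    then show "?F \<delta> = ?F' (rep C)"
      using F_pt[of "y \<otimes> k"] F_right y fun_rep_coset[OF subgroup_K y(1), of ?F'] by simp
  next
    fix \<delta> assume "\<delta> \<in> space ?M" and not: "\<delta> \<notin> (\<Union>C\<in>?\<C>. pt ` C)"
    then have "\<delta> \<in> topspace (stop S)" by (simp add: twisted_haar_def)
    then obtain x where x: "x \<in> carrier G" "\<delta> = pt x" using point_cases by blast
    then have "x \<in> x <# K" using coset_eq_iff[OF subgroup_K, of x x] by simp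
    then have "?f x = 0" using x not by (auto simp: supp_cosets_def)
    then show "?F \<delta> = 0" using F_pt[OF x(1)] x by simp
  next
    fix C assume "C \<in> ?\<C>"
    then obtain y where y: "y \<in> carrier G" "C = y <# K" using supp_cosets_coset by blast
    show "pt ` C \<in> sets ?M" "emeasure ?M (pt ` C) < \<infinity>" "measure ?M (pt ` C) = vol"
      using y twisted_haar_pt[OF \<delta>\<^sub>0 y(1)] emeasure_coset_finite[OF y(1)] emeasure_coset[OF y(1)]
      by (auto simp: measure_def)
    show "pt ` C \<noteq> {}" using y coset_eq_iff[OF subgroup_K, of y y] by auto
  qed
  then have "rep_hecke_tw_action S \<delta>\<^sub>0 \<mu> H.fscale tw.tw_rep \<phi> (H.emb w) \<one> =
      (\<Sum>C\<in>?\<C>. s (of_real vol * ?f (rep C)) (H.shift (rep C) (H.emb (T w)) \<one>))"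
    unfolding rep_hecke_tw_action_def by (simp add: sum_fun_apply) (simp add: fun_scale_def)
  also have "\<dots> = (\<Sum>C\<in>?\<C>. s (of_real vol * ?f (rep C)) (E (rep C) (T w)))"
  proof (rule sum.cong[OF refl])
    fix C assume "C \<in> ?\<C>"
    then obtain y where y: "y \<in> carrier G" "C = y <# K" using supp_cosets_coset by blast
    then have "rep C \<in> carrier G" using rep_coset_carrier[OF subgroup_K] by simp
    then show "s (of_real vol * ?f (rep C)) (H.shift (rep C) (H.emb (T w)) \<one>) =
        s (of_real vol * ?f (rep C)) (E (rep C) (T w))"
      by (simp add: H.shift_def H.emb_def)
  qed
  finally show ?thesis using a_expand_supp[OF f Tw] b_pull[OF \<phi> w] by simp
qed

lemma fixed_vectors_isomorphic:
  assumes \<delta>\<^sub>0: "\<delta>\<^sub>0 \<in> topspace (stop S)"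
  shows "twisted_modules_isomorphic G S K H.fscale (fixed_vectors H.V H.shift K)
    (rep_hecke_action \<mu> H.fscale H.shift) (rep_hecke_tw_action S \<delta>\<^sub>0 \<mu> H.fscale tw.tw_rep) s W a b"
  unfolding twisted_modules_isomorphic_def H.fixed_vectors_eq
proof (intro exI[of _ "\<lambda>F. F \<one>"] conjI ballI)
  show "linear_between H.fscale (H.emb ` W) s W (\<lambda>F. F \<one>)"
    by (auto simp: linear_between_def H.emb_one fun_scale_def)
  show "bij_betw (\<lambda>F. F \<one>) (H.emb ` W) W"
    by (rule bij_betw_byWitness[where f' = H.emb]) (auto simp: H.emb_one)
qed (use rep_hecke_action_emb rep_hecke_tw_action_emb[OF \<delta>\<^sub>0] in \<open>auto simp: H.emb_one\<close>)

end

theorem proposition2: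
  fixes G :: "'g topgroup"
    and S :: "('g, 'x) twisted"
    and \<omega> :: "'g \<Rightarrow> complex"
    and \<delta>\<^sub>0 \<delta>\<^sub>1 :: 'x
    and \<mu> :: "'g measure"
    and \<K>\<^sub>1 :: "'g set set"
    and K :: "'g set"
    and s :: "complex \<Rightarrow> 'w \<Rightarrow> 'w::ab_group_add"
    and W :: "'w set"
    and a :: "('g \<Rightarrow> complex) \<Rightarrow> 'w \<Rightarrow> 'w"
    and b :: "('x \<Rightarrow> complex) \<Rightarrow> 'w \<Rightarrow> 'w"
  assumes "locally_profinite G"
    and "twisted_space G S"
    and "character G \<omega>"
    and "left_haar_measure G \<mu>"
    and "\<delta>\<^sub>0 \<in> topspace (stop S)"
    and "\<delta>\<^sub>1 \<in> topspace (stop S)"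
    and "adapted_system G S \<omega> \<delta>\<^sub>1 \<K>\<^sub>1"
    and "K \<in> \<K>\<^sub>1"
    and "twisted_hecke_module G S \<omega> \<mu> K s W a b"
    and "no_killed_vectors S K W b"
    and "simple_twisted G S K s W a b"
    and "socle s (a ` hecke G K) W \<noteq> {0}"
  shows "semisimple_under s (a ` hecke G K) W \<and>
    (\<exists>(V :: ('g \<Rightarrow> 'w) set) \<pi> P.
       smooth_twisted_rep G S \<omega> (fun_scale s) V \<pi> P \<and>
       irreducible_twisted S (fun_scale s) V P \<and>
       twisted_modules_isomorphic G S K
         (fun_scale s) (fixed_vectors V \<pi> K)
         (rep_hecke_action \<mu> (fun_scale s) \<pi>)
         (rep_hecke_tw_action S \<delta>\<^sub>0 \<mu> (fun_scale s) P)
         s W a b \<and>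
       semisimple_under (fun_scale s) (\<pi> ` carrier G) V \<and>
       (finite_length_under (fun_scale s) (\<pi> ` carrier G) V \<longleftrightarrow>
          finite_length_under s (a ` hecke G K) W) \<and>
       (simple_under (fun_scale s) (\<pi> ` carrier G) V \<longleftrightarrow>
          simple_under s (a ` hecke G K) W))"
proof -
  have tg: "topological_group G" "Hausdorff_space (gtop G)" and G: "group G"
    using assms(1) by (auto simp: locally_profinite_def topological_group_def)
  have K: "open_compact_subgroup G K" "\<And>k. k \<in> K \<Longrightarrow> \<omega> k = 1" "twist S \<delta>\<^sub>1 ` K = K"
    using assms(7,8) by (auto simp: adapted_system_def)
  have module: "hecke_module G \<mu> K s W a"
    using assms(9) by (simp add: twisted_hecke_module_def)
  have nondeg: "nondegenerate S K s W b" and W_ne: "W \<noteq> {0}"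
    and simple: "\<And>U. invariant_subspace s (a ` hecke G K) W U \<Longrightarrow> U \<noteq> {0} \<Longrightarrow>
      hecke_tw_span S K s b U = U \<Longrightarrow> U = W"
    using assms(11) by (auto simp: simple_twisted_def)
  interpret group G by (rule G)
  interpret complex_space s
    using module by (auto simp: hecke_module_def intro: complex_space.intro)
  interpret twisted_module G K S \<omega> \<delta>\<^sub>1 \<mu> s W a b
    by unfold_locales (fact tg K assms(2,3,4,6,9,10) module nondeg)+
  note cong = invariant_subspace_cong[OF invariant_subspace_hecke]
  have simple': "X = W" if "H.submodule X" "X \<noteq> {0}" "T ` X = X" for X
    using simple[OF _ that(2) hecke_tw_span_eq[OF that(1,3)]] that(1)
    by (simp only: invariant_subspace_hecke)
  have ss: "semisimple_under s (E ` carrier G) W"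
  proof (rule tw.W_semisimple)
    show "socle s (E ` carrier G) W \<noteq> {0}" using assms(12) by (simp only: cong(1) not_False_eq_True)
  qed (rule simple')
  note iso = H.fixed_part_iso[OF ss]
  note iso' = invariant_subspace_iso_inv[OF iso]
  note vs = H.fs.vector_space_axioms vector_space_axioms
  note V = H.gen_subspace[of W] H.shift_linear_all and W' = H.W H.E_linear_all
  have "finite_length_under H.fscale (H.shift ` carrier G) H.V \<longleftrightarrow> finite_length_under s (a ` hecke G K) W"
    using invariant_subspace_iso_finite_length[OF iso vs V W']
      invariant_subspace_iso_finite_length[OF iso' vs(2,1) W' V] cong(3) by blast
  moreover have "simple_under H.fscale (H.shift ` carrier G) H.V \<longleftrightarrow> simple_under s (a ` hecke G K) W"
  proof -
    have "H.fixed_part H.V = W"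
      using invariant_subspace_iso_bounds(2)[OF iso vs V W'] .
    moreover have "inv_into {U. H.subrep U} H.fixed_part W = H.V"
      using invariant_subspace_iso_bounds(2)[OF iso' vs(2,1) W' V] .
    ultimately show ?thesis
      using invariant_subspace_iso_simple[OF iso vs V W' H.subrep_gen[OF order_refl]]
        invariant_subspace_iso_simple[OF iso' vs(2,1) W' V H.submodule_W] cong(2) by metis
  qed
  moreover have "semisimple_under s (a ` hecke G K) W"
    using ss by (simp only: semisimple_under_def cong(1))
  moreover have "irreducible_twisted S H.fscale H.V tw.tw_rep"
    by (rule tw.V_irreducible[OF _ W_ne]) (rule simple')
  ultimately show ?thesis
    using tw.V_twisted_rep fixed_vectors_isomorphic[OF assms(5)] H.V_semisimple[OF ss] by blast
qed

end
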